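(* Let $k$ be a field, let $g$ and $d$ be natural numbers, and suppose that $M\in\mathrm{Rep}_k(\mathcal{G}_g^{\mathrm{op}})$ is $d$-smallish. Let $G$ be a graph of genus $g$, let $r$ be a natural number, and let $\underline v=(v_1,\dots,v_r)$ be an ordered $r$-tuple of distinct vertices of $G$. Then there exists a multivariate polynomial $f_{M,G,\underline v}(t_1,\dots,t_r)$ of total degree at most $d$ such that, if $\underline m=(m_1,\dots,m_r)$ is sufficiently large in every coordinate, $$\dim_k M(G(\underline v,\underline m))=f_{M,G,\underline v}(m_1,\dots,m_r).$$
   Context: A graph is a finite CW complex of dimension at most 1; 0-cells are vertices, 1-cells are edges (loops and multiple edges allowed). The genus of a non-empty connected graph is the rank of its first homology; a "graph of genus $g$" is always non-empty and connected. A map of CW complexes between graphs is very cellular if it takes every vertex to a vertex and every edge to either a vertex or an edge. A graph morphism is an equivalence class of very cellular maps under homotopy through very cellular maps. A contraction is a surjective graph morphism with contractible fibers (it amounts to collapsing a set of edges forming a forest, followed by a graph isomorphism). $\mathcal{G}_g$ is the category of graphs of genus $g$ with contractions as morphisms, and $\mathrm{Rep}_k(\mathcal{G}_g^{\mathrm{op}})$ is the category of functors from $\mathcal{G}_g^{\mathrm{op}}$ to $k$-modules. $M$ is finitely generated in degrees $\le d$ if there are finitely many graphs $G_1,\dots,G_s$ of genus $g$, each with at most $d$ edges, and elements $u_i\in M(G_i)$ such that for every $G$, $M(G)$ is spanned by the images of the $u_i$ under the maps $M(G_i)\to M(G)$ induced by all contractions $G\to G_i$. $M$ is $d$-small if it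 is a subquotient of a module that is finitely generated in degrees $\le d$, and $d$-smallish if it admits a (finite) filtration by submodules, $0=M_0\subset\dots\subset M_m=M$, whose associated graded module is $d$-small. For an $r$-tuple $\underline m=(m_1,\dots,m_r)$ of natural numbers, $G(\underline v,\underline m)$ is the graph obtained from $G$ by attaching, for each $i$, $m_i$ new edges to the vertex $v_i$, each having a new vertex (a leaf) as its other endpoint. "Sufficiently large in every coordinate" means that there is a constant $N$ such that the equality holds whenever $m_i\ge N$ for all $i$. The polynomial has rational coefficients. *)

theory Defs
  imports
    "Jordan_Normal_Form.VS_Connect"
    "Graph_Theory.Digraph_Component"
    "HOL-Algebra.AbelCoset"
    "HOL-Library.Poly_Mapping"
    "HOL-Library.FuncSet"
    "HOL-Library.Nat_Bijection"
begin

text \<open>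
  A graph is given by its finite sets of 0-cells and 1-cells together with the two ends
  \<open>tail\<close> and \<open>head\<close> of the attaching map of each 1-cell. The resulting orientation of the
  edges is auxiliary: the morphisms below may reverse it. Cells are labelled by natural numbers,
  which covers every finite graph up to isomorphism.
\<close>

type_synonym cw_graph = "(nat, nat) pre_digraph"

text \<open>
  Cellular first homology. There are no 2-cells, so it is the kernel of the boundary map on
  integral 1-chains.
\<close>

definition homology1 :: "cw_graph \<Rightarrow> (nat \<Rightarrow> int) set" where
  "homology1 G = {z. (\<forall>e. e \<notin> arcs G \<longrightarrow> z e = 0) \<and>
     (\<forall>v\<in>verts G. (\<Sum>e\<in>in_arcs G v. z e) - (\<Sum>e\<in>out_arcs G v. z e) = 0)}"

definition int_independent :: "(nat \<Rightarrow> int) set \<Rightarrow> bool" where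
  "int_independent B \<longleftrightarrow> finite B \<and>
     (\<forall>c :: (nat \<Rightarrow> int) \<Rightarrow> int. (\<forall>e. (\<Sum>z\<in>B. c z * z e) = 0) \<longrightarrow> (\<forall>z\<in>B. c z = 0))"

definition genus :: "cw_graph \<Rightarrow> nat" where
  "genus G = Max {card B | B. B \<subseteq> homology1 G \<and> int_independent B}"

text \<open>The notion of connectedness from the library includes non-emptiness.\<close>

definition graph_of_genus :: "nat \<Rightarrow> cw_graph \<Rightarrow> bool" where
  "graph_of_genus g G \<longleftrightarrow> fin_digraph G \<and> Digraph_Component.connected G \<and> genus G = g"

text \<open>
  Combinatorial description of the homotopy class of a very cellular map that is either constant
  or injective on each open edge: \<open>emap \<phi> e = None\<close> if the edge \<open>e\<close> is sent to a
  vertex, and \<open>emap \<phi> e = Some (e', b)\<close> if it is sent to the edge \<open>e'\<close>, with its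
  orientation reversed iff \<open>b\<close>. For a non-loop \<open>e'\<close> the value of \<open>b\<close> is forced by
  \<open>vmap\<close>; for a loop the two values are two different homotopy classes. Very cellular maps
  that are not of this form have disconnected fibers over points of open edges, so they do not
  occur among contractions.
\<close>

record graph_map =
  vmap :: "nat \<Rightarrow> nat"
  emap :: "nat \<Rightarrow> (nat \<times> bool) option"

definition graph_morphism :: "cw_graph \<Rightarrow> cw_graph \<Rightarrow> graph_map \<Rightarrow> bool" where
  "graph_morphism G H \<phi> \<longleftrightarrow>
     vmap \<phi> \<in> verts G \<rightarrow>\<^sub>E verts H \<and>
     emap \<phi> \<in> extensional (arcs G) \<and>
     (\<forall>e\<in>arcs G. case emap \<phi> e of
          None \<Rightarrow> vmap \<phi> (tail G e) = vmap \<phi> (head G e)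
        | Some (e', b) \<Rightarrow> e' \<in> arcs H \<and>
            (if b
             then vmap \<phi> (tail G e) = head H e' \<and> vmap \<phi> (head G e) = tail H e'
             else vmap \<phi> (tail G e) = tail H e' \<and> vmap \<phi> (head G e) = head H e'))"

definition id_map :: "cw_graph \<Rightarrow> graph_map" where
  "id_map G = \<lparr>vmap = (\<lambda>v\<in>verts G. v), emap = (\<lambda>e\<in>arcs G. Some (e, False))\<rparr>"

text \<open>The composite of \<open>\<phi> : G \<rightarrow> H\<close> followed by \<open>\<psi>\<close>; only the source \<open>G\<close> is needed.\<close>

definition comp_map :: "cw_graph \<Rightarrow> graph_map \<Rightarrow> graph_map \<Rightarrow> graph_map" where
  "comp_map G \<psi> \<phi> =
     \<lparr>vmap = compose (verts G) (vmap \<psi>) (vmap \<phi>),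
      emap = (\<lambda>e\<in>arcs G. case emap \<phi> e of
          None \<Rightarrow> None
        | Some (e1, b1) \<Rightarrow> (case emap \<psi> e1 of
              None \<Rightarrow> None
            | Some (e2, b2) \<Rightarrow> Some (e2, b1 \<noteq> b2)))\<rparr>"

definition vertex_fiber :: "cw_graph \<Rightarrow> graph_map \<Rightarrow> nat \<Rightarrow> cw_graph" where
  "vertex_fiber G \<phi> w =
     \<lparr>verts = {v \<in> verts G. vmap \<phi> v = w},
      arcs = {e \<in> arcs G. emap \<phi> e = None \<and> vmap \<phi> (tail G e) = w},
      tail = tail G, head = head G\<rparr>"

text \<open>
  A graph is contractible iff it is connected with vanishing first homology. The fiber over an
  interior point of an edge \<open>e'\<close> is discrete, with one point for each edge sent to \<open>e'\<close>.
  As contractible fibers are non-empty, surjectivity is subsumed.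
\<close>

definition contraction :: "cw_graph \<Rightarrow> cw_graph \<Rightarrow> graph_map \<Rightarrow> bool" where
  "contraction G H \<phi> \<longleftrightarrow>
     graph_morphism G H \<phi> \<and>
     (\<forall>w\<in>verts H. graph_of_genus 0 (vertex_fiber G \<phi> w)) \<and>
     (\<forall>e'\<in>arcs H. \<exists>!e. e \<in> arcs G \<and> (\<exists>b. emap \<phi> e = Some (e', b)))"

text \<open>
  Contravariant functors to \<open>'k\<close>-vector spaces: \<open>rep_map M G H \<phi>\<close> is the map from
  \<open>M(H)\<close> to \<open>M(G)\<close> induced by \<open>\<phi> : G \<rightarrow> H\<close>.
\<close>

record ('k, 'v) graph_rep =
  rep_obj :: "cw_graph \<Rightarrow> ('k, 'v) module"
  rep_map :: "cw_graph \<Rightarrow> cw_graph \<Rightarrow> graph_map \<Rightarrow> 'v \<Rightarrow> 'v"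

definition is_graph_rep :: "nat \<Rightarrow> ('k :: field, 'v) graph_rep \<Rightarrow> bool" where
  "is_graph_rep g M \<longleftrightarrow>
     (\<forall>G. graph_of_genus g G \<longrightarrow> vectorspace class_ring (rep_obj M G)) \<and>
     (\<forall>G H \<phi>. graph_of_genus g G \<and> graph_of_genus g H \<and> contraction G H \<phi> \<longrightarrow>
        linear_map class_ring (rep_obj M H) (rep_obj M G) (rep_map M G H \<phi>)) \<and>
     (\<forall>G. graph_of_genus g G \<longrightarrow>
        (\<forall>x\<in>carrier (rep_obj M G). rep_map M G G (id_map G) x = x)) \<and>
     (\<forall>G H K \<phi> \<psi>. graph_of_genus g G \<and> graph_of_genus g H \<and> graph_of_genus g K \<and>
        contraction G H \<phi> \<and> contraction H K \<psi> \<longrightarrow>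
        (\<forall>x\<in>carrier (rep_obj M K).
           rep_map M G K (comp_map G \<psi> \<phi>) x = rep_map M G H \<phi> (rep_map M H K \<psi> x)))"

definition rep_iso ::
    "nat \<Rightarrow> ('k :: field, 'v) graph_rep \<Rightarrow> ('k, 'w) graph_rep \<Rightarrow> bool" where
  "rep_iso g M N \<longleftrightarrow> (\<exists>\<eta>.
     (\<forall>G. graph_of_genus g G \<longrightarrow>
        linear_map class_ring (rep_obj M G) (rep_obj N G) (\<eta> G) \<and>
        bij_betw (\<eta> G) (carrier (rep_obj M G)) (carrier (rep_obj N G))) \<and>
     (\<forall>G H \<phi>. graph_of_genus g G \<and> graph_of_genus g H \<and> contraction G H \<phi> \<longrightarrow>
        (\<forall>x\<in>carrier (rep_obj M H). \<eta> G (rep_map M G H \<phi> x) = rep_map N G H \<phi> (\<eta> H x))))"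

definition subrep ::
    "nat \<Rightarrow> ('k :: field, 'v) graph_rep \<Rightarrow> (cw_graph \<Rightarrow> 'v set) \<Rightarrow> bool" where
  "subrep g M A \<longleftrightarrow>
     (\<forall>G. graph_of_genus g G \<longrightarrow> VectorSpace.subspace class_ring (A G) (rep_obj M G)) \<and>
     (\<forall>G H \<phi>. graph_of_genus g G \<and> graph_of_genus g H \<and> contraction G H \<phi> \<longrightarrow>
        rep_map M G H \<phi> ` A H \<subseteq> A G)"

text \<open>
  The quotient \<open>A / B\<close> for subspaces \<open>B \<subseteq> A\<close> of \<open>V\<close>, made of cosets of \<open>B\<close>. The
  fields \<open>mult\<close> and \<open>one\<close> of a module record carry no meaning.
\<close>

definition quotient_module :: "('k, 'v) module \<Rightarrow> 'v set \<Rightarrow> 'v set \<Rightarrow> ('k, 'v set) module" where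
  "quotient_module V A B =
     \<lparr>carrier = (\<lambda>x. B +>\<^bsub>V\<^esub> x) ` A,
      monoid.mult = undefined, one = undefined,
      zero = B,
      add = (\<lambda>X Y. X <+>\<^bsub>V\<^esub> Y),
      smult = (\<lambda>c X. \<Union>x\<in>X. B +>\<^bsub>V\<^esub> (c \<odot>\<^bsub>V\<^esub> x))\<rparr>"

definition quotient_rep ::
    "('k, 'v) graph_rep \<Rightarrow> (cw_graph \<Rightarrow> 'v set) \<Rightarrow> (cw_graph \<Rightarrow> 'v set) \<Rightarrow> ('k, 'v set) graph_rep" where
  "quotient_rep M A B =
     \<lparr>rep_obj = (\<lambda>G. quotient_module (rep_obj M G) (A G) (B G)),
      rep_map = (\<lambda>G H \<phi> X. \<Union>x\<in>X. B G +>\<^bsub>rep_obj M G\<^esub> rep_map M G H \<phi> x)\<rparr>"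

text \<open>Only used for finite \<open>I\<close>, where the direct sum is the direct product.\<close>

definition direct_sum_rep :: "'i set \<Rightarrow> ('i \<Rightarrow> ('k, 'v) graph_rep) \<Rightarrow> ('k, 'i \<Rightarrow> 'v) graph_rep" where
  "direct_sum_rep I M =
     \<lparr>rep_obj = (\<lambda>G.
        \<lparr>carrier = (\<Pi>\<^sub>E i\<in>I. carrier (rep_obj (M i) G)),
         monoid.mult = undefined, one = undefined,
         zero = (\<lambda>i\<in>I. \<zero>\<^bsub>rep_obj (M i) G\<^esub>),
         add = (\<lambda>x y. \<lambda>i\<in>I. x i \<oplus>\<^bsub>rep_obj (M i) G\<^esub> y i),
         smult = (\<lambda>c x. \<lambda>i\<in>I. c \<odot>\<^bsub>rep_obj (M i) G\<^esub> x i)\<rparr>),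
      rep_map = (\<lambda>G H \<phi> x. \<lambda>i\<in>I. rep_map (M i) G H \<phi> (x i))\<rparr>"

definition fin_gen_in_degrees_le :: "nat \<Rightarrow> nat \<Rightarrow> ('k :: field, 'v) graph_rep \<Rightarrow> bool" where
  "fin_gen_in_degrees_le g d M \<longleftrightarrow> (\<exists>U :: (cw_graph \<times> 'v) set. finite U \<and>
     (\<forall>(H, u)\<in>U. graph_of_genus g H \<and> card (arcs H) \<le> d \<and> u \<in> carrier (rep_obj M H)) \<and>
     (\<forall>G. graph_of_genus g G \<longrightarrow>
        LinearCombinations.module.span class_ring (rep_obj M G)
          {rep_map M G H \<phi> u | H u \<phi>. (H, u) \<in> U \<and> contraction G H \<phi>} =
        carrier (rep_obj M G)))"

definition subquotient_rep ::
    "nat \<Rightarrow> ('k :: field, 'v) graph_rep \<Rightarrow> ('k, 'w) graph_rep \<Rightarrow> bool" where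
  "subquotient_rep g M N \<longleftrightarrow> (\<exists>A B. subrep g N A \<and> subrep g N B \<and>
     (\<forall>G. graph_of_genus g G \<longrightarrow> B G \<subseteq> A G) \<and> rep_iso g M (quotient_rep N A B))"

text \<open>
  The type argument is the type in which the finitely generated module takes its values. HOL
  cannot quantify over it existentially inside a formula; as a type variable occurring only in
  the hypothesis of a theorem it amounts to that existential quantifier.
\<close>

definition d_small :: "'w itself \<Rightarrow> nat \<Rightarrow> nat \<Rightarrow> ('k :: field, 'v) graph_rep \<Rightarrow> bool" where
  "d_small TYPE('w) g d M \<longleftrightarrow> (\<exists>N :: ('k, 'w) graph_rep.
     is_graph_rep g N \<and> fin_gen_in_degrees_le g d N \<and> subquotient_rep g M N)"

definition filtration ::
    "nat \<Rightarrow> ('k :: field, 'v) graph_rep \<Rightarrow> nat \<Rightarrow> (nat \<Rightarrow> cw_graph \<Rightarrow> 'v set) \<Rightarrow> bool" where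
  "filtration g M n F \<longleftrightarrow>
     (\<forall>i\<le>n. subrep g M (F i)) \<and>
     (\<forall>G. graph_of_genus g G \<longrightarrow>
        F 0 G = {\<zero>\<^bsub>rep_obj M G\<^esub>} \<and>
        (\<forall>i<n. F i G \<subseteq> F (Suc i) G) \<and>
        F n G = carrier (rep_obj M G))"

definition associated_graded ::
    "('k, 'v) graph_rep \<Rightarrow> nat \<Rightarrow> (nat \<Rightarrow> cw_graph \<Rightarrow> 'v set) \<Rightarrow> ('k, nat \<Rightarrow> 'v set) graph_rep" where
  "associated_graded M n F = direct_sum_rep {..<n} (\<lambda>i. quotient_rep M (F (Suc i)) (F i))"

definition d_smallish :: "'w itself \<Rightarrow> nat \<Rightarrow> nat \<Rightarrow> ('k :: field, 'v) graph_rep \<Rightarrow> bool" where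
  "d_smallish TYPE('w) g d M \<longleftrightarrow>
     (\<exists>n F. filtration g M n F \<and> d_small TYPE('w) g d (associated_graded M n F))"

text \<open>
  The graph \<open>G(vs, ms)\<close>: the \<open>j\<close>-th new edge at \<open>vs ! i\<close> (for \<open>j < ms ! i\<close>) and the leaf
  at its other end get the labels \<open>prod_encode (i, j)\<close>, shifted beyond all labels used in
  \<open>G\<close>.
\<close>

definition fresh :: "nat set \<Rightarrow> nat" where
  "fresh A = Suc (Max (insert 0 A))"

definition sprout :: "cw_graph \<Rightarrow> nat list \<Rightarrow> nat list \<Rightarrow> cw_graph" where
  "sprout G vs ms = (let P = prod_encode ` (SIGMA i:{..<length vs}. {..<ms ! i}) in
     \<lparr>verts = verts G \<union> (\<lambda>p. fresh (verts G) + p) ` P,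
      arcs = arcs G \<union> (\<lambda>p. fresh (arcs G) + p) ` P,
      tail = (\<lambda>e. if e \<in> arcs G then tail G e
                  else vs ! fst (prod_decode (e - fresh (arcs G)))),
      head = (\<lambda>e. if e \<in> arcs G then head G e
                  else fresh (verts G) + (e - fresh (arcs G)))\<rparr>)"

text \<open>
  Multivariate polynomials as finitely supported functions from monomials to coefficients; the
  monomial \<open>a\<close> is the product of the powers \<open>t\<^sub>i ^ a\<^sub>i\<close>.
\<close>

type_synonym 'a mpolynomial = "(nat \<Rightarrow>\<^sub>0 nat) \<Rightarrow>\<^sub>0 'a"

definition mpoly_eval :: "'a :: comm_semiring_1 mpolynomial \<Rightarrow> (nat \<Rightarrow> 'a) \<Rightarrow> 'a" where
  "mpoly_eval f x =
     (\<Sum>a\<in>Poly_Mapping.keys f.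
        Poly_Mapping.lookup f a * (\<Prod>i\<in>Poly_Mapping.keys a. x i ^ Poly_Mapping.lookup a i))"

definition mpoly_vars :: "'a :: zero mpolynomial \<Rightarrow> nat set" where
  "mpoly_vars f = (\<Union>a\<in>Poly_Mapping.keys f. Poly_Mapping.keys a)"

definition total_degree_le :: "'a :: zero mpolynomial \<Rightarrow> nat \<Rightarrow> bool" where
  "total_degree_le f d \<longleftrightarrow>
     (\<forall>a\<in>Poly_Mapping.keys f. (\<Sum>i\<in>Poly_Mapping.keys a. Poly_Mapping.lookup a i) \<le> d)"

end

theory Submission
  imports Defs "HOL-Library.List_Lexorder"
begin

text \<open>
  Collapsing leaves makes the spaces \<open>N(G(v, m))\<close> a representation of tuples of injections. A
  contraction of \<open>G(v, m)\<close> onto a graph with at most \<open>d\<close> edges keeps at most \<open>d\<close> of the new leaves, so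
  if \<open>N\<close> is finitely generated in degrees at most \<open>d\<close>, then so is this representation: \<open>N(G(v, m))\<close> is
  spanned by monomials, which are finitely many generators placed at tuples of subsets of the leaves.
  For a submodule \<open>B\<close>, the codimension of \<open>B(G(v, m))\<close> is the number of monomials that are not leading
  monomials of \<open>B\<close>. Recording a subset by its gaps turns the leading monomials into an upward closed
  subset of \<open>\<nat>\<^sup>n\<close>, which by Dickson's lemma is a finite union of orthants; inclusion-exclusion and
  stars and bars then count them by a polynomial of degree at most \<open>d\<close>. Finally, the dimension of a
  module with a filtration is that of its associated graded module \<open>A / B\<close>.
\<close>

section \<open>Polynomial functions\<close>

text \<open>No order on monomials is respected by all injections: a transposition of two leaves
  already destroys it. Hence only increasing injections are used. This loses nothing, because a
  generator placed along an arbitrary injection is a permuted generator placed along an increasing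
  one, and the generating list contains the images of the given generators under all contractions,
  hence the permuted ones. Submodules are controlled without generators of their own; stability of
  their leading monomials under gap insertion suffices. The monomials may be linearly dependent in
  \<open>N\<close>, so the leading monomials of \<open>B\<close> can outnumber the dimension of
  \<open>B\<close>. The excess is the same for every submodule, so it cancels in the difference for
  \<open>A\<close> and \<open>B\<close>, which is the dimension wanted. The degree bound comes from
  counting parameters: a set of \<open>k\<close> leaves at one vertex has \<open>k + 1\<close> gaps
  with a prescribed sum, hence \<open>k\<close> degrees of freedom. The threshold is the point from
  which truncated subtraction in the binomial coefficients agrees with true subtraction.\<close>

inductive poly_fun :: "nat \<Rightarrow> nat \<Rightarrow> ((nat \<Rightarrow> rat) \<Rightarrow> rat) \<Rightarrow> bool" for r where
  monomial: "(\<Sum>i<r. \<alpha> i) \<le> n \<Longrightarrow> poly_fun r n (\<lambda>x. c * (\<Prod>i<r. x i ^ \<alpha> i))"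
| add: "poly_fun r n p \<Longrightarrow> poly_fun r n q \<Longrightarrow> poly_fun r n (\<lambda>x. p x + q x)"

lemma poly_fun_mono: "poly_fun r n p \<Longrightarrow> n \<le> n' \<Longrightarrow> poly_fun r n' p"
  by (induction rule: poly_fun.induct) (auto intro: poly_fun.intros)

lemma poly_fun_const: "poly_fun r n (\<lambda>x. c)"
  using poly_fun.monomial[where \<alpha> = "\<lambda>_. 0" and r = r and c = c and n = n] by simp

lemma poly_fun_cmult: "poly_fun r n p \<Longrightarrow> poly_fun r n (\<lambda>x. c * p x)"
proof (induction rule: poly_fun.induct)
  case (monomial \<alpha> n c')
  then show ?case using poly_fun.monomial[of \<alpha> r n "c * c'"] by (simp add: mult.assoc)
next
  case (add n p q)
  then show ?case using poly_fun.add by (simp add: distrib_left)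
qed

lemma poly_fun_diff: "poly_fun r n p \<Longrightarrow> poly_fun r n q \<Longrightarrow> poly_fun r n (\<lambda>x. p x - q x)"
  using poly_fun.add[of r n p "\<lambda>x. (-1) * q x"] poly_fun_cmult[of r n q "-1"] by simp

lemma poly_fun_mult_monomial:
  assumes "poly_fun r m q" and "(\<Sum>i<r. \<alpha> i) \<le> n"
  shows "poly_fun r (n + m) (\<lambda>x. (c * (\<Prod>i<r. x i ^ \<alpha> i)) * q x)"
  using assms
proof (induction rule: poly_fun.induct)
  case (monomial \<beta> m c')
  have "poly_fun r (n + m) (\<lambda>x. (c * c') * (\<Prod>i<r. x i ^ (\<alpha> i + \<beta> i)))"
    using monomial by (intro poly_fun.monomial) (simp add: sum.distrib)
  then show ?case by (simp add: power_add prod.distrib mult_ac)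
next
  case (add m p q)
  then show ?case by (auto simp: distrib_left intro: poly_fun.add)
qed

lemma poly_fun_mult:
  assumes "poly_fun r n p" and "poly_fun r m q"
  shows "poly_fun r (n + m) (\<lambda>x. p x * q x)"
  using assms
proof (induction rule: poly_fun.induct)
  case (monomial \<alpha> n c)
  then show ?case by (intro poly_fun_mult_monomial)
next
  case (add n p p')
  then show ?case by (auto simp: distrib_right intro: poly_fun.add)
qed

lemma poly_fun_var: "i < r \<Longrightarrow> poly_fun r 1 (\<lambda>x. x i)"
proof -
  assume "i < r"
  then have "(\<Prod>j<r. x j ^ (if j = i then 1 else 0)) = x i" for x :: "nat \<Rightarrow> rat"
    by (subst prod.remove[of _ i]) (auto intro!: prod.neutral)
  moreover have "(\<Sum>j<r. if j = i then 1 else 0) \<le> (1::nat)" using \<open>i < r\<close> by simp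
  ultimately show ?thesis
    using poly_fun.monomial[of "\<lambda>j. if j = i then 1 else 0" r 1 1] by simp
qed

lemma poly_fun_prod:
  assumes "finite A" "\<And>a. a \<in> A \<Longrightarrow> poly_fun r (n a) (p a)"
  shows "poly_fun r (\<Sum>a\<in>A. n a) (\<lambda>x. \<Prod>a\<in>A. p a x)"
  using assms by (induction A) (auto intro: poly_fun_const poly_fun_mult)

text \<open>A product of \<open>a\<close> linear factors divided by \<open>fact a\<close>, hence of
  degree \<open>a\<close>. This division is where rational coefficients enter.\<close>

lemma poly_fun_gbinomial: "i < r \<Longrightarrow> poly_fun r a (\<lambda>x. (x i - c) gchoose a)"
proof -
  assume i: "i < r"
  have "poly_fun r (\<Sum>j\<in>{0..<a}. 1) (\<lambda>x. \<Prod>j\<in>{0..<a}. (x i - c) - of_nat j)"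
    by (intro poly_fun_prod poly_fun_diff poly_fun_var i poly_fun_const) auto
  from poly_fun_cmult[OF this, of "1 / fact a"] show ?thesis
    by (simp add: gbinomial_prod_rev)
qed

lemma mpoly_eval_superset:
  assumes "finite A" "Poly_Mapping.keys f \<subseteq> A"
  shows "mpoly_eval f x =
    (\<Sum>a\<in>A. Poly_Mapping.lookup f a * (\<Prod>i\<in>Poly_Mapping.keys a. x i ^ Poly_Mapping.lookup a i))"
  unfolding mpoly_eval_def using assms
  by (intro sum.mono_neutral_left) (auto simp: in_keys_iff)

lemma mpoly_eval_add: "mpoly_eval (f + g) x = mpoly_eval f x + mpoly_eval g x"
proof -
  let ?A = "Poly_Mapping.keys f \<union> Poly_Mapping.keys g"
  have "Poly_Mapping.keys (f + g) \<subseteq> ?A" by (rule Poly_Mapping.keys_add)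
  then show ?thesis
    by (simp add: mpoly_eval_superset[where A = ?A] lookup_add distrib_right sum.distrib)
qed

text \<open>Polynomials are handled as functions throughout, where closure under sums and products
  is a rule induction; only the final answer has to be an \<open>mpolynomial\<close>.\<close>

lemma poly_fun_imp_mpolynomial:
  assumes "poly_fun r n p"
  shows "\<exists>f :: rat mpolynomial. mpoly_vars f \<subseteq> {..<r} \<and> total_degree_le f n \<and>
           (\<forall>x. mpoly_eval f x = p x)"
  using assms
proof (induction rule: poly_fun.induct)
  case (monomial \<alpha> n c)
  \<comment> \<open>Exponents from \<open>r\<close> on are set to 0: \<open>poly_fun\<close> does
    not read them, and a monomial must have finite support.\<close>
  define a where "a = Abs_poly_mapping (\<lambda>i. if i < r then \<alpha> i else 0)"
  have "finite {i. (if i < r then \<alpha> i else 0) \<noteq> 0}"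
    by (rule finite_subset[of _ "{..<r}"]) auto
  then have lookup_a: "Poly_Mapping.lookup a = (\<lambda>i. if i < r then \<alpha> i else 0)"
    unfolding a_def by (rule lookup_Abs_poly_mapping)
  have keys_a: "Poly_Mapping.keys a \<subseteq> {..<r}"
    by (auto simp: in_keys_iff lookup_a split: if_splits)
  let ?f = "Poly_Mapping.single a c"
  have deg: "(\<Sum>i\<in>Poly_Mapping.keys a. Poly_Mapping.lookup a i) \<le> n"
  proof -
    have "(\<Sum>i\<in>Poly_Mapping.keys a. Poly_Mapping.lookup a i) = (\<Sum>i<r. Poly_Mapping.lookup a i)"
      using keys_a by (intro sum.mono_neutral_left) (auto simp: in_keys_iff)
    then show ?thesis using monomial by (simp add: lookup_a)
  qed
  have "mpoly_eval ?f x = c * (\<Prod>i<r. x i ^ \<alpha> i)" for x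
  proof -
    have "(\<Prod>i\<in>Poly_Mapping.keys a. x i ^ Poly_Mapping.lookup a i) =
          (\<Prod>i<r. x i ^ Poly_Mapping.lookup a i)"
      using keys_a by (intro prod.mono_neutral_left) (auto simp: in_keys_iff)
    then show ?thesis
      by (subst mpoly_eval_superset[of "{a}"]) (auto simp: lookup_a)
  qed
  moreover have "mpoly_vars ?f \<subseteq> {..<r}" "total_degree_le ?f n"
    using keys_a deg by (auto simp: mpoly_vars_def total_degree_le_def)
  ultimately show ?case by blast
next
  case (add n p q)
  then obtain f g where
    "mpoly_vars f \<subseteq> {..<r}" "total_degree_le f n" "\<forall>x. mpoly_eval f x = p x"
    "mpoly_vars g \<subseteq> {..<r}" "total_degree_le g n" "\<forall>x. mpoly_eval g x = q x" by blast
  moreover have "mpoly_vars (f + g) \<subseteq> mpoly_vars f \<union> mpoly_vars g"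
    using Poly_Mapping.keys_add[of f g] by (auto simp: mpoly_vars_def)
  moreover have "total_degree_le (f + g) n"
    using calculation Poly_Mapping.keys_add[of f g] by (auto simp: total_degree_le_def)
  ultimately show ?case
    by (intro exI[of _ "f + g"]) (auto simp: mpoly_eval_add)
qed

section \<open>Functions of tuples that are polynomial for large arguments\<close>

definition eventually_poly :: "nat \<Rightarrow> nat \<Rightarrow> (nat list \<Rightarrow> rat) \<Rightarrow> bool" where
  "eventually_poly r d F \<longleftrightarrow> (\<exists>p N. poly_fun r d p \<and>
     (\<forall>ms. length ms = r \<and> (\<forall>i<r. N \<le> ms ! i) \<longrightarrow> F ms = p (\<lambda>i. of_nat (ms ! i))))"

lemma eventually_poly_cong:
  assumes "eventually_poly r d F" and "\<And>ms. length ms = r \<Longrightarrow> F ms = F' ms"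
  shows "eventually_poly r d F'"
  using assms unfolding eventually_poly_def by metis

lemma eventually_poly_mono: "eventually_poly r d F \<Longrightarrow> d \<le> d' \<Longrightarrow> eventually_poly r d' F"
  unfolding eventually_poly_def using poly_fun_mono by blast

lemma eventually_poly_zero: "eventually_poly r d (\<lambda>_. 0)"
  unfolding eventually_poly_def using poly_fun_const by fast

lemma eventually_poly_combine:
  assumes "eventually_poly r d F" "eventually_poly r d F'"
    and "\<And>p q. poly_fun r d p \<Longrightarrow> poly_fun r d q \<Longrightarrow> poly_fun r d (\<lambda>x. h (p x) (q x))"
  shows "eventually_poly r d (\<lambda>ms. h (F ms) (F' ms))"
proof -
  obtain p N q N' where
    "poly_fun r d p" "\<And>ms. length ms = r \<and> (\<forall>i<r. N \<le> ms ! i) \<Longrightarrow> F ms = p (\<lambda>i. of_nat (ms ! i))"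
    "poly_fun r d q" "\<And>ms. length ms = r \<and> (\<forall>i<r. N' \<le> ms ! i) \<Longrightarrow> F' ms = q (\<lambda>i. of_nat (ms ! i))"
    using assms unfolding eventually_poly_def by blast
  then show ?thesis unfolding eventually_poly_def
    using assms(3) by (intro exI[of _ "\<lambda>x. h (p x) (q x)"] exI[of _ "max N N'"]) auto
qed

lemma eventually_poly_add:
  "eventually_poly r d F \<Longrightarrow> eventually_poly r d F' \<Longrightarrow> eventually_poly r d (\<lambda>ms. F ms + F' ms)"
  by (rule eventually_poly_combine) (auto intro: poly_fun.add)

lemma eventually_poly_diff:
  "eventually_poly r d F \<Longrightarrow> eventually_poly r d F' \<Longrightarrow> eventually_poly r d (\<lambda>ms. F ms - F' ms)"
  by (rule eventually_poly_combine) (auto intro: poly_fun_diff)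

lemma eventually_poly_sum:
  assumes "finite A" "\<And>a. a \<in> A \<Longrightarrow> eventually_poly r d (F a)"
  shows "eventually_poly r d (\<lambda>ms. \<Sum>a\<in>A. F a ms)"
  using assms by (induction A) (auto intro: eventually_poly_zero eventually_poly_add)

section \<open>Dickson's lemma\<close>

text \<open>Coordinates are treated one at a time: passing to a subsequence for the new coordinate
  keeps the earlier ones weakly increasing.\<close>

lemma dickson_sequence:
  fixes v :: "nat \<Rightarrow> 'j \<Rightarrow> nat"
  assumes "finite J"
  shows "\<exists>h :: nat \<Rightarrow> nat. strict_mono h \<and> (\<forall>j\<in>J. mono (\<lambda>n. v (h n) j))"
  using assms
proof (induction J)
  case empty
  show ?case by (intro exI[of _ id]) (auto simp: strict_mono_def)
next
  case (insert j J)
  then obtain h :: "nat \<Rightarrow> nat" where h: "strict_mono h" "\<forall>j\<in>J. mono (\<lambda>n. v (h n) j)" by blast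
  obtain f where f: "strict_mono f" "monoseq (\<lambda>n. v (h (f n)) j)"
    using seq_monosub[of "\<lambda>n. v (h n) j"] by auto
  have "\<exists>f :: nat \<Rightarrow> nat. strict_mono f \<and> mono (\<lambda>n. v (h (f n)) j)"
  proof (cases "mono (\<lambda>n. v (h (f n)) j)")
    case False
    then have dec: "v (h (f n)) j \<le> v (h (f m)) j" if "m \<le> n" for m n
      using f(2) that unfolding monoseq_def mono_def by blast
    \<comment> \<open>A weakly decreasing sequence of natural numbers is constant from any place
      where it attains its least value, so dropping the first \<open>k\<close> terms makes it weakly
      increasing as well.\<close>
    obtain k where k: "\<And>n. v (h (f k)) j \<le> v (h (f n)) j"
      using ex_has_least_nat[of "\<lambda>_. True" 0 "\<lambda>n. v (h (f n)) j"] by auto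
    have "v (h (f (k + n))) j = v (h (f k)) j" for n
      using dec[of k "k + n"] k[of "k + n"] by simp
    moreover have "strict_mono (\<lambda>n. f (k + n))" using f(1) by (simp add: strict_mono_def)
    ultimately show ?thesis by (intro exI[of _ "\<lambda>n. f (k + n)"]) (simp add: mono_def)
  qed (use f in blast)
  then obtain f :: "nat \<Rightarrow> nat" where f: "strict_mono f" "mono (\<lambda>n. v (h (f n)) j)" by blast
  have "strict_mono (\<lambda>n. h (f n))" using h(1) f(1) by (simp add: strict_mono_def)
  moreover have "mono (\<lambda>n. v (h (f n)) j')" if "j' \<in> J" for j'
    using h(2) f(1) that by (simp add: mono_def strict_mono_less_eq)
  ultimately show ?case using f(2) by (intro exI[of _ "\<lambda>n. h (f n)"]) auto
qed

text \<open>If no finite subset worked, a greedy choice would give a sequence in which no term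
  dominates an earlier one; a subsequence that is weakly increasing in every coordinate contradicts
  this.\<close>

lemma dickson:
  fixes v :: "'x \<Rightarrow> 'j \<Rightarrow> nat"
  assumes "finite J"
  shows "\<exists>F. finite F \<and> F \<subseteq> U \<and> (\<forall>x\<in>U. \<exists>p\<in>F. \<forall>j\<in>J. v p j \<le> v x j)"
proof (rule ccontr)
  assume contra: "\<not> ?thesis"
  have step: "\<exists>x\<in>U. \<forall>p\<in>F. \<exists>j\<in>J. v x j < v p j" if "finite F" "F \<subseteq> U" for F
    using contra that by (meson not_le)
  define nxt where "nxt F = (SOME x. x \<in> U \<and> (\<forall>p\<in>F. \<exists>j\<in>J. v x j < v p j))" for F
  have nxt: "nxt F \<in> U \<and> (\<forall>p\<in>F. \<exists>j\<in>J. v (nxt F) j < v p j)" if "finite F" "F \<subseteq> U" for F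
    unfolding nxt_def by (rule someI_ex) (use step[OF that] in blast)
  \<comment> \<open>\<open>S n\<close> collects the first \<open>n\<close> terms of the greedy
    sequence, so that each new term is chosen against all earlier ones at once.\<close>
  define S where "S n = ((\<lambda>F. insert (nxt F) F) ^^ n) {}" for n :: nat
  have S: "finite (S n) \<and> S n \<subseteq> U" for n
    by (induction n) (use nxt in \<open>auto simp: S_def\<close>)
  have S_mono: "S m \<subseteq> S n" if "m \<le> n" for m n
    by (rule lift_Suc_mono_le[OF _ that]) (auto simp: S_def)
  define x where "x n = nxt (S n)" for n
  have bad: "\<exists>j\<in>J. v (x n) j < v (x m) j" if "m < n" for m n
  proof -
    have "x m \<in> S (Suc m)" by (simp add: S_def x_def)
    then have "x m \<in> S n" using S_mono[of "Suc m" n] that by auto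
    then show ?thesis using nxt[of "S n"] S by (auto simp: x_def)
  qed
  obtain h :: "nat \<Rightarrow> nat" where h: "strict_mono h" "\<forall>j\<in>J. mono (\<lambda>n. v (x (h n)) j)"
    using dickson_sequence[OF assms, of "\<lambda>n. v (x n)"] by blast
  obtain j where "j \<in> J" "v (x (h 1)) j < v (x (h 0)) j"
    using bad[of "h 0" "h 1"] h(1) by (auto simp: strict_mono_def)
  moreover from \<open>j \<in> J\<close> have "v (x (h 0)) j \<le> v (x (h 1)) j" using h(2) by (simp add: mono_def)
  ultimately show False by simp
qed

section \<open>Counting gap vectors\<close>

text \<open>A list of gaps \<open>x\<^sub>0, \<dots>, x\<^sub>a\<close> encodes the \<open>a\<close>-element subset of \<open>{c..<c + a + \<Sum>x\<^sub>k}\<close> whose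
  elements are separated by these gaps.\<close>

fun positions :: "nat \<Rightarrow> nat list \<Rightarrow> nat list" where
  "positions c [] = []"
| "positions c [x] = []"
| "positions c (x # y # zs) = (c + x) # positions (Suc (c + x)) (y # zs)"

definition shift :: "nat \<Rightarrow> nat \<Rightarrow> nat" where
  "shift p y = (if y < p then y else Suc y)"

lemma strict_mono_shift: "strict_mono (shift p)"
  by (auto simp: strict_mono_def shift_def)

lemma length_positions [simp]: "length (positions c l) = length l - 1"
  by (induction c l rule: positions.induct) auto

lemma positions_ge: "p \<in> set (positions c l) \<Longrightarrow> c \<le> p"
  by (induction c l rule: positions.induct) fastforce+

lemma positions_less: "p \<in> set (positions c l) \<Longrightarrow> p < c + sum_list l + (length l - 1)"
  by (induction c l rule: positions.induct) fastforce+

lemma sorted_positions: "sorted_wrt (<) (positions c l)"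
  by (induction c l rule: positions.induct) (auto dest: positions_ge)

lemma positions_Suc: "positions (Suc c) l = map Suc (positions c l)"
  by (induction c l rule: positions.induct) auto

text \<open>The last gap leaves no trace in the positions; equality of the sums recovers it.\<close>

lemma positions_inject:
  "length l = length l' \<Longrightarrow> sum_list l = sum_list l' \<Longrightarrow> positions c l = positions c l' \<Longrightarrow> l = l'"
proof (induction c l arbitrary: l' rule: positions.induct)
  case (2 c x)
  then show ?case by (cases l') auto
next
  case (3 c x y zs)
  then obtain x' y' zs' where l': "l' = x' # y' # zs'"
    by (metis length_Suc_conv)
  then have "y # zs = y' # zs'" using 3 by (intro "3.IH") auto
  then show ?case using l' 3 by simp
qed auto

text \<open>The gaps are read off as differences, and the last one is whatever remains below
  \<open>m\<close>.\<close>

lemma positions_surj: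
  assumes "sorted_wrt (<) S" "\<And>s. s \<in> set S \<Longrightarrow> c \<le> s \<and> s < m" "c \<le> m"
  shows "\<exists>l. length l = Suc (length S) \<and> c + sum_list l + length S = m \<and> positions c l = S"
  using assms
proof (induction S arbitrary: c)
  case Nil
  then show ?case by (intro exI[of _ "[m - c]"]) simp
next
  case (Cons s S)
  have "\<exists>l. length l = Suc (length S) \<and> Suc s + sum_list l + length S = m \<and> positions (Suc s) l = S"
    using Cons.prems by (intro Cons.IH) (auto simp: Suc_le_eq)
  then obtain l where l: "length l = Suc (length S)" "Suc s + sum_list l + length S = m"
    "positions (Suc s) l = S" by blast
  moreover from l(1) obtain y zs where "l = y # zs" by (cases l) auto
  ultimately show ?case using Cons.prems(2)[of s] by (intro exI[of _ "(s - c) # l"]) auto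
qed

text \<open>Enlarging a gap moves every element behind it up by one. The witness \<open>p\<close> is
  the place where that gap begins: elements before it stay, and \<open>shift p\<close> moves the
  rest.\<close>

lemma positions_increment:
  assumes "k < length l"
  shows "\<exists>p. c \<le> p \<and> p \<le> c + sum_list l + (length l - 1) \<and>
    positions c (l[k := Suc (l ! k)]) = map (shift p) (positions c l)"
  using assms
proof (induction c l arbitrary: k rule: positions.induct)
  case (2 c x)
  then show ?case by (intro exI[of _ c]) auto
next
  case (3 c x y zs)
  show ?case
  proof (cases k)
    case 0
    have "map (shift c) (positions c (x # y # zs)) = map Suc (positions c (x # y # zs))"
      by (rule map_cong) (auto simp: shift_def dest: positions_ge)
    then show ?thesis using 0 by (intro exI[of _ c]) (auto simp: positions_Suc)
  next
    case (Suc k')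
    then obtain p where p: "Suc (c + x) \<le> p" "p \<le> Suc (c + x) + sum_list (y # zs) + (length (y # zs) - 1)"
      "positions (Suc (c + x)) ((y # zs)[k' := Suc ((y # zs) ! k')]) =
         map (shift p) (positions (Suc (c + x)) (y # zs))"
      using "3.IH"[of k'] "3.prems" by auto
    moreover obtain y' zs' where "(y # zs)[k' := Suc ((y # zs) ! k')] = y' # zs'"
      by (cases k') auto
    ultimately show ?thesis using Suc by (intro exI[of _ p]) (auto simp: shift_def)
  qed
qed auto

lemma finite_lists_sum: "finite {l :: nat list. length l = n \<and> sum_list l = s}"
proof (rule finite_subset)
  show "{l :: nat list. length l = n \<and> sum_list l = s} \<subseteq> {l. set l \<subseteq> {..s} \<and> length l = n}"
    using member_le_sum_list by fastforce
qed (rule finite_lists_length_eq, simp)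

text \<open>Subtracting the lower bounds \<open>q\<close> reduces this to unrestricted lists with
  \<open>a + 1\<close> entries, which stars and bars counts.\<close>

lemma card_lists_sum_ge:
  fixes q :: "nat \<Rightarrow> nat"
  assumes "(\<Sum>k\<le>a. q k) \<le> s"
  shows "card {l :: nat list. length l = Suc a \<and> sum_list l = s \<and> (\<forall>k\<le>a. q k \<le> l ! k)} =
         (s - (\<Sum>k\<le>a. q k) + a) choose a"
proof -
  let ?A = "{l :: nat list. length l = Suc a \<and> sum_list l = s - (\<Sum>k\<le>a. q k)}"
  let ?B = "{l :: nat list. length l = Suc a \<and> sum_list l = s \<and> (\<forall>k\<le>a. q k \<le> l ! k)}"
  let ?f = "\<lambda>l :: nat list. map (\<lambda>k. l ! k + q k) [0..<Suc a]"
  let ?g = "\<lambda>l :: nat list. map (\<lambda>k. l ! k - q k) [0..<Suc a]"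
  have sl: "sum_list l = (\<Sum>k\<le>a. l ! k)" if "length l = Suc a" for l :: "nat list"
    using that by (simp add: sum_list_sum_nth atLeast0LessThan lessThan_Suc_atMost)
  have "bij_betw ?f ?A ?B"
  proof (rule bij_betw_byWitness[where f' = ?g])
    show "\<forall>l\<in>?A. ?g (?f l) = l" "\<forall>l\<in>?B. ?f (?g l) = l"
      by (auto intro!: nth_equalityI simp: nth_append simp del: upt_Suc)
    show "?f ` ?A \<subseteq> ?B"
    proof (rule image_subsetI)
      fix l assume l: "l \<in> ?A"
      have "(\<Sum>k\<le>a. ?f l ! k) = (\<Sum>k\<le>a. l ! k + q k)"
        by (rule sum.cong) (auto simp del: upt_Suc)
      then have "(\<Sum>k\<le>a. ?f l ! k) = s" using l assms sl[of l] by (simp add: sum.distrib)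
      then show "?f l \<in> ?B" using sl[of "?f l"] by (auto simp del: upt_Suc)
    qed
    show "?g ` ?B \<subseteq> ?A"
    proof (rule image_subsetI)
      fix l assume l: "l \<in> ?B"
      then have "(\<Sum>k\<le>a. l ! k - q k) = (\<Sum>k\<le>a. l ! k) - (\<Sum>k\<le>a. q k)"
        by (intro sum_subtractf_nat) auto
      moreover have "(\<Sum>k\<le>a. ?g l ! k) = (\<Sum>k\<le>a. l ! k - q k)"
        by (rule sum.cong) (auto simp del: upt_Suc)
      ultimately show "?g l \<in> ?A" using l sl[of l] sl[of "?g l"] by (simp del: upt_Suc)
    qed
  qed
  then have "card ?B = card ?A" by (simp add: bij_betw_same_card)
  also have "\<dots> = (s - (\<Sum>k\<le>a. q k) + a) choose a"
    using card_length_sum_list[of "Suc a" "s - (\<Sum>k\<le>a. q k)"]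
      binomial_symmetric[of a "s - (\<Sum>k\<le>a. q k) + a"] by simp
  finally show ?thesis .
qed

text \<open>The gaps and the \<open>ks ! i\<close> chosen elements together fill
  \<open>{..<ms ! i}\<close>. Written as a sum instead of a difference, the condition has no
  solution when \<open>ks ! i\<close> exceeds \<open>ms ! i\<close>.\<close>

definition gap_vectors :: "nat list \<Rightarrow> nat list \<Rightarrow> (nat \<Rightarrow> nat list) set" where
  "gap_vectors ks ms =
     (\<Pi>\<^sub>E i\<in>{..<length ks}. {l. length l = Suc (ks ! i) \<and> sum_list l + ks ! i = ms ! i})"

text \<open>The slice with totals \<open>ms\<close> of the orthant with corner \<open>q\<close>;
  coordinate \<open>(i, k)\<close> is the \<open>k\<close>-th gap of the \<open>i\<close>-th
  list.\<close>

definition gap_cone :: "nat list \<Rightarrow> nat list \<Rightarrow> (nat \<times> nat \<Rightarrow> nat) \<Rightarrow> (nat \<Rightarrow> nat list) set" where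
  "gap_cone ks ms q =
     {x \<in> gap_vectors ks ms. \<forall>i<length ks. \<forall>k\<le>ks ! i. q (i, k) \<le> x i ! k}"

lemma finite_gap_vectors: "finite (gap_vectors ks ms)"
proof -
  have "finite {l :: nat list. length l = Suc a \<and> sum_list l + a = m}" for a m
    by (rule finite_subset[OF _ finite_lists_sum[of "Suc a" "m - a"]]) auto
  then show ?thesis unfolding gap_vectors_def by (intro finite_PiE) auto
qed

text \<open>The lists for different \<open>i\<close> are independent, so the count is a product of
  binomial coefficients with lower entries \<open>ks ! i\<close>; their degrees add up to
  \<open>sum_list ks\<close>.\<close>

lemma eventually_poly_card_gap_cone:
  assumes r: "length ks = r"
  shows "eventually_poly r (sum_list ks) (\<lambda>ms. of_nat (card (gap_cone ks ms q)))"
  unfolding eventually_poly_def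
proof (intro exI conjI allI impI)
  let ?Q = "\<lambda>i. \<Sum>k\<le>ks ! i. q (i, k)"
  have "poly_fun r (\<Sum>i<r. ks ! i) (\<lambda>x. \<Prod>i<r. (x i - of_nat (?Q i)) gchoose (ks ! i))"
    by (intro poly_fun_prod poly_fun_gbinomial) auto
  moreover have "(\<Sum>i<r. ks ! i) = sum_list ks"
    using r by (simp add: sum_list_sum_nth atLeast0LessThan)
  ultimately show "poly_fun r (sum_list ks) (\<lambda>x. \<Prod>i<r. (x i - of_nat (?Q i)) gchoose (ks ! i))"
    by simp
  fix ms :: "nat list"
  \<comment> \<open>The sum over all \<open>i\<close> serves as a common threshold, since it
    dominates each of its summands.\<close>
  assume ms: "length ms = r \<and> (\<forall>i<r. (\<Sum>i<r. ks ! i + ?Q i) \<le> ms ! i)"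
  have large: "ks ! i + ?Q i \<le> ms ! i" if "i < r" for i
  proof -
    have "ks ! i + ?Q i \<le> (\<Sum>i<r. ks ! i + ?Q i)"
      using that by (intro member_le_sum) auto
    then show ?thesis using ms that by fastforce
  qed
  have iff: "sum_list l + ks ! i = ms ! i \<longleftrightarrow> sum_list l = ms ! i - ks ! i" if "i < r" for i and l :: "nat list"
    using large[OF that] by arith
  have "gap_cone ks ms q = (\<Pi>\<^sub>E i\<in>{..<r}.
      {l. length l = Suc (ks ! i) \<and> sum_list l = ms ! i - ks ! i \<and> (\<forall>k\<le>ks ! i. q (i, k) \<le> l ! k)})"
    unfolding gap_cone_def gap_vectors_def r by (rule Set.set_eqI) (auto simp: PiE_iff iff)
  then have "card (gap_cone ks ms q) = (\<Prod>i<r. card {l :: nat list. length l = Suc (ks ! i) \<and>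
      sum_list l = ms ! i - ks ! i \<and> (\<forall>k\<le>ks ! i. q (i, k) \<le> l ! k)})"
    by (simp add: card_PiE)
  also have "\<dots> = (\<Prod>i<r. (ms ! i - ?Q i) choose (ks ! i))"
  proof (rule prod.cong)
    fix i assume "i \<in> {..<r}"
    then have "?Q i \<le> ms ! i - ks ! i" "ms ! i - ks ! i - ?Q i + ks ! i = ms ! i - ?Q i"
      using large[of i] by simp_all
    then show "card {l :: nat list. length l = Suc (ks ! i) \<and>
      sum_list l = ms ! i - ks ! i \<and> (\<forall>k\<le>ks ! i. q (i, k) \<le> l ! k)} = (ms ! i - ?Q i) choose (ks ! i)"
      using card_lists_sum_ge[of "\<lambda>k. q (i, k)" "ks ! i" "ms ! i - ks ! i"] by simp
  qed simp
  finally have "rat_of_nat (card (gap_cone ks ms q)) =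
      (\<Prod>i<r. of_nat ((ms ! i - ?Q i) choose (ks ! i)))" by simp
  also have "\<dots> = (\<Prod>i<r. (of_nat (ms ! i) - of_nat (?Q i)) gchoose (ks ! i))"
  proof (rule prod.cong)
    fix i assume "i \<in> {..<r}"
    then have "?Q i \<le> ms ! i" using large[of i] by simp
    then show "rat_of_nat ((ms ! i - ?Q i) choose (ks ! i)) = (of_nat (ms ! i) - of_nat (?Q i)) gchoose (ks ! i)"
      by (simp only: binomial_gbinomial of_nat_diff)
  qed simp
  finally show "rat_of_nat (card (gap_cone ks ms q)) =
      (\<Prod>i<r. (of_nat (ms ! i) - of_nat (?Q i)) gchoose (ks ! i))" .
qed

text \<open>Two orthants meet in the orthant whose corner is the coordinatewise maximum. So one
  orthant meets a union of \<open>n\<close> others in a union of at most \<open>n\<close> orthants,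
  and inclusion-exclusion becomes an induction on their number.\<close>

lemma eventually_poly_card_Union_gap_cones:
  assumes r: "length ks = r" and "finite F"
  shows "eventually_poly r (sum_list ks) (\<lambda>ms. of_nat (card (\<Union>q\<in>F. gap_cone ks ms q)))"
  using assms(2)
proof (induction "card F" arbitrary: F rule: less_induct)
  case less
  show ?case
  proof (cases "F = {}")
    case True
    then show ?thesis by (simp add: eventually_poly_zero)
  next
    case False
    then obtain q F' where F: "F = insert q F'" "q \<notin> F'" by (meson equals0I mk_disjoint_insert)
    then have fin: "finite F'" and card: "card F' < card F" using less.prems by auto
    define F'' where "F'' = (\<lambda>q' j. max (q j) (q' j)) ` F'"
    have F'': "finite F''" "card F'' < card F"
      unfolding F''_def using fin card card_image_le[OF fin] by (auto intro: le_less_trans)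
    let ?U = "\<lambda>ms F. \<Union>q\<in>F. gap_cone ks ms q"
    have "?U ms F' \<inter> gap_cone ks ms q = ?U ms F''" for ms
      unfolding F''_def gap_cone_def by auto
    moreover have finU: "finite (?U ms F')" "finite (gap_cone ks ms q)" for ms
      using fin finite_gap_vectors by (auto simp: gap_cone_def)
    ultimately have "card (?U ms F) + card (?U ms F'') = card (?U ms F') + card (gap_cone ks ms q)" for ms
      using card_Un_Int[OF finU(1)[of ms] finU(2)[of ms]] F by (simp add: Un_commute)
    then have "rat_of_nat (card (?U ms F)) + of_nat (card (?U ms F'')) =
        of_nat (card (?U ms F')) + of_nat (card (gap_cone ks ms q))" for ms
      by (metis of_nat_add)
    then have "rat_of_nat (card (?U ms F)) =
        of_nat (card (?U ms F')) + of_nat (card (gap_cone ks ms q)) - of_nat (card (?U ms F''))" for ms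
      by (simp add: algebra_simps)
    moreover have "eventually_poly r (sum_list ks) (\<lambda>ms. of_nat (card (?U ms F')) +
        of_nat (card (gap_cone ks ms q)) - of_nat (card (?U ms F'')))"
      by (intro eventually_poly_add eventually_poly_diff less.hyps F'' card fin
          eventually_poly_card_gap_cone r)
    ultimately show ?thesis by simp
  qed
qed

definition increment :: "nat \<Rightarrow> nat \<Rightarrow> (nat \<Rightarrow> nat list) \<Rightarrow> nat \<Rightarrow> nat list" where
  "increment i k x = x(i := (x i)[k := Suc (x i ! k)])"

text \<open>\<open>P\<close> does not mention \<open>ms\<close>: Dickson's lemma is applied once, to
  the gap vectors of all totals together, and the same finitely many corners then serve every
  slice.\<close>

lemma eventually_poly_card_upward_closed:
  assumes r: "length ks = r"
    and up: "\<And>x i k. x \<in> (\<Pi>\<^sub>E i\<in>{..<r}. {l. length l = Suc (ks ! i)}) \<Longrightarrow> P x \<Longrightarrow> i < r \<Longrightarrow> k \<le> ks ! i \<Longrightarrow>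
               P (increment i k x)"
  shows "eventually_poly r (sum_list ks) (\<lambda>ms. of_nat (card {x \<in> gap_vectors ks ms. P x}))"
proof -
  let ?E = "\<Pi>\<^sub>E i\<in>{..<r}. {l :: nat list. length l = Suc (ks ! i)}"
  let ?J = "SIGMA i:{..<r}. {..ks ! i}"
  define v where "v x = (\<lambda>(i, k). x i ! k)" for x :: "nat \<Rightarrow> nat list"
  \<comment> \<open>Closure under single increments gives closure under the coordinatewise order:
    \<open>p\<close> is raised one coordinate at a time, with the total distance to \<open>x\<close>
    as measure.\<close>
  have step: "P x" if "p \<in> ?E" "x \<in> ?E" "P p" "\<forall>j\<in>?J. v p j \<le> v x j" for p x
    using that
  proof (induction "\<Sum>j\<in>?J. v x j - v p j" arbitrary: p rule: less_induct)
    case less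
    show ?case
    proof (cases "\<exists>j\<in>?J. v p j < v x j")
      case True
      then obtain i k where ik: "i < r" "k \<le> ks ! i" "p i ! k < x i ! k" by (auto simp: v_def)
      have len: "length (p i) = Suc (ks ! i)" using less.prems(1) ik by (auto simp: PiE_iff)
      let ?p = "increment i k p"
      have v: "v ?p j = (if j = (i, k) then Suc (v p j) else v p j)" if "j \<in> ?J" for j
      proof -
        obtain i' k' where j: "j = (i', k')" "k' \<le> ks ! i'" using \<open>j \<in> ?J\<close> by auto
        show ?thesis
          using len j by (cases "i' = i") (simp_all add: v_def increment_def nth_list_update less_Suc_eq_le)
      qed
      have "?p \<in> ?E" using less.prems(1) ik by (auto simp: increment_def PiE_iff extensional_def)
      moreover have "P ?p" using up less.prems ik by blast
      moreover have "\<forall>j\<in>?J. v ?p j \<le> v x j" using v less.prems(4) ik by (auto simp: v_def)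
      moreover have "(\<Sum>j\<in>?J. v x j - v ?p j) < (\<Sum>j\<in>?J. v x j - v p j)"
      proof (rule sum_strict_mono_ex1)
        show "\<forall>j\<in>?J. v x j - v ?p j \<le> v x j - v p j" using v by (auto simp: diff_le_mono2)
        show "\<exists>j\<in>?J. v x j - v ?p j < v x j - v p j"
          using v[of "(i, k)"] ik by (intro bexI[of _ "(i, k)"]) (auto simp: v_def)
      qed auto
      ultimately show ?thesis using less.hyps[of ?p] less.prems(2) by blast
    next
      case False
      have eq: "p i ! k = x i ! k" if "i < r" "k \<le> ks ! i" for i k
        using False less.prems(4) that by (force simp: v_def)
      have "p = x"
      proof (rule PiE_ext[OF less.prems(1,2)])
        fix i assume i: "i \<in> {..<r}"
        then show "p i = x i" using less.prems(1,2) eq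
          by (intro nth_equalityI) (auto simp: PiE_iff less_Suc_eq_le)
      qed
      then show ?thesis using less.prems(3) by simp
    qed
  qed
  have "finite ?J" by auto
  from dickson[OF this, of "{x \<in> ?E. P x}" v]
  obtain F where F: "finite F" "F \<subseteq> {x \<in> ?E. P x}"
    "\<forall>x\<in>{x \<in> ?E. P x}. \<exists>p\<in>F. \<forall>j\<in>?J. v p j \<le> v x j" by (elim exE conjE)
  have gE: "gap_vectors ks ms \<subseteq> ?E" for ms unfolding gap_vectors_def r by (rule PiE_mono) auto
  have cone: "x \<in> gap_cone ks ms (v p) \<longleftrightarrow> x \<in> gap_vectors ks ms \<and> (\<forall>j\<in>?J. v p j \<le> v x j)" for x ms p
    by (auto simp: gap_cone_def v_def r)
  have "{x \<in> gap_vectors ks ms. P x} = (\<Union>q\<in>v ` F. gap_cone ks ms q)" for ms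
  proof (intro equalityI subsetI)
    fix x assume "x \<in> {x \<in> gap_vectors ks ms. P x}"
    then show "x \<in> (\<Union>q\<in>v ` F. gap_cone ks ms q)"
      using F(3) gE[of ms] unfolding UN_iff bex_simps cone by blast
  next
    fix x assume "x \<in> (\<Union>q\<in>v ` F. gap_cone ks ms q)"
    then obtain p where p: "p \<in> F" "x \<in> gap_vectors ks ms" "\<forall>j\<in>?J. v p j \<le> v x j"
      unfolding UN_iff bex_simps cone by blast
    then show "x \<in> {x \<in> gap_vectors ks ms. P x}" using step[of p x] F(2) gE[of ms] by blast
  qed
  then show ?thesis
    using eventually_poly_card_Union_gap_cones[OF r, of "v ` F"] F(1) by simp
qed

section \<open>Dimensions of vector spaces\<close>

text \<open>Independent subsets of \<open>W\<close> have at most \<open>dim\<close> elements; one of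
  largest size spans \<open>W\<close>, since otherwise it could be enlarged.\<close>

lemma (in vectorspace) subspace_fin_dim:
  assumes fd: fin_dim and W: "VectorSpace.subspace K W V"
  shows "vectorspace.fin_dim K (vs W)"
proof -
  interpret W: vectorspace K "vs W" by (rule subspace_is_vs[OF W])
  have sub: "submodule K W V" using W by simp
  have WV: "W \<subseteq> carrier V" using sub by (simp add: submodule_def)
  let ?P = "\<lambda>A. A \<subseteq> W \<and> lin_indpt A"
  have "?P {}" by (auto simp: lin_dep_def)
  moreover have "\<forall>A. ?P A \<longrightarrow> card A < Suc dim"
    using li_le_dim(2)[OF fd] WV by (metis less_Suc_eq_le order_trans)
  ultimately obtain A where A: "?P A" and max: "\<And>A'. ?P A' \<Longrightarrow> card A' \<le> card A"
    using ex_has_greatest_nat[of ?P "{}" card "Suc dim"] by blast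
  have AV: "A \<subseteq> carrier V" using A WV by auto
  have finA: "finite A" using li_le_dim(1)[OF fd AV] A by simp
  have "W \<subseteq> span A"
  proof
    fix v assume v: "v \<in> W"
    show "v \<in> span A"
    proof (rule ccontr)
      assume nv: "v \<notin> span A"
      then have "v \<notin> A" using in_own_span[OF AV] by auto
      moreover from this have "lin_indpt (A \<union> {v})"
        using lin_dep_iff_in_span[OF AV _ _ \<open>v \<notin> A\<close>] A v WV nv by auto
      ultimately show False using max[of "A \<union> {v}"] A v finA by auto
    qed
  qed
  moreover have "span A \<subseteq> W" by (rule span_is_subset) (use A sub in auto)
  moreover have "W.span A = span A" by (rule span_li_not_depend(1)) (use A sub in auto)
  ultimately show ?thesis unfolding W.fin_dim_def using finA A by auto
qed

lemma (in vectorspace) span_insert_eq: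
  assumes "A \<subseteq> carrier V" "A' \<subseteq> carrier V" "span A = span A'" "v \<in> carrier V"
  shows "span (insert v A) = span (insert v A')"
proof -
  have *: "span (insert v A) \<subseteq> span (insert v A')"
    if "A \<subseteq> carrier V" "A' \<subseteq> carrier V" "span A = span A'" for A A'
  proof (rule span_is_subset)
    have "A \<subseteq> span (insert v A')"
      using in_own_span[OF that(1)] that span_is_monotone[of A' "insert v A'"] by auto
    moreover have "v \<in> span (insert v A')"
      using in_own_span[of "insert v A'"] that assms(4) by auto
    ultimately show "insert v A \<subseteq> span (insert v A')" by simp
    show "submodule K (span (insert v A')) V"
      using that assms(4) by (intro span_is_submodule) auto
  qed
  show ?thesis using *[of A A'] *[of A' A] assms by auto
qed

text \<open>The standard elements span a complement of \<open>B\<close>, as in Macaulay's theorem on initial ideals.\<close>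

lemma (in vectorspace) dim_eq_dim_subspace_plus_card_standard:
  fixes key :: "'x \<Rightarrow> 'o :: linorder"
  assumes fd: fin_dim and B: "VectorSpace.subspace K B V" and X: "finite X"
    and e: "\<And>x. x \<in> X \<Longrightarrow> e x \<in> carrier V" and key: "inj_on key X"
    and gen: "carrier V \<subseteq> span (B \<union> e ` X)"
  shows "dim = vectorspace.dim K (vs B) +
           card {t \<in> X. e t \<notin> span (B \<union> e ` {s \<in> X. key s < key t})}"
proof -
  interpret B: vectorspace K "vs B" by (rule subspace_is_vs[OF B])
  have subB: "submodule K B V" using B by simp
  then have BV: "B \<subseteq> carrier V" by (simp add: submodule_def)
  obtain b where b: "finite b" "B.basis b"
    using B.finite_basis_exists subspace_fin_dim[OF fd B] by auto
  then have bB: "b \<subseteq> B" by (simp add: B.basis_def)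
  have b_indep: "lin_indpt b"
    using b span_li_not_depend(2)[OF bB subB] by (simp add: B.basis_def)
  have b_span: "span b = B"
    using b span_li_not_depend(1)[OF bB subB] by (simp add: B.basis_def)
  have span_B: "span B = B"
    using span_is_subset[OF order.refl subB] in_own_span[OF BV] by auto
  \<comment> \<open>Defined for an arbitrary set \<open>Y\<close>, so that \<open>X\<close> can be
    built up element by element in order of increasing \<open>key\<close>.\<close>
  define std where "std Y = {t \<in> Y. e t \<notin> span (B \<union> e ` {s \<in> Y. key s < key t})}" for Y
  have "lin_indpt (b \<union> e ` std X) \<and> span (b \<union> e ` std X) = span (B \<union> e ` X) \<and>
        card (b \<union> e ` std X) = card b + card (std X)"
    using X e key
  proof (induction X rule: finite_ranking_induct[where f = key])
    case empty
    then show ?case using b_indep b_span span_B by (simp add: std_def)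
  next
    case (insert x Y)
    show ?case
    proof (cases "x \<in> Y")
      case True
      then have "insert x Y = Y" by auto
      then show ?thesis using insert by simp
    next
      case False
      have less: "key y < key x" if "y \<in> Y" for y
        using insert.hyps(2)[OF that] insert.prems(2) that False
        by (metis inj_onD insertI1 insertI2 order_le_imp_less_or_eq)
      let ?A = "b \<union> e ` std Y"
      have IH: "lin_indpt ?A" "span ?A = span (B \<union> e ` Y)" "card ?A = card b + card (std Y)"
        using insert.IH insert.prems by (auto intro: inj_on_subset)
      have eY: "e ` Y \<subseteq> carrier V" and ex: "e x \<in> carrier V" using insert.prems by auto
      have AV: "?A \<subseteq> carrier V" using eY bB BV by (auto simp: std_def)
      have finA: "finite ?A" using b insert.hyps by (simp add: std_def)
      \<comment> \<open>The new element has the largest key, so it does not alter which of the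
        earlier elements are standard.\<close>
      have below: "{s \<in> insert x Y. key s < key t} = {s \<in> Y. key s < key t}" if "t \<in> Y" for t
        using less[OF that] by auto
      have below_x: "{s \<in> insert x Y. key s < key x} = Y" using less by auto
      have std_ins: "std (insert x Y) = std Y \<union> (if e x \<in> span (B \<union> e ` Y) then {} else {x})"
        using below below_x unfolding std_def by (auto simp del: mem_Collect_eq)
      have span_ins: "span (insert (e x) ?A) = span (insert (e x) (B \<union> e ` Y))"
        using AV BV eY IH(2) ex by (intro span_insert_eq) auto
      show ?thesis
      proof (cases "e x \<in> span (B \<union> e ` Y)")
        case True
        have "span (B \<union> e ` Y) = span (insert (e x) (B \<union> e ` Y))"
          using already_in_span[of "B \<union> e ` Y" "e x"] True BV eY by simp
        then show ?thesis using True IH by (simp add: std_ins)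
      next
        case new: False
        then have "e x \<notin> ?A" using IH(2) in_own_span[OF AV] by auto
        moreover from this have "lin_indpt (insert (e x) ?A)"
          using lin_dep_iff_in_span[OF AV IH(1) ex] IH(2) new by auto
        moreover have "x \<notin> std Y" using False by (simp add: std_def)
        moreover have "finite (std Y)" using insert.hyps by (simp add: std_def)
        ultimately show ?thesis using new IH span_ins finA by (simp add: std_ins)
      qed
    qed
  qed
  moreover have "b \<union> e ` std X \<subseteq> carrier V" using bB BV e by (auto simp: std_def)
  moreover have "span (B \<union> e ` X) = carrier V"
    using gen span_is_subset2[of "B \<union> e ` X"] BV e by auto
  ultimately have "basis (b \<union> e ` std X)" "card (b \<union> e ` std X) = card b + card (std X)"
    by (auto simp: basis_def)
  then have "dim = card b + card (std X)" using dim_basis[of "b \<union> e ` std X"] b X by (simp add: std_def)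
  then show ?thesis using B.dim_basis b by (simp add: std_def)
qed

text \<open>Lifts of a finite spanning set of \<open>W\<close> together with a finite spanning set
  of the kernel span \<open>V\<close>: every vector differs from one in their span by an element of
  the kernel.\<close>

lemma (in linear_map) fin_dim_if_ker_im:
  assumes W: W.fin_dim and k: "vectorspace.fin_dim K (V\<lparr>carrier := ker\<rparr>)"
    and surj: "T ` carrier V = carrier W"
  shows V.fin_dim
proof -
  interpret k: vectorspace K "V\<lparr>carrier := ker\<rparr>" by (rule V.subspace_is_vs[OF kerT_is_subspace])
  have subk: "submodule K ker V" by (rule ker_is_submodule)
  obtain A where A: "finite A" "A \<subseteq> carrier W" "W.module.span A = carrier W"
    using W by (auto simp: W.fin_dim_def)
  obtain C where C: "finite C" "C \<subseteq> ker" "k.span C = ker"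
    using k by (auto simp: k.fin_dim_def)
  have CV: "C \<subseteq> carrier V" using C subk by (auto simp: submodule_def)
  have spanC: "V.module.span C = ker" using C V.module.span_li_not_depend(1)[OF C(2) subk] by simp
  define A' where "A' = inv_into (carrier V) T ` A"
  have inv: "inv_into (carrier V) T y \<in> carrier V" "T (inv_into (carrier V) T y) = y" if "y \<in> A" for y
  proof -
    have "y \<in> T ` carrier V" using that A(2) surj by blast
    then show "inv_into (carrier V) T y \<in> carrier V" "T (inv_into (carrier V) T y) = y"
      by (simp_all add: inv_into_into f_inv_into_f)
  qed
  have A': "finite A'" "A' \<subseteq> carrier V" using A(1) inv(1) by (auto simp: A'_def)
  have TA': "T ` A' = A" using inv(2) by (auto simp: A'_def image_image)
  let ?S = "V.module.span (A' \<union> C)"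
  have subS: "submodule K ?S V" using A' CV by (intro V.module.span_is_submodule) auto
  have own: "A' \<union> C \<subseteq> ?S" using A' CV by (intro V.module.in_own_span) auto
  interpret S: submodule K ?S V by (rule subS)
  have "submodule K (T ` ?S) W"
  proof (unfold_locales)
    show "T ` ?S \<subseteq> carrier W" using S.subset by blast
    show "v \<oplus>\<^bsub>W\<^esub> w \<in> T ` ?S" if v: "v \<in> T ` ?S" and w: "w \<in> T ` ?S" for v w
    proof -
      obtain x y where "x \<in> ?S" "y \<in> ?S" "v = T x" "w = T y" using v w by blast
      moreover from this have "x \<in> carrier V" "y \<in> carrier V" using S.subset by blast+
      ultimately show ?thesis by (intro image_eqI[of _ _ "x \<oplus>\<^bsub>V\<^esub> y"]) simp_all
    qed
    show "\<zero>\<^bsub>W\<^esub> \<in> T ` ?S" by (intro image_eqI[of _ _ "\<zero>\<^bsub>V\<^esub>"]) simp_all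
    show "c \<odot>\<^bsub>W\<^esub> v \<in> T ` ?S" if c: "c \<in> carrier K" and v: "v \<in> T ` ?S" for c v
    proof -
      obtain x where "x \<in> ?S" "v = T x" using v by blast
      moreover from this have "x \<in> carrier V" using S.subset by blast
      ultimately show ?thesis using c by (intro image_eqI[of _ _ "c \<odot>\<^bsub>V\<^esub> x"]) simp_all
    qed
  qed
  moreover have "A \<subseteq> T ` ?S" using TA' own by auto
  ultimately have "carrier W \<subseteq> T ` ?S" using W.module.span_is_subset[of A "T ` ?S"] A by auto
  have "carrier V \<subseteq> ?S"
  proof
    fix x assume x: "x \<in> carrier V"
    then have "T x \<in> T ` ?S" using \<open>carrier W \<subseteq> T ` ?S\<close> by blast
    then obtain s where s: "s \<in> ?S" "T x = T s" by blast
    have sV: "s \<in> carrier V" using s S.subset by blast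
    have "T (x \<ominus>\<^bsub>V\<^esub> s) = T s \<ominus>\<^bsub>W\<^esub> T s" using f_minus[OF x sV] s by simp
    also have "\<dots> = \<zero>\<^bsub>W\<^esub>" using sV by (simp add: a_minus_def W.module.M.r_neg)
    finally have "x \<ominus>\<^bsub>V\<^esub> s \<in> ker" unfolding ker_def using x sV by simp
    moreover have "ker \<subseteq> ?S" unfolding spanC[symmetric] by (rule V.module.span_is_monotone) blast
    ultimately have "(x \<ominus>\<^bsub>V\<^esub> s) \<oplus>\<^bsub>V\<^esub> s \<in> ?S" using s by blast
    moreover have "(x \<ominus>\<^bsub>V\<^esub> s) \<oplus>\<^bsub>V\<^esub> s = x"
      using x sV by (simp add: a_minus_def V.module.M.a_assoc V.module.M.l_neg)
    ultimately show "x \<in> ?S" by simp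
  qed
  then have "?S = carrier V" using S.subset by blast
  then show ?thesis unfolding V.fin_dim_def using A' C(1) CV by blast
qed

text \<open>The equivalence matters besides the formula: along a filtration, the finite dimension of
  a step is known only through the previous step, which is the kernel, and the quotient.\<close>

lemma (in linear_map) rank_nullity_surj:
  assumes surj: "T ` carrier V = carrier W"
  shows "V.fin_dim \<longleftrightarrow> W.fin_dim \<and> vectorspace.fin_dim K (V\<lparr>carrier := ker\<rparr>)"
    and "V.fin_dim \<Longrightarrow> V.dim = W.dim + vectorspace.dim K (V\<lparr>carrier := ker\<rparr>)"
proof -
  show "V.fin_dim \<longleftrightarrow> W.fin_dim \<and> vectorspace.fin_dim K (V\<lparr>carrier := ker\<rparr>)"
    using surj_fin_dim[OF _ surj] V.subspace_fin_dim[OF _ kerT_is_subspace] fin_dim_if_ker_im[OF _ _ surj]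
    by blast
  show "V.fin_dim \<Longrightarrow> V.dim = W.dim + vectorspace.dim K (V\<lparr>carrier := ker\<rparr>)"
    using rank_nullity surj_imp_imT_carrier[OF surj] by simp
qed

text \<open>\<open>W\<close> is a bare record of operations. It inherits the vector space axioms
  because each of its elements is a value of \<open>f\<close> and \<open>f\<close> respects the
  operations; this is how \<open>quotient_module\<close> is seen to be a vector space.\<close>

lemma linear_map_onto_image:
  assumes V: "vectorspace K V" and im: "f ` carrier V = carrier W"
    and zero: "f \<zero>\<^bsub>V\<^esub> = \<zero>\<^bsub>W\<^esub>"
    and add: "\<And>x y. x \<in> carrier V \<Longrightarrow> y \<in> carrier V \<Longrightarrow> f (x \<oplus>\<^bsub>V\<^esub> y) = f x \<oplus>\<^bsub>W\<^esub> f y"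
    and smult: "\<And>c x. c \<in> carrier K \<Longrightarrow> x \<in> carrier V \<Longrightarrow> f (c \<odot>\<^bsub>V\<^esub> x) = c \<odot>\<^bsub>W\<^esub> f x"
  shows "linear_map K V W f"
proof -
  interpret V: vectorspace K V by (rule V)
  have mem: "f x \<in> carrier W" if "x \<in> carrier V" for x using im that by auto
  have pre: "\<exists>x. x \<in> carrier V \<and> v = f x" if "v \<in> carrier W" for v
    using that unfolding im[symmetric] by auto
  have "vectorspace K W"
  proof (rule vs_criteria; (intro allI impI ballI)?; (elim conjE)?)
    show "field K" by (rule V.field_axioms)
    show "\<zero>\<^bsub>W\<^esub> \<in> carrier W" using mem[OF V.M.zero_closed] zero by simp
  next
    fix v assume "v \<in> carrier W"
    then obtain x where x: "x \<in> carrier V" "v = f x" using pre by blast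
    have "v \<oplus>\<^bsub>W\<^esub> f (\<ominus>\<^bsub>V\<^esub> x) = \<zero>\<^bsub>W\<^esub>"
      using x add[of x "\<ominus>\<^bsub>V\<^esub> x"] zero by (simp add: V.M.r_neg)
    then show "\<exists>w\<in>carrier W. v \<oplus>\<^bsub>W\<^esub> w = \<zero>\<^bsub>W\<^esub>" using mem[of "\<ominus>\<^bsub>V\<^esub> x"] x by blast
    show "v \<oplus>\<^bsub>W\<^esub> \<zero>\<^bsub>W\<^esub> = v" using x add[of x "\<zero>\<^bsub>V\<^esub>"] zero by simp
    show "\<one>\<^bsub>K\<^esub> \<odot>\<^bsub>W\<^esub> v = v" using x smult[of "\<one>\<^bsub>K\<^esub>" x] by simp
  next
    fix v w assume "v \<in> carrier W" "w \<in> carrier W"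
    then obtain x y where xy: "x \<in> carrier V" "v = f x" "y \<in> carrier V" "w = f y"
      using pre by blast
    show "v \<oplus>\<^bsub>W\<^esub> w \<in> carrier W" unfolding xy add[OF xy(1,3), symmetric] using xy by (intro mem) simp
    show "v \<oplus>\<^bsub>W\<^esub> w = w \<oplus>\<^bsub>W\<^esub> v"
      unfolding xy add[OF xy(1,3), symmetric] add[OF xy(3,1), symmetric] using xy by (simp add: V.M.a_comm)
  next
    fix c v assume c: "c \<in> carrier K" "v \<in> carrier W"
    then obtain x where x: "x \<in> carrier V" "v = f x" using pre by blast
    show "c \<odot>\<^bsub>W\<^esub> v \<in> carrier W" unfolding x smult[OF c(1) x(1), symmetric] using x c by (intro mem) simp
  next
    fix v w u assume "v \<in> carrier W" "w \<in> carrier W" "u \<in> carrier W"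
    then obtain x y z where xy: "x \<in> carrier V" "v = f x" "y \<in> carrier V" "w = f y" "z \<in> carrier V" "u = f z"
      using pre by metis
    show "v \<oplus>\<^bsub>W\<^esub> w \<oplus>\<^bsub>W\<^esub> u = v \<oplus>\<^bsub>W\<^esub> (w \<oplus>\<^bsub>W\<^esub> u)"
      using xy add[of "x \<oplus>\<^bsub>V\<^esub> y" z] add[of x "y \<oplus>\<^bsub>V\<^esub> z"] add[of x y] add[of y z]
      by (simp add: V.M.a_assoc)
  next
    fix a b v assume ab: "a \<in> carrier K" "b \<in> carrier K" "v \<in> carrier W"
    then obtain x where x: "x \<in> carrier V" "v = f x" using pre by blast
    show "(a \<otimes>\<^bsub>K\<^esub> b) \<odot>\<^bsub>W\<^esub> v = a \<odot>\<^bsub>W\<^esub> (b \<odot>\<^bsub>W\<^esub> v)"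
      using x ab smult[of "a \<otimes>\<^bsub>K\<^esub> b" x] smult[of a "b \<odot>\<^bsub>V\<^esub> x"] smult[of b x]
      by (simp add: V.smult_assoc1)
    show "(a \<oplus>\<^bsub>K\<^esub> b) \<odot>\<^bsub>W\<^esub> v = a \<odot>\<^bsub>W\<^esub> v \<oplus>\<^bsub>W\<^esub> b \<odot>\<^bsub>W\<^esub> v"
      using x ab smult[of "a \<oplus>\<^bsub>K\<^esub> b" x] smult[of a x] smult[of b x] add[of "a \<odot>\<^bsub>V\<^esub> x" "b \<odot>\<^bsub>V\<^esub> x"]
      by (simp add: V.smult_l_distr)
  next
    fix a v w assume a: "a \<in> carrier K" "v \<in> carrier W" "w \<in> carrier W"
    then obtain x y where xy: "x \<in> carrier V" "v = f x" "y \<in> carrier V" "w = f y"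
      using pre by blast
    show "a \<odot>\<^bsub>W\<^esub> (v \<oplus>\<^bsub>W\<^esub> w) = a \<odot>\<^bsub>W\<^esub> v \<oplus>\<^bsub>W\<^esub> a \<odot>\<^bsub>W\<^esub> w"
      using xy a add[of x y] smult[of a "x \<oplus>\<^bsub>V\<^esub> y"] smult[of a x] smult[of a y]
        add[of "a \<odot>\<^bsub>V\<^esub> x" "a \<odot>\<^bsub>V\<^esub> y"]
      by (simp add: V.smult_r_distr)
  qed
  moreover have "mod_hom K V W f"
    unfolding mod_hom_def mod_hom_axioms_def LinearCombinations.module_hom_def
    using V.module_axioms \<open>vectorspace K W\<close> mem add smult by (auto simp: vectorspace_def)
  ultimately show ?thesis by (simp add: linear_map_def V)
qed

section \<open>Quotient spaces and filtrations\<close>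

lemma (in vectorspace) subspace_imp_abelian_subgroup:
  assumes "VectorSpace.subspace K B V"
  shows "abelian_subgroup B V"
proof -
  interpret B: submodule K B V using assms by simp
  have "\<ominus>\<^bsub>V\<^esub> x \<in> B" if "x \<in> B" for x
  proof -
    have "\<ominus>\<^bsub>K\<^esub> \<one>\<^bsub>K\<^esub> \<odot>\<^bsub>V\<^esub> x \<in> B" using that by (intro B.smult_closed) simp_all
    moreover have "x \<in> carrier V" using that B.subset by blast
    ultimately show ?thesis by (simp only: smult_minus_1)
  qed
  then have "subgroup B (add_monoid V)"
    using B.subset by (intro subgroup.intro) (auto simp: a_inv_def)
  then show ?thesis
    by (intro abelian_subgroupI3 additive_subgroup.intro M.abelian_group_axioms)
qed

lemma linear_map_quotient_module:
  fixes V :: "('k, 'v) module"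
  assumes V: "vectorspace K V" and A: "VectorSpace.subspace K A V" and B: "VectorSpace.subspace K B V" and BA: "B \<subseteq> A"
  defines "\<pi> \<equiv> \<lambda>x. B +>\<^bsub>V\<^esub> x" and "Q \<equiv> quotient_module V A B"
  shows "linear_map K (V\<lparr>carrier := A\<rparr>) Q \<pi>" and "\<pi> ` A = carrier Q"
    and "mod_hom.ker (V\<lparr>carrier := A\<rparr>) Q \<pi> = B"
proof -
  interpret V: vectorspace K V by (rule V)
  interpret A: submodule K A V using A by simp
  interpret B: submodule K B V using B by simp
  interpret S: abelian_subgroup B V by (rule V.subspace_imp_abelian_subgroup[OF B])
  have cos: "B +>\<^bsub>V\<^esub> (b \<oplus>\<^bsub>V\<^esub> y) = B +>\<^bsub>V\<^esub> y" if "b \<in> B" "y \<in> carrier V" for b y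
    using that S.a_repr_independence'[of "b \<oplus>\<^bsub>V\<^esub> y" y] by (auto simp: a_r_coset_def')
  have AV: "x \<in> carrier V" if "x \<in> A" for x using that A.subset by auto
  have BV: "x \<in> carrier V" if "x \<in> B" for x using that B.subset by auto
  show im: "\<pi> ` A = carrier Q" by (simp add: \<pi>_def Q_def quotient_module_def)
  show lin: "linear_map K (V\<lparr>carrier := A\<rparr>) Q \<pi>"
  proof (rule linear_map_onto_image)
    show "vectorspace K (V\<lparr>carrier := A\<rparr>)" by (rule V.subspace_is_vs[OF A])
    show "\<pi> ` carrier (V\<lparr>carrier := A\<rparr>) = carrier Q" using im by simp
    have "B +>\<^bsub>V\<^esub> \<zero>\<^bsub>V\<^esub> = B" using S.a_rcos_const[of "\<zero>\<^bsub>V\<^esub>"] by simp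
    then show "\<pi> \<zero>\<^bsub>V\<lparr>carrier := A\<rparr>\<^esub> = \<zero>\<^bsub>Q\<^esub>" by (simp add: \<pi>_def Q_def quotient_module_def)
    show "\<pi> (x \<oplus>\<^bsub>V\<lparr>carrier := A\<rparr>\<^esub> y) = \<pi> x \<oplus>\<^bsub>Q\<^esub> \<pi> y" if "x \<in> carrier (V\<lparr>carrier := A\<rparr>)" "y \<in> carrier (V\<lparr>carrier := A\<rparr>)" for x y
      using that AV by (simp add: \<pi>_def Q_def quotient_module_def S.a_rcos_sum)
    show "\<pi> (c \<odot>\<^bsub>V\<lparr>carrier := A\<rparr>\<^esub> x) = c \<odot>\<^bsub>Q\<^esub> \<pi> x" if c: "c \<in> carrier K" and "x \<in> carrier (V\<lparr>carrier := A\<rparr>)" for c x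
    proof -
      have x: "x \<in> carrier V" using that AV by simp
      \<comment> \<open>Scalar multiplication in the quotient is a union over all representatives
        \<open>z\<close>. They all yield the same coset, so the union is that coset.\<close>
      have "B +>\<^bsub>V\<^esub> (c \<odot>\<^bsub>V\<^esub> z) = B +>\<^bsub>V\<^esub> (c \<odot>\<^bsub>V\<^esub> x)" if z: "z \<in> B +>\<^bsub>V\<^esub> x" for z
      proof -
        obtain b where "b \<in> B" "z = b \<oplus>\<^bsub>V\<^esub> x" using z by (auto simp: a_r_coset_def')
        then show ?thesis using x c BV cos[of "c \<odot>\<^bsub>V\<^esub> b" "c \<odot>\<^bsub>V\<^esub> x"] by (simp add: V.smult_r_distr)
      qed
      moreover have "x \<in> B +>\<^bsub>V\<^esub> x" using S.a_rcos_self[OF x] by simp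
      ultimately have "(\<Union>z\<in>B +>\<^bsub>V\<^esub> x. B +>\<^bsub>V\<^esub> (c \<odot>\<^bsub>V\<^esub> z)) = B +>\<^bsub>V\<^esub> (c \<odot>\<^bsub>V\<^esub> x)"
        by blast
      then show ?thesis by (simp add: \<pi>_def Q_def quotient_module_def)
    qed
  qed
  interpret \<pi>: linear_map K "V\<lparr>carrier := A\<rparr>" Q \<pi> by (rule lin)
  have "x \<in> B" if "B +>\<^bsub>V\<^esub> x = B" "x \<in> A" for x
    using S.a_rcos_self[of x] that AV by auto
  then show "\<pi>.ker = B"
    using BA S.a_rcos_const unfolding \<pi>.ker_def by (auto simp: \<pi>_def Q_def quotient_module_def)
qed

text \<open>The preimage of the submodule on the right is a submodule that contains
  \<open>S\<close>, hence contains its span.\<close>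

lemma (in linear_map) image_span_subset:
  assumes "S \<subseteq> carrier V"
  shows "T ` V.module.span S \<subseteq> W.module.span (T ` S)"
proof -
  let ?N = "{x \<in> carrier V. T x \<in> W.module.span (T ` S)}"
  have TS: "T ` S \<subseteq> carrier W" using assms by auto
  interpret N: submodule K "W.module.span (T ` S)" W by (rule W.module.span_is_submodule[OF TS])
  have "submodule K ?N V"
  proof (rule submodule.intro)
    show "Module.module K V" by (rule V.module.module_axioms)
    show "\<zero>\<^bsub>V\<^esub> \<in> ?N" using N.zero_closed f0_is_0 by simp
    show "v \<oplus>\<^bsub>V\<^esub> w \<in> ?N" if "v \<in> ?N" "w \<in> ?N" for v w
      using that N.m_closed[of "T v" "T w"] T_add[of v w] by simp
    show "c \<odot>\<^bsub>V\<^esub> v \<in> ?N" if "c \<in> carrier K" "v \<in> ?N" for c v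
      using that N.smult_closed[of c "T v"] T_smult[of c v] by simp
  qed blast
  moreover have "S \<subseteq> ?N" using assms W.module.in_own_span[OF TS] by auto
  ultimately have "V.module.span S \<subseteq> ?N" by (intro V.module.span_is_subset)
  then show ?thesis by auto
qed

lemma (in vectorspace) zero_space:
  assumes "VectorSpace.subspace K {\<zero>\<^bsub>V\<^esub>} V"
  shows "vectorspace.fin_dim K (vs {\<zero>\<^bsub>V\<^esub>})" "vectorspace.dim K (vs {\<zero>\<^bsub>V\<^esub>}) = 0"
proof -
  interpret Z: vectorspace K "vs {\<zero>\<^bsub>V\<^esub>}" by (rule subspace_is_vs[OF assms])
  have "Z.span {} = {\<zero>\<^bsub>V\<^esub>}" using Z.span_empty by simp
  then have gen: "Z.gen_set {}" by simp
  then show "Z.fin_dim" unfolding Z.fin_dim_def by (intro exI[of _ "{}"]) simp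
  have "Z.dim \<le> card ({} :: 'c set)" using gen by (intro Z.gen_ge_dim) simp_all
  then show "Z.dim = 0" by simp
qed

lemma (in linear_map) iso_dim:
  assumes "bij_betw T (carrier V) (carrier W)" "W.fin_dim"
  shows "V.fin_dim" "V.dim = W.dim"
proof -
  have surj: "T ` carrier V = carrier W" and inj: "inj_on T (carrier V)"
    using assms(1) by (auto simp: bij_betw_def)
  have ker: "ker = {\<zero>\<^bsub>V\<^esub>}" using inj_imp_Ker0[OF inj] by simp
  have "VectorSpace.subspace K {\<zero>\<^bsub>V\<^esub>} V" using kerT_is_subspace by (simp add: ker)
  note z = V.zero_space[OF this]
  show fd: "V.fin_dim" using rank_nullity_surj(1)[OF surj] assms(2) z(1) by (simp add: ker)
  show "V.dim = W.dim" using rank_nullity_surj(2)[OF surj fd] z(2) by (simp add: ker)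
qed

text \<open>The direct sum \<open>D\<close> carries a filtration of its own with the same successive
  quotients \<open>Q i\<close>, so the two dimensions agree step by step.\<close>

lemma dim_filtration:
  fixes V :: "('k, 'v) module" and Q :: "nat \<Rightarrow> ('k, 'u) module" and D :: "('k, nat \<Rightarrow> 'u) module"
  assumes V: "vectorspace K V" and D: "vectorspace K D" and fd: "vectorspace.fin_dim K D"
    and D_simps: "carrier D = (\<Pi>\<^sub>E i\<in>{..<n}. carrier (Q i))" "\<zero>\<^bsub>D\<^esub> = (\<lambda>i\<in>{..<n}. \<zero>\<^bsub>Q i\<^esub>)"
      "\<And>x y. x \<oplus>\<^bsub>D\<^esub> y = (\<lambda>i\<in>{..<n}. x i \<oplus>\<^bsub>Q i\<^esub> y i)" "\<And>c x. c \<odot>\<^bsub>D\<^esub> x = (\<lambda>i\<in>{..<n}. c \<odot>\<^bsub>Q i\<^esub> x i)"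
    and F: "\<And>i. i \<le> n \<Longrightarrow> VectorSpace.subspace K (F i) V" "F 0 = {\<zero>\<^bsub>V\<^esub>}" "F n = carrier V"
    and \<pi>: "\<And>i. i < n \<Longrightarrow> linear_map K (V\<lparr>carrier := F (Suc i)\<rparr>) (Q i) (\<pi> i)"
      "\<And>i. i < n \<Longrightarrow> \<pi> i ` F (Suc i) = carrier (Q i)"
      "\<And>i. i < n \<Longrightarrow> mod_hom.ker (V\<lparr>carrier := F (Suc i)\<rparr>) (Q i) (\<pi> i) = F i"
  shows "vectorspace.fin_dim K V" "vectorspace.dim K V = vectorspace.dim K D"
proof -
  interpret V: vectorspace K V by (rule V)
  interpret D: vectorspace K D by (rule D)
  have Q: "vectorspace K (Q i)" if "i < n" for i using \<pi>(1)[OF that] by (simp add: linear_map_def)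
  \<comment> \<open>\<open>E i\<close> is the sum of the first \<open>i\<close> summands. The
    projection of \<open>E (Suc i)\<close> to coordinate \<open>i\<close> has kernel
    \<open>E i\<close> and image \<open>Q i\<close>, just as \<open>\<pi> i\<close> has kernel
    \<open>F i\<close> and image \<open>Q i\<close>.\<close>
  define E where "E i = {x \<in> carrier D. \<forall>j. i \<le> j \<and> j < n \<longrightarrow> x j = \<zero>\<^bsub>Q j\<^esub>}" for i
  have sub_E: "VectorSpace.subspace K (E i) D" for i
    unfolding VectorSpace.subspace_def
  proof (intro conjI D submodule.intro)
    show "Module.module K D" by (rule D.module_axioms)
    show "\<zero>\<^bsub>D\<^esub> \<in> E i" using D.M.zero_closed by (simp add: E_def D_simps(2))
    show "x \<oplus>\<^bsub>D\<^esub> y \<in> E i" if xy: "x \<in> E i" "y \<in> E i" for x y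
    proof -
      have "(x \<oplus>\<^bsub>D\<^esub> y) j = \<zero>\<^bsub>Q j\<^esub>" if j: "i \<le> j" "j < n" for j
      proof -
        interpret Qj: vectorspace K "Q j" by (rule Q[OF j(2)])
        show ?thesis using xy j by (simp add: E_def D_simps(3))
      qed
      moreover have "x \<oplus>\<^bsub>D\<^esub> y \<in> carrier D" using xy by (intro D.M.a_closed) (simp_all add: E_def)
      ultimately show ?thesis by (simp add: E_def)
    qed
    show "c \<odot>\<^bsub>D\<^esub> x \<in> E i" if cx: "c \<in> carrier K" "x \<in> E i" for c x
    proof -
      have "(c \<odot>\<^bsub>D\<^esub> x) j = \<zero>\<^bsub>Q j\<^esub>" if j: "i \<le> j" "j < n" for j
      proof -
        interpret Qj: vectorspace K "Q j" by (rule Q[OF j(2)])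
        show ?thesis using cx j by (simp add: E_def D_simps(4))
      qed
      moreover have "c \<odot>\<^bsub>D\<^esub> x \<in> carrier D" using cx by (intro D.smult_closed) (simp_all add: E_def)
      ultimately show ?thesis by (simp add: E_def)
    qed
  qed (simp add: E_def)
  have "vectorspace.fin_dim K (V\<lparr>carrier := F i\<rparr>) \<and>
      vectorspace.dim K (V\<lparr>carrier := F i\<rparr>) = vectorspace.dim K (D\<lparr>carrier := E i\<rparr>)" if "i \<le> n" for i
    using that
  proof (induction i)
    case 0
    have "x = \<zero>\<^bsub>D\<^esub>" if "x \<in> E 0" for x
      using that by (intro extensionalityI[of _ "{..<n}"]) (auto simp: E_def D_simps PiE_iff)
    moreover have "\<zero>\<^bsub>D\<^esub> \<in> E 0" using D.M.zero_closed by (simp add: E_def D_simps(2))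
    ultimately have E0: "E 0 = {\<zero>\<^bsub>D\<^esub>}" by blast
    show ?case
      using V.zero_space D.zero_space sub_E[of 0] F(1)[of 0] by (simp add: E0 F(2))
  next
    case (Suc i)
    then have i: "i < n" by simp
    interpret \<pi>: linear_map K "V\<lparr>carrier := F (Suc i)\<rparr>" "Q i" "\<pi> i" by (rule \<pi>(1)[OF i])
    interpret Qi: vectorspace K "Q i" by (rule Q[OF i])
    have im: "(\<lambda>x. x i) ` E (Suc i) = carrier (Q i)"
    proof (intro equalityI subsetI)
      fix q assume q: "q \<in> carrier (Q i)"
      let ?x = "\<lambda>j\<in>{..<n}. if j = i then q else \<zero>\<^bsub>Q j\<^esub>"
      have "\<zero>\<^bsub>Q j\<^esub> \<in> carrier (Q j)" if j: "j < n" for j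
      proof -
        interpret Qj: vectorspace K "Q j" by (rule Q[OF j])
        show ?thesis by simp
      qed
      then have "?x \<in> E (Suc i)" using q by (auto simp: E_def D_simps(1))
      then show "q \<in> (\<lambda>x. x i) ` E (Suc i)" using i by (intro image_eqI[of _ _ ?x]) simp_all
    qed (use i in \<open>auto simp: E_def D_simps(1) PiE_iff\<close>)
    have pr: "linear_map K (D\<lparr>carrier := E (Suc i)\<rparr>) (Q i) (\<lambda>x. x i)"
      using i im by (intro linear_map_onto_image D.subspace_is_vs sub_E) (simp_all add: D_simps)
    interpret pr: linear_map K "D\<lparr>carrier := E (Suc i)\<rparr>" "Q i" "\<lambda>x. x i" by (rule pr)
    have ker: "pr.ker = E i"
    proof -
      have "pr.ker = {x \<in> E (Suc i). x i = \<zero>\<^bsub>Q i\<^esub>}" by (simp add: pr.ker_def)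
      also have "\<dots> = E i" using i unfolding E_def by (auto simp: le_Suc_eq Suc_le_eq dest: le_neq_implies_less)
      finally show ?thesis .
    qed
    have fdE: "vectorspace.fin_dim K (D\<lparr>carrier := E (Suc i)\<rparr>)"
      by (rule D.subspace_fin_dim[OF fd sub_E])
    have surj: "(\<lambda>x. x i) ` carrier (D\<lparr>carrier := E (Suc i)\<rparr>) = carrier (Q i)" using im by simp
    have surj': "\<pi> i ` carrier (V\<lparr>carrier := F (Suc i)\<rparr>) = carrier (Q i)" using \<pi>(2)[OF i] by simp
    note D_rank = pr.rank_nullity_surj[OF surj, unfolded ker]
    note V_rank = \<pi>.rank_nullity_surj[OF surj', unfolded \<pi>(3)[OF i]]
    have "vectorspace.fin_dim K (Q i)" using D_rank(1) fdE by blast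
    then have "vectorspace.fin_dim K (V\<lparr>carrier := F (Suc i)\<rparr>)" using V_rank(1) Suc by simp
    then show ?case using V_rank(2) D_rank(2)[OF fdE] Suc by simp
  qed
  from this[of n] have "vectorspace.fin_dim K (V\<lparr>carrier := carrier V\<rparr>)"
    "vectorspace.dim K (V\<lparr>carrier := carrier V\<rparr>) = vectorspace.dim K (D\<lparr>carrier := E n\<rparr>)"
    by (simp_all add: F(3))
  moreover have "E n = carrier D" by (auto simp: E_def)
  ultimately show "vectorspace.fin_dim K V" "vectorspace.dim K V = vectorspace.dim K D" by simp_all
qed

lemma dim_quotient_module:
  fixes V :: "('k, 'v) module"
  assumes V: "vectorspace K V" and fd: "vectorspace.fin_dim K V"
    and A: "VectorSpace.subspace K A V" and B: "VectorSpace.subspace K B V" and BA: "B \<subseteq> A"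
  shows "vectorspace.fin_dim K (quotient_module V A B)"
    "vectorspace.dim K (V\<lparr>carrier := A\<rparr>) =
       vectorspace.dim K (quotient_module V A B) + vectorspace.dim K (V\<lparr>carrier := B\<rparr>)"
proof -
  note q = linear_map_quotient_module[OF V A B BA]
  interpret V: vectorspace K V by (rule V)
  interpret q: linear_map K "V\<lparr>carrier := A\<rparr>" "quotient_module V A B" "\<lambda>x. B +>\<^bsub>V\<^esub> x" by (rule q(1))
  have fdA: "q.V.fin_dim" by (rule V.subspace_fin_dim[OF fd A])
  have surj: "(\<lambda>x. B +>\<^bsub>V\<^esub> x) ` carrier (V\<lparr>carrier := A\<rparr>) = carrier (quotient_module V A B)"
    using q(2) by simp
  note rank = q.rank_nullity_surj[OF surj, unfolded q(3)]
  show "q.W.fin_dim" using rank(1) fdA by blast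
  show "q.V.dim = q.W.dim + vectorspace.dim K (V\<lparr>carrier := B\<rparr>)" using rank(2)[OF fdA] by simp
qed

section \<open>Leading monomials\<close>

text \<open>The morphisms of the \<open>r\<close>-fold power of the category of finite sets and
  injections, with \<open>n\<close> standing for \<open>{..<n}\<close>. Values of \<open>f\<close>
  outside these ranges are arbitrary, whence the assumption \<open>T_cong\<close> below.\<close>

definition inj_tuple :: "nat \<Rightarrow> nat list \<Rightarrow> nat list \<Rightarrow> (nat \<Rightarrow> nat \<Rightarrow> nat) \<Rightarrow> bool" where
  "inj_tuple r ks ms f \<longleftrightarrow> (\<forall>i<r. inj_on (f i) {..<ks ! i} \<and> f i ` {..<ks ! i} \<subseteq> {..<ms ! i})"

lemma map_strict_mono_less:
  fixes xs ys :: "nat list"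
  assumes "strict_mono h" "xs < ys"
  shows "map h xs < map h ys"
  using assms(2)
proof (induction xs arbitrary: ys)
  case Nil
  then show ?case by (cases ys) auto
next
  case (Cons x xs)
  then show ?case using assms(1) by (cases ys) (auto simp: strict_mono_less)
qed

lemma list_less_same_length_iff:
  fixes xs ys :: "'a :: order list"
  assumes "length xs = length ys"
  shows "xs < ys \<longleftrightarrow> (\<exists>i<length xs. take i xs = take i ys \<and> xs ! i < ys ! i)"
  unfolding list_less_def lexord_take_index_conv using assms by auto

text \<open>A lexicographic comparison is decided at the first difference; entries before it stay
  equal and the entry at it stays smaller.\<close>

lemma map_upt_less_mono:
  fixes P Q P' Q' :: "nat \<Rightarrow> 'a :: order"
  assumes less: "map P [0..<r] < map Q [0..<r]"
    and eq: "\<And>i. i < r \<Longrightarrow> P i = Q i \<Longrightarrow> P' i = Q' i"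
    and mono: "\<And>i. i < r \<Longrightarrow> P i < Q i \<Longrightarrow> P' i < Q' i"
  shows "map P' [0..<r] < map Q' [0..<r]"
proof -
  obtain n where n: "n < r" "take n (map P [0..<r]) = take n (map Q [0..<r])" "P n < Q n"
    using less by (auto simp: list_less_same_length_iff)
  have "P i = Q i" if "i < n" for i
  proof -
    have "take n (map P [0..<r]) ! i = take n (map Q [0..<r]) ! i" by (simp only: n(2))
    then show ?thesis using that n(1) by simp
  qed
  then have "take n (map P' [0..<r]) = take n (map Q' [0..<r])"
    using eq n(1) by (auto simp: take_map)
  then show ?thesis using n mono by (auto simp: list_less_same_length_iff)
qed

text \<open>A representation of tuples of injections, generated in total degree at most
  \<open>d\<close>. Since \<open>generated\<close> admits only increasing injections, permuted
  generators have to be covered by \<open>gens\<close>. A list is used so that each generator has an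
  index that can enter the order on monomials.\<close>

locale tuple_module =
  fixes K :: "('k, 'b) ring_scheme" and r d :: nat
    and V :: "nat list \<Rightarrow> ('k, 'w) module"
    and T :: "nat list \<Rightarrow> nat list \<Rightarrow> (nat \<Rightarrow> nat \<Rightarrow> nat) \<Rightarrow> 'w \<Rightarrow> 'w"
    and gens :: "(nat list \<times> 'w) list"
  assumes vectorspace_V: "length ms = r \<Longrightarrow> vectorspace K (V ms)"
    and linear_T: "length ks = r \<Longrightarrow> length ms = r \<Longrightarrow> inj_tuple r ks ms f \<Longrightarrow>
      linear_map K (V ks) (V ms) (T ks ms f)"
    and T_comp: "length ks = r \<Longrightarrow> length ms = r \<Longrightarrow> length ns = r \<Longrightarrow> inj_tuple r ks ms f \<Longrightarrow>
      inj_tuple r ms ns h \<Longrightarrow> x \<in> carrier (V ks) \<Longrightarrow>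
      T ms ns h (T ks ms f x) = T ks ns (\<lambda>i k. h i (f i k)) x"
    and T_cong: "(\<And>i k. i < r \<Longrightarrow> k < ks ! i \<Longrightarrow> f i k = f' i k) \<Longrightarrow> T ks ms f = T ks ms f'"
    and gens: "(ks, w) \<in> set gens \<Longrightarrow> length ks = r \<and> sum_list ks \<le> d \<and> w \<in> carrier (V ks)"
    and generated: "length ms = r \<Longrightarrow> carrier (V ms) \<subseteq> LinearCombinations.module.span K (V ms)
      {T ks ms f w | ks w f. (ks, w) \<in> set gens \<and> inj_tuple r ks ms f \<and>
         (\<forall>i<r. \<forall>k k'. k < k' \<and> k' < ks ! i \<longrightarrow> f i k < f i k')}"
begin

abbreviation deg :: "nat \<Rightarrow> nat list" where "deg j \<equiv> fst (gens ! j)"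

abbreviation pos :: "(nat \<Rightarrow> nat list) \<Rightarrow> nat \<Rightarrow> nat list" where "pos x i \<equiv> positions 0 (x i)"

definition monomials :: "nat list \<Rightarrow> (nat \<times> (nat \<Rightarrow> nat list)) set" where
  "monomials ms = (SIGMA j:{..<length gens}. gap_vectors (deg j) ms)"

text \<open>The generator with index \<open>j\<close> placed at the subsets that have gaps
  \<open>x\<close>. Different monomials may have equal or linearly dependent values.\<close>

definition ev :: "nat list \<Rightarrow> nat \<times> (nat \<Rightarrow> nat list) \<Rightarrow> 'w" where
  "ev ms = (\<lambda>(j, x). T (deg j) ms (\<lambda>i k. pos x i ! k) (snd (gens ! j)))"

text \<open>Monomials are compared by generator and then lexicographically by positions. Inserting a gap at
  the same place into two monomials acts on positions by a strictly monotone map, so it preserves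
  this order.\<close>

definition key :: "nat \<times> (nat \<Rightarrow> nat list) \<Rightarrow> nat list list" where
  "key = (\<lambda>(j, x). [j] # map (pos x) [0..<r])"

lemma length_deg [simp]: "j < length gens \<Longrightarrow> length (deg j) = r"
  and sum_deg: "j < length gens \<Longrightarrow> sum_list (deg j) \<le> d"
  and gen_carrier: "j < length gens \<Longrightarrow> snd (gens ! j) \<in> carrier (V (deg j))"
  using gens[of "deg j" "snd (gens ! j)"] by auto

lemma finite_monomials: "finite (monomials ms)"
  by (auto simp: monomials_def finite_gap_vectors)

lemma gap_vectorsD:
  assumes "x \<in> gap_vectors ks ms" "length ks = r" "i < r"
  shows "length (x i) = Suc (ks ! i)" "sum_list (x i) + ks ! i = ms ! i" "length (pos x i) = ks ! i"
  using assms by (auto simp: gap_vectors_def PiE_iff)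

lemma inj_tuple_pos:
  assumes x: "x \<in> gap_vectors ks ms" and r: "length ks = r"
  shows "inj_tuple r ks ms (\<lambda>i k. pos x i ! k)"
  unfolding inj_tuple_def
proof (intro allI impI conjI)
  fix i assume i: "i < r"
  note D = gap_vectorsD[OF x r i]
  have "distinct (pos x i)" using sorted_positions strict_sorted_iff by blast
  then show "inj_on ((!) (pos x i)) {..<ks ! i}" using D(3) by (intro inj_on_nth) auto
  show "(!) (pos x i) ` {..<ks ! i} \<subseteq> {..<ms ! i}"
  proof (rule image_subsetI)
    fix k assume "k \<in> {..<ks ! i}"
    then have "pos x i ! k \<in> set (pos x i)" using D(3) by simp
    then show "pos x i ! k \<in> {..<ms ! i}" using positions_less[of _ 0 "x i"] D by fastforce
  qed
qed

lemma ev_carrier: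
  assumes "length ms = r" "t \<in> monomials ms"
  shows "ev ms t \<in> carrier (V ms)"
proof -
  obtain j x where t: "t = (j, x)" "j < length gens" "x \<in> gap_vectors (deg j) ms"
    using assms by (auto simp: monomials_def)
  interpret T: linear_map K "V (deg j)" "V ms" "T (deg j) ms (\<lambda>i k. pos x i ! k)"
    using t assms by (intro linear_T inj_tuple_pos) auto
  show ?thesis using t gen_carrier by (simp add: ev_def)
qed

text \<open>For fixed \<open>ms\<close> the totals of the gaps are prescribed, so the positions
  determine the gaps.\<close>

lemma inj_on_key: "inj_on key (monomials ms)"
proof (rule inj_onI)
  fix s t assume s: "s \<in> monomials ms" and t: "t \<in> monomials ms" and eq: "key s = key t"
  obtain j x where s: "s = (j, x)" "j < length gens" "x \<in> gap_vectors (deg j) ms"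
    using s by (auto simp: monomials_def)
  obtain y where t: "t = (j, y)" "y \<in> gap_vectors (deg j) ms"
    using t eq s(1) by (auto simp: monomials_def key_def)
  have "x = y"
  proof (rule PiE_ext[OF s(3)[unfolded gap_vectors_def] t(2)[unfolded gap_vectors_def]])
    fix i assume "i \<in> {..<length (deg j)}"
    then have i: "i < r" using s by simp
    have "pos x i = pos y i" using eq s t i by (simp add: key_def)
    moreover note D = gap_vectorsD[OF s(3) length_deg[OF s(2)] i] gap_vectorsD[OF t(2) length_deg[OF s(2)] i]
    moreover have "sum_list (x i) = sum_list (y i)" using D(2,5) by linarith
    ultimately show "x i = y i" by (intro positions_inject[of "x i" "y i" 0]) simp_all
  qed
  then show "s = t" using s t by simp
qed

lemma monomial_of_positions:
  assumes ks: "length ks = r"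
    and S: "\<And>i. i < r \<Longrightarrow> length (S i) = ks ! i" "\<And>i. i < r \<Longrightarrow> sorted_wrt (<) (S i)"
      "\<And>i s. i < r \<Longrightarrow> s \<in> set (S i) \<Longrightarrow> s < ms ! i"
  shows "\<exists>x \<in> gap_vectors ks ms. \<forall>i<r. pos x i = S i"
proof -
  have "\<forall>i\<in>{..<r}. \<exists>l. length l = Suc (ks ! i) \<and> sum_list l + ks ! i = ms ! i \<and> positions 0 l = S i"
    using positions_surj[of "S _" 0 "ms ! _"] S by force
  then obtain l where "\<forall>i\<in>{..<r}. length (l i) = Suc (ks ! i) \<and> sum_list (l i) + ks ! i = ms ! i \<and>
      positions 0 (l i) = S i"
    by metis
  then show ?thesis using ks by (intro bexI[of _ "restrict l {..<r}"]) (auto simp: gap_vectors_def)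
qed

text \<open>An increasing injection is determined by its image, so placing a generator along it is
  the monomial whose positions are its values.\<close>

lemma span_monomials:
  assumes ms: "length ms = r"
  shows "carrier (V ms) \<subseteq> LinearCombinations.module.span K (V ms) (ev ms ` monomials ms)"
proof -
  interpret vectorspace K "V ms" using ms by (rule vectorspace_V)
  have "T ks ms f w \<in> ev ms ` monomials ms"
    if gen: "(ks, w) \<in> set gens" and f: "inj_tuple r ks ms f"
      and mono: "\<forall>i<r. \<forall>k k'. k < k' \<and> k' < ks ! i \<longrightarrow> f i k < f i k'" for ks w f
  proof -
    obtain j where j: "j < length gens" "gens ! j = (ks, w)" using gen by (auto simp: in_set_conv_nth)
    then have ks: "length ks = r" using length_deg[of j] by simp
    have "f i k < ms ! i" if "i < r" "k < ks ! i" for i k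
      using f that unfolding inj_tuple_def by blast
    then have "\<exists>x \<in> gap_vectors ks ms. \<forall>i<r. pos x i = map (f i) [0..<ks ! i]"
      using mono by (intro monomial_of_positions[OF ks]) (auto simp: sorted_wrt_iff_nth_less)
    then obtain x where x: "x \<in> gap_vectors ks ms" "\<And>i. i < r \<Longrightarrow> pos x i = map (f i) [0..<ks ! i]"
      by blast
    have "T ks ms f = T ks ms (\<lambda>i k. pos x i ! k)" using x(2) by (intro T_cong) simp
    then have "T ks ms f w = ev ms (j, x)" using j by (simp add: ev_def)
    moreover have "(j, x) \<in> monomials ms" using j x(1) by (simp add: monomials_def)
    ultimately show ?thesis by (rule image_eqI)
  qed
  then have "{T ks ms f w | ks w f. (ks, w) \<in> set gens \<and> inj_tuple r ks ms f \<and>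
         (\<forall>i<r. \<forall>k k'. k < k' \<and> k' < ks ! i \<longrightarrow> f i k < f i k')} \<subseteq> ev ms ` monomials ms" by blast
  from span_is_monotone[OF this] show ?thesis using generated[OF ms] by blast
qed

lemma fin_dim_V:
  assumes ms: "length ms = r"
  shows "vectorspace.fin_dim K (V ms)"
proof -
  interpret vectorspace K "V ms" using ms by (rule vectorspace_V)
  have sub: "ev ms ` monomials ms \<subseteq> carrier (V ms)" using ev_carrier[OF ms] by auto
  then show ?thesis
    unfolding fin_dim_def using finite_monomials span_monomials[OF ms] span_is_subset2[OF sub]
    by (intro exI[of _ "ev ms ` monomials ms"]) auto
qed

text \<open>The tuple of increasing injections that raises the \<open>i\<close>-th entry of
  \<open>ms\<close> by one: component \<open>i\<close> omits \<open>p\<close>, the others are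
  identities.\<close>

definition insert_gap :: "nat \<Rightarrow> nat \<Rightarrow> nat \<Rightarrow> nat \<Rightarrow> nat" where
  "insert_gap i p i' y = (if i' = i then shift p y else y)"

lemma insert_gap_eq: "insert_gap i p i = shift p" "i' \<noteq> i \<Longrightarrow> insert_gap i p i' = (\<lambda>y. y)"
  by (auto simp: insert_gap_def)

lemma strict_mono_insert_gap: "strict_mono (insert_gap i p i')"
  using strict_mono_shift[of p] by (simp add: insert_gap_def strict_mono_def)

lemma insert_gap_less:
  "length ms = r \<Longrightarrow> i < r \<Longrightarrow> i' < r \<Longrightarrow> y < ms ! i' \<Longrightarrow> insert_gap i p i' y < ms[i := Suc (ms ! i)] ! i'"
  by (auto simp: insert_gap_def shift_def nth_list_update)

lemma inj_tuple_insert_gap: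
  assumes "length ms = r" "i < r"
  shows "inj_tuple r ms (ms[i := Suc (ms ! i)]) (insert_gap i p)"
  unfolding inj_tuple_def
  using insert_gap_less[OF assms] strict_mono_insert_gap[of i p]
  by (auto intro: inj_on_subset[OF strict_mono_imp_inj_on])

text \<open>A relation on positions instead of a formula on gaps, because one and the same map
  enlarges different gaps in different monomials: in each of them the gap into which the place
  \<open>p\<close> falls.\<close>

definition shifted :: "nat \<Rightarrow> nat \<Rightarrow> nat \<times> (nat \<Rightarrow> nat list) \<Rightarrow> nat \<times> (nat \<Rightarrow> nat list) \<Rightarrow> bool" where
  "shifted i p s s' \<longleftrightarrow> fst s' = fst s \<and>
     (\<forall>i'<r. pos (snd s') i' = map (insert_gap i p i') (pos (snd s) i'))"

lemma ex_shifted: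
  assumes ms: "length ms = r" "i < r" and s: "s \<in> monomials ms"
  shows "\<exists>s' \<in> monomials (ms[i := Suc (ms ! i)]). shifted i p s s'"
proof -
  obtain j x where s: "s = (j, x)" "j < length gens" "x \<in> gap_vectors (deg j) ms"
    using s by (auto simp: monomials_def)
  have "\<exists>x' \<in> gap_vectors (deg j) (ms[i := Suc (ms ! i)]).
      \<forall>i'<r. pos x' i' = map (insert_gap i p i') (pos x i')"
  proof (rule monomial_of_positions)
    show "length (deg j) = r" using s by simp
    fix i' assume i': "i' < r"
    note D = gap_vectorsD[OF s(3) _ i']
    show "length (map (insert_gap i p i') (pos x i')) = deg j ! i'" using D s by simp
    show "sorted_wrt (<) (map (insert_gap i p i') (pos x i'))"
      using sorted_positions[of 0 "x i'"] strict_mono_insert_gap[of i p i']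
      by (simp add: sorted_wrt_map strict_mono_less)
    fix y assume "y \<in> set (map (insert_gap i p i') (pos x i'))"
    then obtain q where q: "q \<in> set (pos x i')" "y = insert_gap i p i' q" by auto
    have "q < ms ! i'" using positions_less[OF q(1)] D s by fastforce
    then show "y < ms[i := Suc (ms ! i)] ! i'" using q insert_gap_less ms i' by simp
  qed
  then obtain x' where "x' \<in> gap_vectors (deg j) (ms[i := Suc (ms ! i)])"
    "\<forall>i'<r. pos x' i' = map (insert_gap i p i') (pos x i')" by blast
  then show ?thesis using s by (intro bexI[of _ "(j, x')"]) (auto simp: shifted_def monomials_def)
qed

lemma ev_shifted:
  assumes ms: "length ms = r" "i < r" and s: "s \<in> monomials ms" and "shifted i p s s'"
  shows "ev (ms[i := Suc (ms ! i)]) s' = T ms (ms[i := Suc (ms ! i)]) (insert_gap i p) (ev ms s)"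
proof -
  let ?ms = "ms[i := Suc (ms ! i)]"
  obtain j x where s: "s = (j, x)" "j < length gens" "x \<in> gap_vectors (deg j) ms"
    using s by (auto simp: monomials_def)
  obtain x' where s': "s' = (j, x')" "\<And>i'. i' < r \<Longrightarrow> pos x' i' = map (insert_gap i p i') (pos x i')"
    using assms(4) s by (cases s') (auto simp: shifted_def)
  have "T ms ?ms (insert_gap i p) (ev ms s) =
      T (deg j) ?ms (\<lambda>i' k. insert_gap i p i' (pos x i' ! k)) (snd (gens ! j))"
    using s ms gen_carrier inj_tuple_insert_gap inj_tuple_pos by (simp add: ev_def T_comp)
  also have "T (deg j) ?ms (\<lambda>i' k. insert_gap i p i' (pos x i' ! k)) = T (deg j) ?ms (\<lambda>i' k. pos x' i' ! k)"
    using s' gap_vectorsD[OF s(3)] s(2) by (intro T_cong) simp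
  finally show ?thesis using s' by (simp add: ev_def)
qed

lemma key_shifted:
  assumes "shifted i p s s'" "shifted i p t t'" "key s < key t"
  shows "key s' < key t'"
proof -
  obtain j x j' y where st: "s = (j, x)" "t = (j', y)" by (cases s, cases t)
  obtain x' y' where st': "s' = (j, x')" "t' = (j', y')"
    using assms st by (cases s', cases t') (auto simp: shifted_def)
  have "map (pos x') [0..<r] < map (pos y') [0..<r]" if "map (pos x) [0..<r] < map (pos y) [0..<r]"
    using that
  proof (rule map_upt_less_mono)
    fix i' assume i': "i' < r"
    have eqs: "pos x' i' = map (insert_gap i p i') (pos x i')" "pos y' i' = map (insert_gap i p i') (pos y i')"
      using assms st st' i' by (auto simp: shifted_def)
    show "pos x i' = pos y i' \<Longrightarrow> pos x' i' = pos y' i'" using eqs by simp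
    show "pos x i' < pos y i' \<Longrightarrow> pos x' i' < pos y' i'"
      using eqs map_strict_mono_less[OF strict_mono_insert_gap] by simp
  qed
  then show ?thesis using assms(3) by (auto simp: st st' key_def)
qed

section \<open>Leading monomials of a submodule\<close>

context
  fixes B :: "nat list \<Rightarrow> 'w set"
  assumes B_sub: "length ms = r \<Longrightarrow> VectorSpace.subspace K (B ms) (V ms)"
    and B_T: "length ks = r \<Longrightarrow> length ms = r \<Longrightarrow> inj_tuple r ks ms f \<Longrightarrow> T ks ms f ` B ks \<subseteq> B ms"
begin

definition standard :: "nat list \<Rightarrow> (nat \<times> (nat \<Rightarrow> nat list)) set" where
  "standard ms = {t \<in> monomials ms. ev ms t \<notin>
     LinearCombinations.module.span K (V ms) (B ms \<union> ev ms ` {s \<in> monomials ms. key s < key t})}"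

text \<open>These are the monomials whose value is, modulo \<open>B\<close>, a combination of values
  of smaller ones. Relations that hold in \<open>V ms\<close> itself count too, so there can be
  leading monomials even when \<open>B\<close> is zero.\<close>

definition leading :: "nat list \<Rightarrow> (nat \<times> (nat \<Rightarrow> nat list)) set" where
  "leading ms = monomials ms - standard ms"

lemma B_carrier: "length ms = r \<Longrightarrow> B ms \<subseteq> carrier (V ms)"
  using B_sub by (auto simp: VectorSpace.subspace_def submodule_def)

lemma dim_standard:
  assumes ms: "length ms = r"
  shows "vectorspace.dim K (V ms) = vectorspace.dim K (V ms\<lparr>carrier := B ms\<rparr>) + card (standard ms)"
proof -
  interpret vectorspace K "V ms" using ms by (rule vectorspace_V)
  show ?thesis unfolding standard_def
  proof (rule dim_eq_dim_subspace_plus_card_standard)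
    show "carrier (V ms) \<subseteq> span (B ms \<union> ev ms ` monomials ms)"
      using span_monomials[OF ms] span_is_monotone[of "ev ms ` monomials ms" "B ms \<union> ev ms ` monomials ms"]
      by blast
  qed (use fin_dim_V[OF ms] B_sub[OF ms] finite_monomials ev_carrier[OF ms] inj_on_key in auto)
qed

text \<open>Apply a gap insertion to the relation that makes \<open>(j, x)\<close> leading:
  \<open>B\<close> is preserved, smaller monomials go to smaller ones, and the top one goes to its
  increment.\<close>

lemma leading_increment:
  assumes ms: "length ms = r" and t: "(j, x) \<in> leading ms" and i: "i < r" and k: "k \<le> deg j ! i"
  shows "(j, increment i k x) \<in> leading (ms[i := Suc (ms ! i)])"
proof -
  let ?ms = "ms[i := Suc (ms ! i)]" and ?t' = "(j, increment i k x)"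
  have ms': "length ?ms = r" using ms by simp
  have t_mon: "(j, x) \<in> monomials ms" and
    t_span: "ev ms (j, x) \<in> LinearCombinations.module.span K (V ms) (B ms \<union> ev ms ` {s \<in> monomials ms. key s < key (j, x)})"
    using t by (auto simp: leading_def standard_def)
  have j: "j < length gens" and x: "x \<in> gap_vectors (deg j) ms" using t_mon by (auto simp: monomials_def)
  note D = gap_vectorsD[OF x length_deg[OF j] i]
  \<comment> \<open>The place of insertion is dictated by gap \<open>k\<close> of \<open>x\<close>;
    every other monomial of the relation is then shifted at this same \<open>p\<close>.\<close>
  obtain p where "positions 0 ((x i)[k := Suc (x i ! k)]) = map (shift p) (pos x i)"
    using positions_increment[of k "x i" 0] D k by auto
  then have sh: "shifted i p (j, x) ?t'"
    by (simp add: shifted_def increment_def insert_gap_eq)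
  have len: "k < length (x i)" using D k by simp
  have "sum_list ((x i)[k := Suc (x i ! k)]) = Suc (sum_list (x i))"
    using sum_list_update[OF len, of "Suc (x i ! k)"] member_le_sum_list[of "x i ! k" "x i"] len by simp
  then have blk: "length ((x i)[k := Suc (x i ! k)]) = Suc (deg j ! i)"
    "sum_list ((x i)[k := Suc (x i ! k)]) + deg j ! i = ?ms ! i" using D ms i by simp_all
  have "increment i k x \<in> gap_vectors (deg j) ?ms"
    unfolding gap_vectors_def increment_def
  proof (rule PiE_I)
    fix i' assume "i' \<in> {..<length (deg j)}"
    then show "(x(i := (x i)[k := Suc (x i ! k)])) i' \<in>
        {l. length l = Suc (deg j ! i') \<and> sum_list l + deg j ! i' = ?ms ! i'}"
      using blk gap_vectorsD(1,2)[OF x length_deg[OF j], of i'] length_deg[OF j]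
      by (cases "i' = i") simp_all
  next
    fix i' assume "i' \<notin> {..<length (deg j)}"
    then show "(x(i := (x i)[k := Suc (x i ! k)])) i' = undefined"
      using x i length_deg[OF j] unfolding gap_vectors_def by (auto simp: PiE_iff extensional_def)
  qed
  then have t'_mon: "?t' \<in> monomials ?ms" using j by (simp add: monomials_def)
  interpret h: linear_map K "V ms" "V ?ms" "T ms ?ms (insert_gap i p)"
    by (rule linear_T[OF ms ms' inj_tuple_insert_gap[OF ms i]])
  let ?S = "B ms \<union> ev ms ` {s \<in> monomials ms. key s < key (j, x)}"
  let ?S' = "B ?ms \<union> ev ?ms ` {s \<in> monomials ?ms. key s < key ?t'}"
  have "T ms ?ms (insert_gap i p) ` ?S \<subseteq> ?S'"
  proof (rule image_subsetI)
    fix y assume "y \<in> ?S"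
    then consider "y \<in> B ms" | s where "s \<in> monomials ms" "key s < key (j, x)" "y = ev ms s" by blast
    then show "T ms ?ms (insert_gap i p) y \<in> ?S'"
    proof cases
      case 1
      then show ?thesis using B_T[OF ms ms' inj_tuple_insert_gap[OF ms i]] by blast
    next
      case 2
      obtain s' where s': "s' \<in> monomials ?ms" "shifted i p s s'" using ex_shifted[OF ms i 2(1)] by blast
      have "T ms ?ms (insert_gap i p) y = ev ?ms s'" using 2(3) ev_shifted[OF ms i 2(1) s'(2)] by simp
      moreover have "s' \<in> {s \<in> monomials ?ms. key s < key ?t'}"
        using s'(1) key_shifted[OF s'(2) sh 2(2)] by simp
      ultimately show ?thesis by (intro UnI2 image_eqI[of _ _ s'])
    qed
  qed
  then have "h.W.module.span (T ms ?ms (insert_gap i p) ` ?S) \<subseteq> h.W.module.span ?S'"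
    by (rule h.W.module.span_is_monotone)
  moreover have "?S \<subseteq> carrier (V ms)" using B_carrier[OF ms] ev_carrier[OF ms] by auto
  ultimately have "T ms ?ms (insert_gap i p) (ev ms (j, x)) \<in> h.W.module.span ?S'"
    using h.image_span_subset[of ?S] t_span by blast
  then show ?thesis
    using t'_mon ev_shifted[OF ms i t_mon sh] by (simp add: leading_def standard_def)
qed

lemma eventually_poly_card_leading: "eventually_poly r d (\<lambda>ms. of_nat (card (leading ms)))"
proof -
  \<comment> \<open>A gap vector determines its tuple \<open>ms\<close>, as gaps plus number of
    chosen elements. This turns membership in \<open>leading ms\<close> into a predicate of the gap
    vector alone, which the counting lemma requires.\<close>
  define total where "total j x = map (\<lambda>i. deg j ! i + sum_list (x i)) [0..<r]" for j and x :: "nat \<Rightarrow> nat list"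
  let ?P = "\<lambda>j x. (j, x) \<in> leading (total j x)"
  have total: "total j x = ms" if "x \<in> gap_vectors (deg j) ms" "j < length gens" "length ms = r" for j x ms
    using gap_vectorsD[OF that(1)] that by (intro nth_equalityI) (auto simp: total_def add.commute)
  have "eventually_poly r (sum_list (deg j)) (\<lambda>ms. of_nat (card {x \<in> gap_vectors (deg j) ms. ?P j x}))"
    if j: "j < length gens" for j
  proof (rule eventually_poly_card_upward_closed)
    show "length (deg j) = r" using j by simp
    fix x i k
    assume x: "x \<in> (\<Pi>\<^sub>E i\<in>{..<r}. {l. length l = Suc (deg j ! i)})" and P: "?P j x"
      and i: "i < r" and k: "k \<le> deg j ! i"
    have len: "k < length (x i)" using x i k by (auto simp: PiE_iff)
    have "sum_list ((x i)[k := Suc (x i ! k)]) = Suc (sum_list (x i))"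
      using sum_list_update[OF len, of "Suc (x i ! k)"] member_le_sum_list[of "x i ! k" "x i"] len by simp
    then have "total j (increment i k x) = (total j x)[i := Suc (total j x ! i)]"
      using i by (intro nth_equalityI) (auto simp: total_def increment_def nth_list_update)
    then show "?P j (increment i k x)"
      using leading_increment[OF _ P i k] by (simp add: total_def)
  qed
  then have "eventually_poly r d (\<lambda>ms. \<Sum>j<length gens. of_nat (card {x \<in> gap_vectors (deg j) ms. ?P j x}))"
    using sum_deg by (intro eventually_poly_sum) (auto intro: eventually_poly_mono)
  then show ?thesis
  proof (rule eventually_poly_cong)
    fix ms :: "nat list" assume ms: "length ms = r"
    have "leading ms = (SIGMA j:{..<length gens}. {x \<in> gap_vectors (deg j) ms. ?P j x})"
      using total[OF _ _ ms] by (auto simp: leading_def monomials_def)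
    then have "card (leading ms) = (\<Sum>j<length gens. card {x \<in> gap_vectors (deg j) ms. ?P j x})"
      by (simp add: card_SigmaI finite_gap_vectors)
    then show "(\<Sum>j<length gens. rat_of_nat (card {x \<in> gap_vectors (deg j) ms. ?P j x})) =
        of_nat (card (leading ms))" by simp
  qed
qed

lemma card_leading:
  assumes ms: "length ms = r"
  shows "card (leading ms) + vectorspace.dim K (V ms) =
    vectorspace.dim K (V ms\<lparr>carrier := B ms\<rparr>) + card (monomials ms)"
proof -
  have "standard ms \<subseteq> monomials ms" by (auto simp: standard_def)
  then have "card (leading ms) = card (monomials ms) - card (standard ms)"
    "card (standard ms) \<le> card (monomials ms)"
    unfolding leading_def using finite_monomials
    by (auto intro!: card_Diff_subset card_mono intro: finite_subset)
  then show ?thesis using dim_standard[OF ms] by simp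
qed

end

text \<open>The number of leading monomials exceeds the dimension of the submodule by
  \<open>card (monomials ms)\<close> minus the dimension of \<open>V ms\<close>. This is independent
  of the submodule and cancels.\<close>

lemma eventually_poly_dim_diff:
  assumes A: "\<And>ms. length ms = r \<Longrightarrow> VectorSpace.subspace K (A ms) (V ms)"
      "\<And>ks ms f. length ks = r \<Longrightarrow> length ms = r \<Longrightarrow> inj_tuple r ks ms f \<Longrightarrow> T ks ms f ` A ks \<subseteq> A ms"
    and B: "\<And>ms. length ms = r \<Longrightarrow> VectorSpace.subspace K (B ms) (V ms)"
      "\<And>ks ms f. length ks = r \<Longrightarrow> length ms = r \<Longrightarrow> inj_tuple r ks ms f \<Longrightarrow> T ks ms f ` B ks \<subseteq> B ms"
  shows "eventually_poly r d (\<lambda>ms. of_nat (vectorspace.dim K (V ms\<lparr>carrier := A ms\<rparr>)) -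
           of_nat (vectorspace.dim K (V ms\<lparr>carrier := B ms\<rparr>)))"
proof (rule eventually_poly_cong)
  show "eventually_poly r d (\<lambda>ms. of_nat (card (leading A ms)) - of_nat (card (leading B ms)))"
    by (intro eventually_poly_diff eventually_poly_card_leading A B)
  fix ms :: "nat list" assume ms: "length ms = r"
  have "card (leading A ms) + vectorspace.dim K (V ms\<lparr>carrier := B ms\<rparr>) =
      card (leading B ms) + vectorspace.dim K (V ms\<lparr>carrier := A ms\<rparr>)"
    using card_leading[of A ms, OF A ms] card_leading[of B ms, OF B ms] by linarith
  then have "rat_of_nat (card (leading A ms)) + of_nat (vectorspace.dim K (V ms\<lparr>carrier := B ms\<rparr>)) =
      of_nat (card (leading B ms)) + of_nat (vectorspace.dim K (V ms\<lparr>carrier := A ms\<rparr>))"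
    by (metis of_nat_add)
  then show "rat_of_nat (card (leading A ms)) - of_nat (card (leading B ms)) =
      of_nat (vectorspace.dim K (V ms\<lparr>carrier := A ms\<rparr>)) - of_nat (vectorspace.dim K (V ms\<lparr>carrier := B ms\<rparr>))"
    by (simp add: algebra_simps)
qed

end

section \<open>Connectedness, genus and contractions\<close>

text \<open>In this form connectedness passes from one graph to another by pulling functions back,
  without constructing walks. From right to left, the test function is reachability from a fixed
  vertex.\<close>

lemma connected_iff_locally_constant:
  assumes "wf_digraph G"
  shows "Digraph_Component.connected G \<longleftrightarrow> verts G \<noteq> {} \<and>
    (\<forall>Q :: 'a \<Rightarrow> bool. (\<forall>e\<in>arcs G. Q (tail G e) = Q (head G e)) \<longrightarrow>
       (\<forall>u\<in>verts G. \<forall>v\<in>verts G. Q u = Q v))"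
    (is "_ \<longleftrightarrow> _ \<and> ?loc")
proof -
  interpret wf_digraph G by fact
  let ?R = "rtrancl_on (verts G) ((arcs_ends G)\<^sup>s)"
  have 1: "?loc" if reach: "\<forall>u\<in>verts G. \<forall>v\<in>verts G. (u, v) \<in> ?R"
  proof (intro allI impI ballI)
    fix Q :: "'a \<Rightarrow> bool" and u v
    assume Q: "\<forall>e\<in>arcs G. Q (tail G e) = Q (head G e)" and "u \<in> verts G" "v \<in> verts G"
    then have "(u, v) \<in> ?R" using reach by blast
    then show "Q u = Q v"
    proof (induction rule: rtrancl_on_induct)
      case (step y z)
      then show ?case using Q by (auto simp: arcs_ends_conv symcl_def)
    qed simp
  qed
  have 2: "(u, v) \<in> ?R" if loc: ?loc and u: "u \<in> verts G" and v: "v \<in> verts G" for u v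
  proof -
    define Q where "Q x \<longleftrightarrow> (u, x) \<in> ?R" for x
    have "Q (tail G e) = Q (head G e)" if e: "e \<in> arcs G" for e
    proof -
      have "(tail G e, head G e) \<in> (arcs_ends G)\<^sup>s" "(head G e, tail G e) \<in> (arcs_ends G)\<^sup>s"
        using e by (auto simp: arcs_ends_conv symcl_def)
      then show ?thesis unfolding Q_def using e by (meson rtrancl_on_into_rtrancl_on head_in_verts tail_in_verts)
    qed
    moreover have "Q u" using u by (simp add: Q_def)
    ultimately have "Q v" using loc[rule_format, of Q u v] u v by blast
    then show ?thesis by (simp add: Q_def)
  qed
  have "?loc \<longleftrightarrow> (\<forall>u\<in>verts G. \<forall>v\<in>verts G. (u, v) \<in> ?R)"
    by (rule iffI) (use 2 in simp, rule 1)
  then show ?thesis unfolding connected_conv by (simp only:)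
qed

text \<open>The boundary condition at a leaf forces the coefficient of its edge to vanish.\<close>

lemma homology1_eq_delete_leaves:
  assumes fin: "finite (arcs G)" and G: "wf_digraph G" and H: "wf_digraph H"
    and sub: "arcs H \<subseteq> arcs G"
    and ends: "\<And>e. e \<in> arcs H \<Longrightarrow> tail H e = tail G e \<and> head H e = head G e"
    and leaf: "\<And>e. e \<in> arcs G \<Longrightarrow> e \<notin> arcs H \<Longrightarrow> tail G e \<noteq> head G e \<and>
       (\<forall>e'\<in>arcs G. e' \<noteq> e \<longrightarrow> tail G e' \<noteq> head G e \<and> head G e' \<noteq> head G e)"
  shows "homology1 G = homology1 H"
proof -
  interpret G: wf_digraph G by (rule G)
  interpret H: wf_digraph H by (rule H)
  have sums: "(\<Sum>e\<in>in_arcs G v. z e) = (\<Sum>e\<in>in_arcs H v. z e)"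
    "(\<Sum>e\<in>out_arcs G v. z e) = (\<Sum>e\<in>out_arcs H v. z e)"
    if "\<forall>e. e \<notin> arcs H \<longrightarrow> z e = 0" for z :: "nat \<Rightarrow> int" and v
    using that fin sub ends
    by (auto intro!: sum.mono_neutral_right simp: in_arcs_def out_arcs_def)
  \<comment> \<open>The boundary conditions of the two graphs range over different vertex sets; at a
    vertex missing from a graph both sums over its arcs are empty.\<close>
  have none: "in_arcs G v = {} \<and> out_arcs G v = {}" if "v \<notin> verts G" for v
    using that by (auto simp: in_arcs_def out_arcs_def)
  have none': "in_arcs H v = {} \<and> out_arcs H v = {}" if "v \<notin> verts H" for v
    using that by (auto simp: in_arcs_def out_arcs_def)
  have supp: "z e = 0" if z: "z \<in> homology1 G" and e: "e \<notin> arcs H" for z e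
  proof (cases "e \<in> arcs G")
    case True
    then have "in_arcs G (head G e) = {e}" "out_arcs G (head G e) = {}"
      using leaf[OF True e] by (auto simp: in_arcs_def out_arcs_def)
    moreover have "head G e \<in> verts G" using True by simp
    ultimately show ?thesis using z by (force simp: homology1_def)
  qed (use z in \<open>auto simp: homology1_def\<close>)
  show ?thesis
  proof (intro equalityI subsetI)
    fix z assume z: "z \<in> homology1 G"
    then have "\<forall>e. e \<notin> arcs H \<longrightarrow> z e = 0" using supp by blast
    then show "z \<in> homology1 H"
      using z none sums[of z] unfolding homology1_def by (auto; metis sum.empty diff_zero)
  next
    fix z assume z: "z \<in> homology1 H"
    then have "\<forall>e. e \<notin> arcs H \<longrightarrow> z e = 0" by (simp add: homology1_def)
    then show "z \<in> homology1 G"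
      using z sub none' sums[of z] unfolding homology1_def by (auto; metis sum.empty diff_zero)
  qed
qed

lemma genus_eq_if_homology1_eq: "homology1 G = homology1 H \<Longrightarrow> genus G = genus H"
  by (simp add: genus_def)

text \<open>Deleting all leaves of the star leaves the single vertex \<open>c\<close>, so the first
  homology vanishes. Stars are the shape of the vertex fibers of \<open>collapse\<close>
  below.\<close>

lemma graph_of_genus_star:
  assumes S: "fin_digraph S" and c: "c \<in> verts S"
    and v: "\<And>v. v \<in> verts S \<Longrightarrow> v \<noteq> c \<Longrightarrow> \<exists>e\<in>arcs S. tail S e = c \<and> head S e = v"
    and e: "\<And>e. e \<in> arcs S \<Longrightarrow> tail S e = c \<and> head S e \<noteq> c" and inj: "inj_on (head S) (arcs S)"
  shows "graph_of_genus 0 S"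
proof -
  interpret S: fin_digraph S by (rule S)
  define P :: cw_graph where "P = \<lparr>verts = {c}, arcs = {}, tail = tail S, head = head S\<rparr>"
  have "homology1 S = homology1 P"
  proof (rule homology1_eq_delete_leaves)
    show "wf_digraph P" by (unfold_locales) (auto simp: P_def)
    show "tail S a \<noteq> head S a \<and>
      (\<forall>e'\<in>arcs S. e' \<noteq> a \<longrightarrow> tail S e' \<noteq> head S a \<and> head S e' \<noteq> head S a)"
      if "a \<in> arcs S" for a using that e inj by (metis inj_onD)
  qed (auto simp: P_def S.wf_digraph)
  also have "homology1 P = {\<lambda>_. 0}" by (auto simp: homology1_def P_def in_arcs_def out_arcs_def)
  finally have hom: "homology1 S = {\<lambda>_. 0}" .
  \<comment> \<open>The coefficient 1 at the zero chain is a nontrivial relation, so only the empty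
    family competes in the maximum that defines \<open>genus\<close>.\<close>
  have "\<not> int_independent {\<lambda>_. 0}" by (auto simp: int_independent_def intro: exI[of _ "\<lambda>_. 1"])
  then have "B = {}" if "B \<subseteq> {\<lambda>_. 0}" "int_independent B" for B
    using that by (metis subset_singletonD)
  moreover have "int_independent {}" by (simp add: int_independent_def)
  ultimately have "B \<subseteq> homology1 S \<and> int_independent B \<longleftrightarrow> B = {}" for B unfolding hom by blast
  then have "{card B | B. B \<subseteq> homology1 S \<and> int_independent B} = {0}" by simp
  then have "genus S = 0" by (simp add: genus_def)
  moreover have "Digraph_Component.connected S"
    unfolding connected_iff_locally_constant[OF S.wf_digraph]
  proof (intro conjI allI impI ballI)
    fix Q :: "nat \<Rightarrow> bool" and u w
    assume Q: "\<forall>e\<in>arcs S. Q (tail S e) = Q (head S e)" and "u \<in> verts S" "w \<in> verts S"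
    moreover have "Q x = Q c" if "x \<in> verts S" for x
      using v[OF that] Q by (cases "x = c") auto
    ultimately show "Q u = Q w" by simp
  qed (use c in auto)
  ultimately show ?thesis by (simp add: graph_of_genus_def S)
qed

lemma fin_digraph_vertex_fiber:
  assumes "fin_digraph G" "graph_morphism G H \<phi>"
  shows "fin_digraph (vertex_fiber G \<phi> w)"
proof -
  interpret fin_digraph G by fact
  show ?thesis
  proof (unfold_locales)
    fix e assume "e \<in> arcs (vertex_fiber G \<phi> w)"
    then have e: "e \<in> arcs G" "emap \<phi> e = None" "vmap \<phi> (tail G e) = w"
      by (auto simp: vertex_fiber_def)
    then have "vmap \<phi> (head G e) = w"
      using assms(2) by (force simp: graph_morphism_def)
    then show "tail (vertex_fiber G \<phi> w) e \<in> verts (vertex_fiber G \<phi> w)"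
      "head (vertex_fiber G \<phi> w) e \<in> verts (vertex_fiber G \<phi> w)"
      using e by (auto simp: vertex_fiber_def)
  qed (auto simp: vertex_fiber_def)
qed

text \<open>Both components of a morphism are extensional functions between finite sets. Later this
  keeps the list of generators finite.\<close>

lemma finite_contractions:
  assumes "fin_digraph G" "fin_digraph H"
  shows "finite {\<phi>. contraction G H \<phi>}"
proof -
  interpret G: fin_digraph G by fact
  interpret H: fin_digraph H by fact
  let ?V = "verts G \<rightarrow>\<^sub>E verts H"
  let ?E = "arcs G \<rightarrow>\<^sub>E insert None (Some ` (arcs H \<times> (UNIV :: bool set)))"
  have "{\<phi>. contraction G H \<phi>} \<subseteq> (\<lambda>(v, e). \<lparr>vmap = v, emap = e\<rparr>) ` (?V \<times> ?E)"
  proof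
    fix \<phi> assume "\<phi> \<in> {\<phi>. contraction G H \<phi>}"
    then have \<phi>: "graph_morphism G H \<phi>" by (simp add: contraction_def)
    have "emap \<phi> \<in> ?E"
    proof (rule PiE_I)
      fix e assume "e \<in> arcs G"
      then show "emap \<phi> e \<in> insert None (Some ` (arcs H \<times> UNIV))"
        using \<phi> unfolding graph_morphism_def by (cases "emap \<phi> e") fastforce+
    qed (use \<phi> in \<open>auto simp: graph_morphism_def extensional_def\<close>)
    moreover have "vmap \<phi> \<in> ?V" using \<phi> by (simp add: graph_morphism_def)
    ultimately show "\<phi> \<in> (\<lambda>(v, e). \<lparr>vmap = v, emap = e\<rparr>) ` (?V \<times> ?E)"
      by (intro image_eqI[of _ _ "(vmap \<phi>, emap \<phi>)"]) auto
  qed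
  moreover have "finite ((\<lambda>(v, e). \<lparr>vmap = v, emap = e\<rparr>) ` (?V \<times> ?E))"
    by (intro finite_imageI finite_cartesian_product finite_PiE) auto
  ultimately show ?thesis by (rule finite_subset)
qed

section \<open>Collapsing leaves\<close>

definition leaf_vert :: "cw_graph \<Rightarrow> nat \<Rightarrow> nat \<Rightarrow> nat" where
  "leaf_vert G i j = fresh (verts G) + prod_encode (i, j)"

definition leaf_arc :: "cw_graph \<Rightarrow> nat \<Rightarrow> nat \<Rightarrow> nat" where
  "leaf_arc G i j = fresh (arcs G) + prod_encode (i, j)"

lemma less_fresh: "finite A \<Longrightarrow> a \<in> A \<Longrightarrow> a < fresh A"
  by (simp add: fresh_def le_imp_less_Suc)

locale sprouting =
  fixes g :: nat and G :: cw_graph and vs :: "nat list"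
  assumes genus_G: "graph_of_genus g G" and vs_verts: "set vs \<subseteq> verts G"
begin

sublocale fin_digraph G using genus_G by (simp add: graph_of_genus_def)

abbreviation r :: nat where "r \<equiv> length vs"
abbreviation X :: "nat list \<Rightarrow> cw_graph" where "X ms \<equiv> sprout G vs ms"
abbreviation lv :: "nat \<Rightarrow> nat \<Rightarrow> nat" where "lv \<equiv> leaf_vert G"
abbreviation la :: "nat \<Rightarrow> nat \<Rightarrow> nat" where "la \<equiv> leaf_arc G"

lemma lv_notin [simp]: "lv i j \<notin> verts G"
  by (auto simp: leaf_vert_def dest!: less_fresh[OF finite_verts])

lemma la_notin [simp]: "la i j \<notin> arcs G"
  by (auto simp: leaf_arc_def dest!: less_fresh[OF finite_arcs])

lemma lv_neq [simp]: "v \<in> verts G \<Longrightarrow> v \<noteq> lv i j" "v \<in> verts G \<Longrightarrow> lv i j \<noteq> v" by auto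

lemma la_neq [simp]: "e \<in> arcs G \<Longrightarrow> e \<noteq> la i j" "e \<in> arcs G \<Longrightarrow> la i j \<noteq> e" by auto

lemma lv_eq_iff [simp]: "lv i j = lv i' j' \<longleftrightarrow> i = i' \<and> j = j'"
  by (simp add: leaf_vert_def)

lemma la_eq_iff [simp]: "la i j = la i' j' \<longleftrightarrow> i = i' \<and> j = j'"
  by (simp add: leaf_arc_def)

lemma vs_nth [simp]: "i < r \<Longrightarrow> vs ! i \<in> verts G"
  using vs_verts by (auto simp: subset_iff)

lemma verts_X: "verts (X ms) = verts G \<union> {lv i j | i j. i < r \<and> j < ms ! i}"
  by (auto simp: sprout_def Let_def leaf_vert_def image_iff)

lemma arcs_X: "arcs (X ms) = arcs G \<union> {la i j | i j. i < r \<and> j < ms ! i}"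
  by (auto simp: sprout_def Let_def leaf_arc_def image_iff)

lemma tail_X [simp]: "e \<in> arcs G \<Longrightarrow> tail (X ms) e = tail G e" "tail (X ms) (la i j) = vs ! i"
  using la_notin[of i j] by (auto simp: sprout_def Let_def leaf_arc_def)

lemma head_X [simp]: "e \<in> arcs G \<Longrightarrow> head (X ms) e = head G e" "head (X ms) (la i j) = lv i j"
  using la_notin[of i j] by (auto simp: sprout_def Let_def leaf_arc_def leaf_vert_def)

lemma vert_X_cases:
  assumes "v \<in> verts (X ms)"
  obtains "v \<in> verts G" | i j where "i < r" "j < ms ! i" "v = lv i j"
  using assms by (auto simp: verts_X)

lemma arc_X_cases:
  assumes "e \<in> arcs (X ms)"
  obtains "e \<in> arcs G" | i j where "i < r" "j < ms ! i" "e = la i j"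
  using assms by (auto simp: arcs_X)

lemma verts_X_I [simp]: "v \<in> verts G \<Longrightarrow> v \<in> verts (X ms)"
  "lv i j \<in> verts (X ms) \<longleftrightarrow> i < r \<and> j < ms ! i"
  by (auto simp: verts_X)

lemma arcs_X_I [simp]: "e \<in> arcs G \<Longrightarrow> e \<in> arcs (X ms)"
  "la i j \<in> arcs (X ms) \<longleftrightarrow> i < r \<and> j < ms ! i"
  by (auto simp: arcs_X)

lemma fin_digraph_X: "fin_digraph (X ms)"
proof (unfold_locales)
  fix e assume "e \<in> arcs (X ms)"
  then show "tail (X ms) e \<in> verts (X ms)" "head (X ms) e \<in> verts (X ms)"
    by (auto elim!: arc_X_cases)
next
  have "finite (SIGMA i:{..<r}. {..<ms ! i})" by auto
  then show "finite (verts (X ms))" "finite (arcs (X ms))"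
    by (auto simp: sprout_def Let_def)
qed

text \<open>Deleting the new leaf edges does not change the homology, and each new leaf hangs on an
  old vertex, so a locally constant function takes no values beyond those on
  \<open>G\<close>.\<close>

lemma genus_X: "graph_of_genus g (X ms)"
proof -
  interpret X: fin_digraph "X ms" by (rule fin_digraph_X)
  have "homology1 (X ms) = homology1 G"
  proof (rule homology1_eq_delete_leaves)
    fix e assume "e \<in> arcs (X ms)" "e \<notin> arcs G"
    then obtain i j where e: "i < r" "j < ms ! i" "e = la i j" by (auto elim: arc_X_cases)
    show "tail (X ms) e \<noteq> head (X ms) e \<and> (\<forall>e'\<in>arcs (X ms). e' \<noteq> e \<longrightarrow>
      tail (X ms) e' \<noteq> head (X ms) e \<and> head (X ms) e' \<noteq> head (X ms) e)"
      using e by (auto elim!: arc_X_cases)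
  qed (auto simp: X.wf_digraph wf_digraph)
  then have "genus (X ms) = g"
    using genus_eq_if_homology1_eq[of "X ms" G] genus_G by (simp add: graph_of_genus_def)
  moreover have "Digraph_Component.connected (X ms)"
    unfolding connected_iff_locally_constant[OF X.wf_digraph]
  proof (intro conjI allI impI ballI)
    have "Digraph_Component.connected G" using genus_G by (simp add: graph_of_genus_def)
    note con = this[unfolded connected_iff_locally_constant[OF wf_digraph]]
    show "verts (X ms) \<noteq> {}" using con by (auto simp: verts_X)
    fix Q :: "nat \<Rightarrow> bool" and u v
    assume Q: "\<forall>e\<in>arcs (X ms). Q (tail (X ms) e) = Q (head (X ms) e)"
      and "u \<in> verts (X ms)" "v \<in> verts (X ms)"
    moreover have "\<exists>y\<in>verts G. Q x = Q y" if x: "x \<in> verts (X ms)" for x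
      using x
    proof (cases rule: vert_X_cases)
      case (2 i j)
      then have "Q (vs ! i) = Q x" using Q[rule_format, of "la i j"] by simp
      then show ?thesis using 2 by (intro bexI[of _ "vs ! i"]) auto
    qed auto
    moreover have "\<forall>e\<in>arcs G. Q (tail G e) = Q (head G e)"
    proof
      fix e assume "e \<in> arcs G"
      then show "Q (tail G e) = Q (head G e)" using Q[rule_format, of e] by simp
    qed
    ultimately show "Q u = Q v" using con[THEN conjunct2, rule_format, of Q] by metis
  qed
  ultimately show ?thesis by (simp add: graph_of_genus_def fin_digraph_X)
qed

abbreviation leaf_inj :: "nat list \<Rightarrow> nat list \<Rightarrow> (nat \<Rightarrow> nat \<Rightarrow> nat) \<Rightarrow> bool" where
  "leaf_inj \<equiv> inj_tuple r"

text \<open>The \<open>j\<close>-th leaf at \<open>vs ! i\<close> survives iff \<open>j\<close> is in the range of \<open>f i\<close>, and is then relabelled by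
  its preimage.\<close>

definition collapse :: "nat list \<Rightarrow> nat list \<Rightarrow> (nat \<Rightarrow> nat \<Rightarrow> nat) \<Rightarrow> graph_map" where
  "collapse ms ks f =
    \<lparr>vmap = (\<lambda>v\<in>verts (X ms). if v \<in> verts G then v
       else let (i, j) = prod_decode (v - fresh (verts G)) in
         if j \<in> f i ` {..<ks ! i} then lv i (the_inv_into {..<ks ! i} (f i) j) else vs ! i),
     emap = (\<lambda>e\<in>arcs (X ms). if e \<in> arcs G then Some (e, False)
       else let (i, j) = prod_decode (e - fresh (arcs G)) in
         if j \<in> f i ` {..<ks ! i} then Some (la i (the_inv_into {..<ks ! i} (f i) j), False)
         else None)\<rparr>"

lemma collapse_old [simp]:
  "v \<in> verts G \<Longrightarrow> vmap (collapse ms ks f) v = v"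
  "e \<in> arcs G \<Longrightarrow> emap (collapse ms ks f) e = Some (e, False)"
  by (simp_all add: collapse_def)

lemma decode_lv: "prod_decode (lv i j - fresh (verts G)) = (i, j)"
  by (simp add: leaf_vert_def)

lemma decode_la: "prod_decode (la i j - fresh (arcs G)) = (i, j)"
  by (simp add: leaf_arc_def)

lemma collapse_kept:
  assumes "leaf_inj ks ms f" "i < r" "k < ks ! i"
  shows "vmap (collapse ms ks f) (lv i (f i k)) = lv i k"
    "emap (collapse ms ks f) (la i (f i k)) = Some (la i k, False)"
proof -
  have "f i k < ms ! i" "inj_on (f i) {..<ks ! i}" "f i k \<in> f i ` {..<ks ! i}"
    using assms by (auto simp: inj_tuple_def)
  moreover from this have "the_inv_into {..<ks ! i} (f i) (f i k) = k"
    using assms(3) by (intro the_inv_into_f_f) auto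
  ultimately show "vmap (collapse ms ks f) (lv i (f i k)) = lv i k"
    "emap (collapse ms ks f) (la i (f i k)) = Some (la i k, False)"
    using assms(2) by (simp_all add: collapse_def decode_lv decode_la)
qed

lemma collapse_dropped:
  assumes "i < r" "j < ms ! i" "j \<notin> f i ` {..<ks ! i}"
  shows "vmap (collapse ms ks f) (lv i j) = vs ! i"
    "emap (collapse ms ks f) (la i j) = None"
  using assms by (simp_all add: collapse_def decode_lv decode_la)

lemma collapse_extensional:
  "vmap (collapse ms ks f) \<in> extensional (verts (X ms))"
  "emap (collapse ms ks f) \<in> extensional (arcs (X ms))"
  by (simp_all add: collapse_def)

lemma leaf_cases:
  obtains (kept) k where "k < ks ! i" "j = f i k" | (dropped) "j \<notin> f i ` {..<ks ! i}"
  by blast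

lemma kept_less: "leaf_inj ks ms f \<Longrightarrow> i < r \<Longrightarrow> k < ks ! i \<Longrightarrow> f i k < ms ! i"
  by (auto simp: inj_tuple_def)

lemma kept_inj: "leaf_inj ks ms f \<Longrightarrow> i < r \<Longrightarrow> k < ks ! i \<Longrightarrow> k' < ks ! i \<Longrightarrow> f i k = f i k' \<longleftrightarrow> k = k'"
  by (auto simp: inj_tuple_def inj_on_def)

lemma graph_map_eqI:
  assumes "vmap \<phi> \<in> extensional (verts (X ms))" "vmap \<psi> \<in> extensional (verts (X ms))"
    and "emap \<phi> \<in> extensional (arcs (X ms))" "emap \<psi> \<in> extensional (arcs (X ms))"
    and "\<And>v. v \<in> verts G \<Longrightarrow> vmap \<phi> v = vmap \<psi> v" "\<And>e. e \<in> arcs G \<Longrightarrow> emap \<phi> e = emap \<psi> e"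
    and "\<And>i j. i < r \<Longrightarrow> j < ms ! i \<Longrightarrow> vmap \<phi> (lv i j) = vmap \<psi> (lv i j)"
    and "\<And>i j. i < r \<Longrightarrow> j < ms ! i \<Longrightarrow> emap \<phi> (la i j) = emap \<psi> (la i j)"
  shows "\<phi> = (\<psi> :: graph_map)"
proof -
  have "vmap \<phi> = vmap \<psi>"
    by (rule extensionalityI[OF assms(1,2)]) (use assms in \<open>auto elim: vert_X_cases\<close>)
  moreover have "emap \<phi> = emap \<psi>"
    by (rule extensionalityI[OF assms(3,4)]) (use assms in \<open>auto elim: arc_X_cases\<close>)
  ultimately show ?thesis by simp
qed

lemma collapse_cong:
  assumes "\<And>i k. i < r \<Longrightarrow> k < ks ! i \<Longrightarrow> f i k = f' i k"
  shows "collapse ms ks f = collapse ms ks f'"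
proof (rule graph_map_eqI[where ms = ms])
  fix i j assume ij: "i < r" "j < ms ! i"
  have im: "f i ` {..<ks ! i} = f' i ` {..<ks ! i}" using assms ij by (auto simp: image_iff)
  have "the_inv_into {..<ks ! i} (f i) j = the_inv_into {..<ks ! i} (f' i) j"
    unfolding the_inv_into_def using assms ij by (metis lessThan_iff)
  then show "vmap (collapse ms ks f) (lv i j) = vmap (collapse ms ks f') (lv i j)"
    "emap (collapse ms ks f) (la i j) = emap (collapse ms ks f') (la i j)"
    using ij im by (simp_all add: collapse_def decode_lv decode_la)
qed (simp_all add: collapse_extensional)

text \<open>\<open>collapse\<close> reverses composition. As representations are contravariant in
  contractions, the spaces at the graphs \<open>X ms\<close> become covariant in tuples of
  injections.\<close>

lemma collapse_comp:
  assumes f: "leaf_inj ks ms f" and h: "leaf_inj ms ns h"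
  shows "leaf_inj ks ns (\<lambda>i k. h i (f i k))"
    and "comp_map (X ns) (collapse ms ks f) (collapse ns ms h) = collapse ns ks (\<lambda>i k. h i (f i k))"
proof -
  show hf: "leaf_inj ks ns (\<lambda>i k. h i (f i k))"
    unfolding inj_tuple_def
    by (auto intro!: inj_onI simp: kept_inj[OF h] kept_inj[OF f] kept_less[OF f] kept_less[OF h])
  show "comp_map (X ns) (collapse ms ks f) (collapse ns ms h) = collapse ns ks (\<lambda>i k. h i (f i k))"
  proof (rule graph_map_eqI[where ms = ns])
    fix i j assume ij: "i < r" "j < ns ! i"
    have "vmap (collapse ms ks f) (vmap (collapse ns ms h) (lv i j)) =
        vmap (collapse ns ks (\<lambda>i k. h i (f i k))) (lv i j) \<and>
      (case emap (collapse ns ms h) (la i j) of None \<Rightarrow> None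
        | Some (e1, b1) \<Rightarrow> (case emap (collapse ms ks f) e1 of None \<Rightarrow> None
            | Some (e2, b2) \<Rightarrow> Some (e2, b1 \<noteq> b2))) =
        emap (collapse ns ks (\<lambda>i k. h i (f i k))) (la i j)"
    proof (cases rule: leaf_cases[where ks = ms and f = h and i = i and j = j])
      case (kept l)
      show ?thesis
      proof (cases rule: leaf_cases[where ks = ks and f = f and i = i and j = l])
        case kept': (kept k)
        then show ?thesis
          using kept ij collapse_kept[OF hf, of i k] collapse_kept[OF h, of i l] collapse_kept[OF f, of i k]
          by simp
      next
        case dropped
        then have "j \<notin> (\<lambda>k. h i (f i k)) ` {..<ks ! i}"
          using kept ij kept_inj[OF h] kept_less[OF f] by (auto simp: image_iff)
        then show ?thesis
          using kept ij dropped collapse_kept[OF h, of i l] by (simp add: collapse_dropped)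
      qed
    next
      case dropped
      then have "j \<notin> (\<lambda>k. h i (f i k)) ` {..<ks ! i}"
        using ij kept_less[OF f] by (auto simp: image_iff)
      then show ?thesis using ij dropped by (simp add: collapse_dropped)
    qed
    then show "vmap (comp_map (X ns) (collapse ms ks f) (collapse ns ms h)) (lv i j) =
        vmap (collapse ns ks (\<lambda>i k. h i (f i k))) (lv i j)"
      "emap (comp_map (X ns) (collapse ms ks f) (collapse ns ms h)) (la i j) =
        emap (collapse ns ks (\<lambda>i k. h i (f i k))) (la i j)"
      using ij by (simp_all add: comp_map_def compose_def)
  qed (simp_all add: collapse_extensional comp_map_def compose_def)
qed

lemma collapse_morphism:
  assumes f: "leaf_inj ks ms f"
  shows "graph_morphism (X ms) (X ks) (collapse ms ks f)"
proof -
  let ?c = "collapse ms ks f"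
  have "vmap ?c v \<in> verts (X ks)" if v: "v \<in> verts (X ms)" for v
    using v
  proof (cases rule: vert_X_cases)
    case (2 i j)
    then show ?thesis
      by (cases rule: leaf_cases[where ks = ks and f = f and i = i and j = j]) (auto simp: collapse_kept[OF f] collapse_dropped)
  qed auto
  moreover have "case emap ?c e of
          None \<Rightarrow> vmap ?c (tail (X ms) e) = vmap ?c (head (X ms) e)
        | Some (e', b) \<Rightarrow> e' \<in> arcs (X ks) \<and>
            (if b
             then vmap ?c (tail (X ms) e) = head (X ks) e' \<and> vmap ?c (head (X ms) e) = tail (X ks) e'
             else vmap ?c (tail (X ms) e) = tail (X ks) e' \<and> vmap ?c (head (X ms) e) = head (X ks) e')"
    if e: "e \<in> arcs (X ms)" for e
    using e
  proof (cases rule: arc_X_cases)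
    case (2 i j)
    then show ?thesis
      by (cases rule: leaf_cases[where ks = ks and f = f and i = i and j = j]) (auto simp: collapse_kept[OF f] collapse_dropped)
  qed auto
  ultimately show ?thesis
    unfolding graph_morphism_def using collapse_extensional by (auto simp: PiE_iff)
qed

text \<open>The fiber over an old vertex is the star of the dropped leaves around it, and the fiber
  over a leaf is a single point.\<close>

lemma collapse_contraction:
  assumes f: "leaf_inj ks ms f"
  shows "contraction (X ms) (X ks) (collapse ms ks f)"
  unfolding contraction_def
proof (intro conjI ballI)
  let ?c = "collapse ms ks f"
  show "graph_morphism (X ms) (X ks) ?c" by (rule collapse_morphism[OF f])
  fix w assume w: "w \<in> verts (X ks)"
  let ?S = "vertex_fiber (X ms) ?c w"
  have fin: "fin_digraph ?S" by (rule fin_digraph_vertex_fiber[OF fin_digraph_X collapse_morphism[OF f]])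
  have arcs_S: "\<exists>i j. e = la i j \<and> i < r \<and> j < ms ! i \<and> j \<notin> f i ` {..<ks ! i} \<and> w = vs ! i"
    if e: "e \<in> arcs ?S" for e
  proof -
    have "e \<in> arcs (X ms)" "emap ?c e = None" and t: "vmap ?c (tail (X ms) e) = w"
      using e by (auto simp: vertex_fiber_def)
    then obtain i j where ij: "i < r" "j < ms ! i" "e = la i j" "emap ?c (la i j) = None"
      by (auto elim: arc_X_cases)
    then have "j \<notin> f i ` {..<ks ! i}"
      by (cases rule: leaf_cases[where ks = ks and f = f and i = i and j = j]) (auto simp: collapse_kept[OF f])
    then show ?thesis using ij t by auto
  qed
  have inj: "inj_on (head ?S) (arcs ?S)"
  proof (rule inj_onI)
    fix x y assume "x \<in> arcs ?S" "y \<in> arcs ?S" "head ?S x = head ?S y"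
    then show "x = y" using arcs_S[of x] arcs_S[of y] by (auto simp: vertex_fiber_def)
  qed
  show "graph_of_genus 0 ?S"
    using w
  proof (cases rule: vert_X_cases)
    case 1
    show ?thesis
    proof (rule graph_of_genus_star[OF fin, of w])
      show "w \<in> verts ?S" using 1 by (simp add: vertex_fiber_def)
      show "\<exists>e\<in>arcs ?S. tail ?S e = w \<and> head ?S e = v" if v: "v \<in> verts ?S" "v \<noteq> w" for v
      proof -
        have "v \<in> verts (X ms)" and cv: "vmap ?c v = w" using v by (auto simp: vertex_fiber_def)
        then obtain i j where ij: "i < r" "j < ms ! i" "v = lv i j"
          using v by (auto elim: vert_X_cases)
        have nj: "j \<notin> f i ` {..<ks ! i}"
          using ij cv 1 by (cases rule: leaf_cases[where ks = ks and f = f and i = i and j = j]) (auto simp: collapse_kept[OF f])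
        then have "vs ! i = w" using cv ij by (simp add: collapse_dropped)
        then show ?thesis using ij nj 1
          by (intro bexI[of _ "la i j"]) (auto simp: vertex_fiber_def collapse_dropped)
      qed
      show "tail ?S e = w \<and> head ?S e \<noteq> w" if "e \<in> arcs ?S" for e
        using arcs_S[OF that] 1 by (auto simp: vertex_fiber_def)
    qed (rule inj)
  next
    case (2 i k)
    \<comment> \<open>A contracted leaf edge is sent to its old end \<open>vs ! i\<close>, so none
      lies over a leaf and the star has no arms.\<close>
    have no: "arcs ?S = {}" using arcs_S 2 by fastforce
    show ?thesis
    proof (rule graph_of_genus_star[OF fin, of "lv i (f i k)"])
      show "lv i (f i k) \<in> verts ?S"
        using 2 kept_less[OF f] by (simp add: vertex_fiber_def collapse_kept[OF f])
      show "\<exists>e\<in>arcs ?S. tail ?S e = lv i (f i k) \<and> head ?S e = v"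
        if v: "v \<in> verts ?S" "v \<noteq> lv i (f i k)" for v
      proof -
        have "v \<in> verts (X ms)" and cv: "vmap ?c v = w" using v by (auto simp: vertex_fiber_def)
        then obtain i' j where ij: "i' < r" "j < ms ! i'" "v = lv i' j"
          using 2 by (auto elim: vert_X_cases)
        have False
          using ij cv 2 v by (cases rule: leaf_cases[where ks = ks and f = f and i = i' and j = j]) (auto simp: collapse_kept[OF f] collapse_dropped)
        then show ?thesis ..
      qed
    qed (use no inj in auto)
  qed
next
  let ?c = "collapse ms ks f"
  fix e' assume e': "e' \<in> arcs (X ks)"
  have leaf: "\<exists>k<ks ! i. j = f i k \<and> e' = la i k"
    if "i < r" "j < ms ! i" "emap ?c (la i j) = Some (e', b)" for i j b
    using that by (cases rule: leaf_cases[where ks = ks and f = f and i = i and j = j]) (auto simp: collapse_kept[OF f] collapse_dropped)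
  show "\<exists>!e. e \<in> arcs (X ms) \<and> (\<exists>b. emap ?c e = Some (e', b))"
    using e'
  proof (cases rule: arc_X_cases)
    case 1
    show ?thesis
      by (rule ex1I[of _ e']) (use 1 leaf in \<open>auto elim!: arc_X_cases dest!: leaf\<close>)
  next
    case (2 i k)
    show ?thesis
      by (rule ex1I[of _ "la i (f i k)"])
        (use 2 kept_less[OF f] in \<open>auto simp: collapse_kept[OF f] elim!: arc_X_cases dest!: leaf\<close>)
  qed
qed

end

section \<open>Factoring a contraction through a collapse\<close>

context sprouting
begin

text \<open>A section of the collapse on cells; \<open>restr\<close> below is precomposition with it.\<close>

definition vsec :: "(nat \<Rightarrow> nat \<Rightarrow> nat) \<Rightarrow> nat \<Rightarrow> nat" where
  "vsec f v = (if v \<in> verts G then v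
     else let (i, k) = prod_decode (v - fresh (verts G)) in lv i (f i k))"

definition asec :: "(nat \<Rightarrow> nat \<Rightarrow> nat) \<Rightarrow> nat \<Rightarrow> nat" where
  "asec f e = (if e \<in> arcs G then e
     else let (i, k) = prod_decode (e - fresh (arcs G)) in la i (f i k))"

lemma sec_simps [simp]:
  "v \<in> verts G \<Longrightarrow> vsec f v = v" "vsec f (lv i k) = lv i (f i k)"
  "e \<in> arcs G \<Longrightarrow> asec f e = e" "asec f (la i k) = la i (f i k)"
  by (simp_all add: vsec_def asec_def decode_lv decode_la)

lemma sec_mem:
  assumes "leaf_inj ks ms f"
  shows "v \<in> verts (X ks) \<Longrightarrow> vsec f v \<in> verts (X ms)" "e \<in> arcs (X ks) \<Longrightarrow> asec f e \<in> arcs (X ms)"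
    "e \<in> arcs (X ks) \<Longrightarrow> tail (X ms) (asec f e) = vsec f (tail (X ks) e)"
    "e \<in> arcs (X ks) \<Longrightarrow> head (X ms) (asec f e) = vsec f (head (X ks) e)"
  using kept_less[OF assms] by (auto elim!: vert_X_cases arc_X_cases)

lemma asec_inj:
  assumes f: "leaf_inj ks ms f" and "e \<in> arcs (X ks)" "e' \<in> arcs (X ks)" "asec f e = asec f e'"
  shows "e = e'"
  using assms(2-) kept_inj[OF f] by (auto elim!: arc_X_cases)

lemma collapse_vsec:
  assumes f: "leaf_inj ks ms f" and "v \<in> verts (X ks)"
  shows "vmap (collapse ms ks f) (vsec f v) = v"
  using assms(2) by (auto elim!: vert_X_cases simp: collapse_kept[OF f])

definition restr :: "nat list \<Rightarrow> (nat \<Rightarrow> nat \<Rightarrow> nat) \<Rightarrow> graph_map \<Rightarrow> graph_map" where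
  "restr ks f \<phi> = \<lparr>vmap = (\<lambda>v\<in>verts (X ks). vmap \<phi> (vsec f v)),
                  emap = (\<lambda>e\<in>arcs (X ks). emap \<phi> (asec f e))\<rparr>"

context
  fixes ks ms f H \<phi>
  assumes f: "leaf_inj ks ms f" and \<phi>: "contraction (X ms) H \<phi>"
    and kept_iff: "\<And>i j. i < r \<Longrightarrow> j < ms ! i \<Longrightarrow> j \<in> f i ` {..<ks ! i} \<longleftrightarrow> emap \<phi> (la i j) \<noteq> None"
begin

lemma morphism_\<phi>: "graph_morphism (X ms) H \<phi>"
  using \<phi> by (simp add: contraction_def)

lemma extensional_\<phi>: "vmap \<phi> \<in> extensional (verts (X ms))" "emap \<phi> \<in> extensional (arcs (X ms))"
  using morphism_\<phi> by (simp_all add: graph_morphism_def PiE_iff)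

lemma emap_kept: "i < r \<Longrightarrow> k < ks ! i \<Longrightarrow> emap \<phi> (la i (f i k)) \<noteq> None"
  using kept_iff[of i "f i k"] kept_less[OF f] by auto

text \<open>By \<open>kept_iff\<close>, \<open>f\<close> enumerates exactly the leaves whose edge
  survives under \<phi>. Any other leaf is identified by \<phi> with its old end, so nothing is lost
  by collapsing it beforehand.\<close>

lemma vmap_dropped:
  assumes "i < r" "j < ms ! i" "j \<notin> f i ` {..<ks ! i}"
  shows "emap \<phi> (la i j) = None" "vmap \<phi> (lv i j) = vmap \<phi> (vs ! i)"
proof -
  show none: "emap \<phi> (la i j) = None" using kept_iff assms by blast
  have "la i j \<in> arcs (X ms)" using assms by simp
  then have "vmap \<phi> (tail (X ms) (la i j)) = vmap \<phi> (head (X ms) (la i j))"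
    using morphism_\<phi> none unfolding graph_morphism_def by (metis (mono_tags, lifting) option.simps(4))
  then show "vmap \<phi> (lv i j) = vmap \<phi> (vs ! i)" by simp
qed

lemma comp_restr: "comp_map (X ms) (restr ks f \<phi>) (collapse ms ks f) = \<phi>"
proof (rule graph_map_eqI[where ms = ms])
  fix i j assume ij: "i < r" "j < ms ! i"
  have "vmap (restr ks f \<phi>) (vmap (collapse ms ks f) (lv i j)) = vmap \<phi> (lv i j) \<and>
    (case emap (collapse ms ks f) (la i j) of None \<Rightarrow> None
        | Some (e1, b1) \<Rightarrow> (case emap (restr ks f \<phi>) e1 of None \<Rightarrow> None
            | Some (e2, b2) \<Rightarrow> Some (e2, b1 \<noteq> b2))) = emap \<phi> (la i j)"
  proof (cases rule: leaf_cases[where ks = ks and f = f and i = i and j = j])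
    case (kept k)
    then show ?thesis using ij by (auto simp: collapse_kept[OF f] restr_def split: option.splits)
  next
    case dropped
    then show ?thesis using ij vmap_dropped[OF ij dropped] by (simp add: collapse_dropped restr_def)
  qed
  then show "vmap (comp_map (X ms) (restr ks f \<phi>) (collapse ms ks f)) (lv i j) = vmap \<phi> (lv i j)"
    "emap (comp_map (X ms) (restr ks f \<phi>) (collapse ms ks f)) (la i j) = emap \<phi> (la i j)"
    using ij by (simp_all add: comp_map_def compose_def)
qed (auto simp: extensional_\<phi> comp_map_def compose_def restr_def split: option.splits)

text \<open>The section commutes with tails and heads, so the condition at an edge is that of \<phi>
  at its image under \<open>asec f\<close>.\<close>

lemma restr_morphism: "graph_morphism (X ks) H (restr ks f \<phi>)"
proof -
  have "case emap (restr ks f \<phi>) e of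
          None \<Rightarrow> vmap (restr ks f \<phi>) (tail (X ks) e) = vmap (restr ks f \<phi>) (head (X ks) e)
        | Some (e', b) \<Rightarrow> e' \<in> arcs H \<and>
            (if b
             then vmap (restr ks f \<phi>) (tail (X ks) e) = head H e' \<and> vmap (restr ks f \<phi>) (head (X ks) e) = tail H e'
             else vmap (restr ks f \<phi>) (tail (X ks) e) = tail H e' \<and> vmap (restr ks f \<phi>) (head (X ks) e) = head H e')"
    if e: "e \<in> arcs (X ks)" for e
  proof -
    interpret Xk: fin_digraph "X ks" by (rule fin_digraph_X)
    have eqs: "emap (restr ks f \<phi>) e = emap \<phi> (asec f e)"
      "vmap (restr ks f \<phi>) (tail (X ks) e) = vmap \<phi> (tail (X ms) (asec f e))"
      "vmap (restr ks f \<phi>) (head (X ks) e) = vmap \<phi> (head (X ms) (asec f e))"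
      using e sec_mem[OF f] by (simp_all add: restr_def)
    have "\<forall>e\<in>arcs (X ms). case emap \<phi> e of
          None \<Rightarrow> vmap \<phi> (tail (X ms) e) = vmap \<phi> (head (X ms) e)
        | Some (e', b) \<Rightarrow> e' \<in> arcs H \<and>
            (if b
             then vmap \<phi> (tail (X ms) e) = head H e' \<and> vmap \<phi> (head (X ms) e) = tail H e'
             else vmap \<phi> (tail (X ms) e) = tail H e' \<and> vmap \<phi> (head (X ms) e) = head H e')"
      using morphism_\<phi> unfolding graph_morphism_def by blast
    from bspec[OF this sec_mem(2)[OF f e]] show ?thesis unfolding eqs .
  qed
  moreover have "vmap (restr ks f \<phi>) \<in> verts (X ks) \<rightarrow>\<^sub>E verts H"
    using morphism_\<phi> sec_mem(1)[OF f] by (auto simp: restr_def graph_morphism_def PiE_iff)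
  moreover have "emap (restr ks f \<phi>) \<in> extensional (arcs (X ks))" by (simp add: restr_def)
  ultimately show ?thesis unfolding graph_morphism_def by blast
qed

text \<open>Up to the names of the kept leaves, the fiber of \<phi> over \<open>w\<close> is the
  fiber in question with dropped leaves attached. Deleting these keeps the homology, and collapsing
  them transports connectedness.\<close>

lemma restr_fiber:
  assumes w: "w \<in> verts H"
  shows "graph_of_genus 0 (vertex_fiber (X ks) (restr ks f \<phi>) w)"
proof -
  let ?\<psi> = "restr ks f \<phi>" and ?c = "vmap (collapse ms ks f)"
  let ?S = "vertex_fiber (X ks) ?\<psi> w" and ?T = "vertex_fiber (X ms) \<phi> w"
  have T: "graph_of_genus 0 ?T" using \<phi> w by (simp add: contraction_def)
  interpret S: fin_digraph ?S by (rule fin_digraph_vertex_fiber[OF fin_digraph_X restr_morphism])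
  interpret T: fin_digraph ?T by (rule fin_digraph_vertex_fiber[OF fin_digraph_X morphism_\<phi>])
  have verts_S: "v \<in> verts ?S \<longleftrightarrow> v \<in> verts (X ks) \<and> vmap \<phi> (vsec f v) = w" for v
    by (auto simp: vertex_fiber_def restr_def)
  have arcs_T: "e \<in> arcs ?T \<longleftrightarrow> e \<in> arcs (X ms) \<and> emap \<phi> e = None \<and> vmap \<phi> (tail (X ms) e) = w" for e
    by (auto simp: vertex_fiber_def)
  \<comment> \<open>Each leaf edge of \<open>X ks\<close> corresponds to one that \<phi> does not
    contract, so only edges of \<open>G\<close> occur in the fiber.\<close>
  have arcs_S: "e \<in> arcs ?S \<longleftrightarrow> e \<in> arcs G \<and> emap \<phi> e = None \<and> vmap \<phi> (tail G e) = w" for e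
  proof (cases "e \<in> arcs G")
    case True
    then show ?thesis by (simp add: vertex_fiber_def restr_def)
  next
    case False
    then have "e \<notin> arcs ?S"
      by (auto simp: vertex_fiber_def restr_def elim!: arc_X_cases dest: emap_kept)
    then show ?thesis using False by simp
  qed
  have ends: "tail ?S = tail (X ks)" "head ?S = head (X ks)" "tail ?T = tail (X ms)" "head ?T = head (X ms)"
    by (auto simp: vertex_fiber_def)
  have leaf_T: "\<exists>i j. e = la i j \<and> i < r \<and> j < ms ! i \<and> j \<notin> f i ` {..<ks ! i}"
    if "e \<in> arcs ?T" "e \<notin> arcs ?S" for e
  proof -
    have "e \<in> arcs (X ms)" "emap \<phi> e = None" "e \<notin> arcs G"
      using that by (auto simp: arcs_T arcs_S)
    then show ?thesis using kept_iff by (auto elim!: arc_X_cases)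
  qed
  have "homology1 ?T = homology1 ?S"
  proof (rule homology1_eq_delete_leaves)
    show "arcs ?S \<subseteq> arcs ?T" by (auto simp: arcs_T arcs_S)
    show "tail ?S e = tail ?T e \<and> head ?S e = head ?T e" if "e \<in> arcs ?S" for e
      using that by (simp add: arcs_S ends)
    fix e assume e: "e \<in> arcs ?T" "e \<notin> arcs ?S"
    obtain i j where "e = la i j" "i < r" using leaf_T[OF e] by blast
    then show "tail ?T e \<noteq> head ?T e \<and>
       (\<forall>e'\<in>arcs ?T. e' \<noteq> e \<longrightarrow> tail ?T e' \<noteq> head ?T e \<and> head ?T e' \<noteq> head ?T e)"
      unfolding ends by (auto simp: arcs_T elim!: arc_X_cases)
  qed (auto simp: S.wf_digraph T.wf_digraph)
  then have genus: "genus ?S = 0"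
    using T genus_eq_if_homology1_eq[of ?T ?S] by (simp add: graph_of_genus_def)
  have "Digraph_Component.connected ?T" using T by (simp add: graph_of_genus_def)
  note con = this[unfolded connected_iff_locally_constant[OF T.wf_digraph]]
  have c_T: "?c t \<in> verts ?S" if t: "t \<in> verts ?T" for t
  proof -
    have "t \<in> verts (X ms)" and wt: "vmap \<phi> t = w" using t by (auto simp: vertex_fiber_def)
    then show ?thesis
    proof (cases rule: vert_X_cases)
      case (2 i j)
      then show ?thesis
        using wt vmap_dropped[of i j]
        by (cases rule: leaf_cases[where ks = ks and f = f and i = i and j = j])
          (auto simp: verts_S collapse_kept[OF f] collapse_dropped)
    qed (auto simp: verts_S)
  qed
  have sec_S: "vsec f s \<in> verts ?T" if "s \<in> verts ?S" for s
    using that sec_mem(1)[OF f] by (auto simp: verts_S) (auto simp: vertex_fiber_def)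
  have "Digraph_Component.connected ?S"
    unfolding connected_iff_locally_constant[OF S.wf_digraph]
  proof (intro conjI allI impI ballI)
    show "verts ?S \<noteq> {}" using con c_T by blast
    fix Q :: "nat \<Rightarrow> bool" and u v
    assume Q: "\<forall>e\<in>arcs ?S. Q (tail ?S e) = Q (head ?S e)" and uv: "u \<in> verts ?S" "v \<in> verts ?S"
    \<comment> \<open>Pulled back along the collapse, \<open>Q\<close> is still locally constant: an
      old edge keeps its ends, and both ends of a dropped leaf edge go to
      \<open>vs ! i\<close>.\<close>
    have "Q (?c (tail ?T e)) = Q (?c (head ?T e))" if e: "e \<in> arcs ?T" for e
    proof (cases "e \<in> arcs ?S")
      case True
      then have "e \<in> arcs G" by (simp add: arcs_S)
      then show ?thesis using Q[rule_format, OF True] by (simp add: ends)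
    next
      case False
      then obtain i j where "e = la i j" "i < r" "j < ms ! i" "j \<notin> f i ` {..<ks ! i}"
        using leaf_T[OF e] by blast
      then show ?thesis by (simp add: ends collapse_dropped)
    qed
    then have "Q (?c (vsec f u)) = Q (?c (vsec f v))"
      using con[THEN conjunct2, rule_format, of "\<lambda>x. Q (?c x)"] sec_S uv by blast
    moreover have "?c (vsec f u) = u" "?c (vsec f v) = v"
      using uv collapse_vsec[OF f] by (auto simp: verts_S)
    ultimately show "Q u = Q v" by simp
  qed
  then show ?thesis using genus by (simp add: graph_of_genus_def S.fin_digraph_axioms)
qed

text \<open>The unique edge over \<open>e'\<close> is not contracted by \<phi>, so it is old or a
  kept leaf edge and lies in the range of \<open>asec f\<close>, which is injective on
  \<open>arcs (X ks)\<close>.\<close>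

lemma restr_contraction: "contraction (X ks) H (restr ks f \<phi>)"
  unfolding contraction_def
proof (intro conjI ballI restr_morphism restr_fiber)
  fix e' assume "e' \<in> arcs H"
  then obtain e b where e: "e \<in> arcs (X ms)" "emap \<phi> e = Some (e', b)"
    and uniq: "\<And>a b. a \<in> arcs (X ms) \<Longrightarrow> emap \<phi> a = Some (e', b) \<Longrightarrow> a = e"
    using \<phi> unfolding contraction_def by (metis (no_types, lifting))
  have "\<exists>a\<in>arcs (X ks). asec f a = e"
    using e(1)
  proof (cases rule: arc_X_cases)
    case 1
    then show ?thesis by (intro bexI[of _ e]) auto
  next
    case (2 i j)
    then obtain k where "k < ks ! i" "j = f i k" using kept_iff[of i j] e(2) by auto
    then show ?thesis using 2 by (intro bexI[of _ "la i k"]) auto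
  qed
  then obtain a where a: "a \<in> arcs (X ks)" "asec f a = e" by blast
  show "\<exists>!a. a \<in> arcs (X ks) \<and> (\<exists>b. emap (restr ks f \<phi>) a = Some (e', b))"
  proof (rule ex1I[of _ a])
    show "a \<in> arcs (X ks) \<and> (\<exists>b. emap (restr ks f \<phi>) a = Some (e', b))"
      using a e(2) by (simp add: restr_def)
    fix a' assume a': "a' \<in> arcs (X ks) \<and> (\<exists>b. emap (restr ks f \<phi>) a' = Some (e', b))"
    then have "asec f a' = e" using uniq[of "asec f a'"] sec_mem(2)[OF f] by (auto simp: restr_def)
    then show "a' = a" using asec_inj[OF f, of a' a] a a' by simp
  qed
qed

end

text \<open>A contraction onto a graph with at most \<open>d\<close> edges can keep at most \<open>d\<close> leaves.\<close>

lemma contraction_factors: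
  assumes \<phi>: "contraction (X ms) H \<phi>" and H: "finite (arcs H)" "card (arcs H) \<le> d"
  shows "\<exists>ks f \<psi>. length ks = r \<and> sum_list ks \<le> d \<and> leaf_inj ks ms f \<and>
    (\<forall>i<r. \<forall>k k'. k < k' \<and> k' < ks ! i \<longrightarrow> f i k < f i k') \<and>
    contraction (X ks) H \<psi> \<and> \<phi> = comp_map (X ms) \<psi> (collapse ms ks f)"
proof -
  define K where "K i = {j. j < ms ! i \<and> emap \<phi> (la i j) \<noteq> None}" for i
  define ks where "ks = map (\<lambda>i. card (K i)) [0..<r]"
  \<comment> \<open>The surviving leaves are enumerated in increasing order; any permutation of them
    that \<phi> performs is left to \<psi>.\<close>
  define f where "f i k = sorted_list_of_set (K i) ! k" for i k
  have finK: "finite (K i)" for i by (simp add: K_def)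
  have ks: "length ks = r" "\<And>i. i < r \<Longrightarrow> ks ! i = card (K i)" by (simp_all add: ks_def)
  have len: "length (sorted_list_of_set (K i)) = card (K i)" for i by simp
  have im: "f i ` {..<ks ! i} = K i" if "i < r" for i
  proof -
    have "f i ` {..<ks ! i} = set (sorted_list_of_set (K i))"
      using ks(2)[OF that] len[of i] by (force simp: f_def in_set_conv_nth image_iff)
    then show ?thesis using finK by simp
  qed
  have mono: "f i k < f i k'" if "i < r" "k < k'" "k' < ks ! i" for i k k'
    using strict_sorted_list_of_set[of "K i"] that ks(2) by (simp add: f_def sorted_wrt_nth_less)
  have f: "leaf_inj ks ms f"
    unfolding inj_tuple_def
  proof (intro allI impI conjI)
    fix i assume i: "i < r"
    show "inj_on (f i) {..<ks ! i}"
      using mono[OF i] by (intro linorder_inj_onI) (auto simp: neq_iff)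
    show "f i ` {..<ks ! i} \<subseteq> {..<ms ! i}" using im[OF i] by (auto simp: K_def)
  qed
  have kept_iff: "j \<in> f i ` {..<ks ! i} \<longleftrightarrow> emap \<phi> (la i j) \<noteq> None" if "i < r" "j < ms ! i" for i j
    using im that by (simp add: K_def)
  \<comment> \<open>\<open>t\<close> sends a surviving leaf edge to its image in \<open>H\<close>.
    Each edge of \<open>H\<close> has only one preimage, so \<open>t\<close> is injective and
    \<open>card (arcs H)\<close> bounds the number of surviving leaves.\<close>
  define t where "t = (\<lambda>(i, j). fst (the (emap \<phi> (la i j))))"
  have t: "t (i, j) \<in> arcs H \<and> (\<exists>b. emap \<phi> (la i j) = Some (t (i, j), b))"
    if ij: "i < r" "j \<in> K i" for i j
  proof -
    have "la i j \<in> arcs (X ms)" using ij by (simp add: K_def)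
    then show ?thesis
      using ij \<phi> unfolding contraction_def graph_morphism_def
      by (fastforce simp: K_def t_def split: option.splits)
  qed
  have "inj_on t (SIGMA i:{..<r}. K i)"
  proof (rule inj_onI)
    fix x y assume xy: "x \<in> (SIGMA i:{..<r}. K i)" "y \<in> (SIGMA i:{..<r}. K i)" "t x = t y"
    obtain i j where x: "x = (i, j)" "i < r" "j \<in> K i" using xy by auto
    obtain i' j' where y: "y = (i', j')" "i' < r" "j' \<in> K i'" using xy by auto
    have "la i j \<in> arcs (X ms)" "la i' j' \<in> arcs (X ms)" using x y by (auto simp: K_def)
    then have "la i j = la i' j'"
      using t[of i j] t[of i' j'] x y xy(3) \<phi> unfolding contraction_def by metis
    then show "x = y" using x y by simp
  qed
  moreover have "t ` (SIGMA i:{..<r}. K i) \<subseteq> arcs H" using t by auto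
  ultimately have "card (SIGMA i:{..<r}. K i) \<le> card (arcs H)" using H(1) by (rule card_inj_on_le)
  moreover have "card (SIGMA i:{..<r}. K i) = (\<Sum>i<r. card (K i))" using finK by (simp add: card_SigmaI)
  moreover have "sum_list ks = (\<Sum>i<r. card (K i))"
    unfolding ks_def by (simp add: interv_sum_list_conv_sum_set_nat atLeast0LessThan)
  ultimately have "sum_list ks \<le> d" using H by simp
  then show ?thesis
    using ks(1) f mono restr_contraction[OF f \<phi> kept_iff] comp_restr[OF f \<phi> kept_iff, symmetric]
    by blast
qed

end

section \<open>The Hilbert polynomial\<close>

text \<open>By \<open>contraction_factors\<close>, what a generator of \<open>N\<close> contributes
  to the space at \<open>X ms\<close> already comes, through a collapse, from the space at some
  \<open>X ks\<close> with \<open>sum_list ks \<le> d\<close>.\<close>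

lemma (in sprouting) tuple_module_of_rep:
  fixes N :: "('k :: field, 'w) graph_rep"
  assumes N: "is_graph_rep g N" and fg: "fin_gen_in_degrees_le g d N"
  shows "\<exists>gens. tuple_module class_ring r d (\<lambda>ms. rep_obj N (X ms))
    (\<lambda>ks ms f. rep_map N (X ms) (X ks) (collapse ms ks f)) gens"
proof -
  obtain U :: "(cw_graph \<times> 'w) set" where U: "finite U"
    "\<And>H u. (H, u) \<in> U \<Longrightarrow> graph_of_genus g H \<and> card (arcs H) \<le> d \<and> u \<in> carrier (rep_obj N H)"
    "\<And>G. graph_of_genus g G \<Longrightarrow> LinearCombinations.module.span class_ring (rep_obj N G)
          {rep_map N G H \<phi> u | H u \<phi>. (H, u) \<in> U \<and> contraction G H \<phi>} = carrier (rep_obj N G)"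
    using fg unfolding fin_gen_in_degrees_le_def by blast
  have vs: "vectorspace class_ring (rep_obj N Y)" if "graph_of_genus g Y" for Y
    using N that unfolding is_graph_rep_def by blast
  have lin: "linear_map class_ring (rep_obj N H) (rep_obj N Y) (rep_map N Y H \<phi>)"
    if "graph_of_genus g Y" "graph_of_genus g H" "contraction Y H \<phi>" for Y H \<phi>
    using N that unfolding is_graph_rep_def by blast
  have comp: "rep_map N Y L (comp_map Y \<psi> \<phi>) x = rep_map N Y H \<phi> (rep_map N H L \<psi> x)"
    if "graph_of_genus g Y" "graph_of_genus g H" "graph_of_genus g L"
      "contraction Y H \<phi>" "contraction H L \<psi>" "x \<in> carrier (rep_obj N L)" for Y H L \<phi> \<psi> x
    using N that unfolding is_graph_rep_def by blast
  define W where "W = (\<Union>ks\<in>{ks. length ks = r \<and> sum_list ks \<le> d}. \<Union>(H, u)\<in>U.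
    (\<lambda>\<psi>. (ks, rep_map N (X ks) H \<psi> u)) ` {\<psi>. contraction (X ks) H \<psi>})"
  have "finite {ks :: nat list. length ks = r \<and> sum_list ks \<le> d}"
  proof (rule finite_subset)
    show "{ks :: nat list. length ks = r \<and> sum_list ks \<le> d} \<subseteq> {ks. set ks \<subseteq> {..d} \<and> length ks = r}"
      using member_le_sum_list by (fastforce intro: order_trans)
  qed (rule finite_lists_length_eq, simp)
  then have "finite W"
    unfolding W_def using U(1,2) finite_contractions[OF fin_digraph_X]
    by (intro finite_UN_I) (auto simp: graph_of_genus_def intro!: finite_imageI)
  then obtain gens where gens: "set gens = W" using finite_list by blast
  have W: "\<exists>H u \<psi>. length ks = r \<and> sum_list ks \<le> d \<and> (H, u) \<in> U \<and> contraction (X ks) H \<psi> \<and>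
      w = rep_map N (X ks) H \<psi> u" if "(ks, w) \<in> W" for ks w
    using that by (auto simp: W_def)
  have "tuple_module class_ring r d (\<lambda>ms. rep_obj N (X ms))
    (\<lambda>ks ms f. rep_map N (X ms) (X ks) (collapse ms ks f)) gens"
  proof (rule tuple_module.intro)
    show "vectorspace class_ring (rep_obj N (X ms))" for ms by (rule vs[OF genus_X])
    show "linear_map class_ring (rep_obj N (X ks)) (rep_obj N (X ms)) (rep_map N (X ms) (X ks) (collapse ms ks f))"
      if "leaf_inj ks ms f" for ks ms f
      by (rule lin[OF genus_X genus_X collapse_contraction[OF that]])
    show "rep_map N (X ns) (X ms) (collapse ns ms h) (rep_map N (X ms) (X ks) (collapse ms ks f) x) =
        rep_map N (X ns) (X ks) (collapse ns ks (\<lambda>i k. h i (f i k))) x"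
      if f: "leaf_inj ks ms f" and h: "leaf_inj ms ns h" and x: "x \<in> carrier (rep_obj N (X ks))"
      for ks ms ns f h x
      using comp[OF genus_X genus_X genus_X collapse_contraction[OF h] collapse_contraction[OF f] x]
      by (simp add: collapse_comp[OF f h])
    show "rep_map N (X ms) (X ks) (collapse ms ks f) = rep_map N (X ms) (X ks) (collapse ms ks f')"
      if "\<And>i k. i < r \<Longrightarrow> k < ks ! i \<Longrightarrow> f i k = f' i k" for ks ms f f'
      using collapse_cong[OF that] by simp
    show "length ks = r \<and> sum_list ks \<le> d \<and> w \<in> carrier (rep_obj N (X ks))"
      if kw: "(ks, w) \<in> set gens" for ks w
    proof -
      obtain H u \<psi> where *: "length ks = r" "sum_list ks \<le> d" "(H, u) \<in> U" "contraction (X ks) H \<psi>"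
        "w = rep_map N (X ks) H \<psi> u" using W[of ks w] kw gens by blast
      interpret \<psi>: linear_map class_ring "rep_obj N H" "rep_obj N (X ks)" "rep_map N (X ks) H \<psi>"
        using U(2)[OF *(3)] *(4) by (intro lin genus_X) auto
      show ?thesis using * U(2)[OF *(3)] \<psi>.T_im by blast
    qed
    fix ms :: "nat list" assume ms: "length ms = r"
    interpret V: vectorspace class_ring "rep_obj N (X ms)" by (rule vs[OF genus_X])
    let ?T = "{rep_map N (X ms) (X ks) (collapse ms ks f) w | ks w f. (ks, w) \<in> set gens \<and>
        leaf_inj ks ms f \<and> (\<forall>i<r. \<forall>k k'. k < k' \<and> k' < ks ! i \<longrightarrow> f i k < f i k')}"
    have "{rep_map N (X ms) H \<phi> u | H u \<phi>. (H, u) \<in> U \<and> contraction (X ms) H \<phi>} \<subseteq> ?T"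
    proof
      fix y assume "y \<in> {rep_map N (X ms) H \<phi> u | H u \<phi>. (H, u) \<in> U \<and> contraction (X ms) H \<phi>}"
      then obtain H u \<phi> where y: "y = rep_map N (X ms) H \<phi> u" "(H, u) \<in> U" "contraction (X ms) H \<phi>"
        by blast
      have H: "graph_of_genus g H" "card (arcs H) \<le> d" "u \<in> carrier (rep_obj N H)" "finite (arcs H)"
        using U(2)[OF y(2)] by (auto simp: graph_of_genus_def fin_digraph_def fin_digraph_axioms_def)
      obtain ks f \<psi> where *: "length ks = r" "sum_list ks \<le> d" "leaf_inj ks ms f"
        "\<forall>i<r. \<forall>k k'. k < k' \<and> k' < ks ! i \<longrightarrow> f i k < f i k'"
        "contraction (X ks) H \<psi>" "\<phi> = comp_map (X ms) \<psi> (collapse ms ks f)"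
        using contraction_factors[OF y(3) H(4,2)] by blast
      have "y = rep_map N (X ms) (X ks) (collapse ms ks f) (rep_map N (X ks) H \<psi> u)"
        unfolding y(1) *(6)
        by (rule comp[OF genus_X genus_X H(1) collapse_contraction[OF *(3)] *(5) H(3)])
      moreover have "(ks, rep_map N (X ks) H \<psi> u) \<in> set gens"
        unfolding gens W_def using * y(2) by blast
      ultimately show "y \<in> ?T" using *(3,4) by blast
    qed
    then show "carrier (rep_obj N (X ms)) \<subseteq> V.span ?T"
      using V.span_is_monotone U(3)[OF genus_X, of ms] by blast
  qed
  then show ?thesis by blast
qed

theorem corollary4p7:
  fixes M :: "('k :: field, 'v) graph_rep"
    and g d r :: nat
    and G :: cw_graph
    and vs :: "nat list"
  assumes "is_graph_rep g M"
    and "d_smallish TYPE('w) g d M"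
    and "graph_of_genus g G"
    and "length vs = r"
    and "distinct vs"
    and "set vs \<subseteq> verts G"
  shows "\<exists>f :: rat mpolynomial. mpoly_vars f \<subseteq> {..<r} \<and> total_degree_le f d \<and>
    (\<exists>N. \<forall>ms :: nat list. length ms = r \<and> (\<forall>i<r. N \<le> ms ! i) \<longrightarrow>
       vectorspace.fin_dim class_ring (rep_obj M (sprout G vs ms)) \<and>
       of_nat (vectorspace.dim class_ring (rep_obj M (sprout G vs ms))) =
         mpoly_eval f (\<lambda>i. of_nat (ms ! i)))"
proof -
  interpret sprouting g G vs using assms by unfold_locales
  obtain n F and N :: "('k, 'w) graph_rep" where F: "filtration g M n F"
    and N: "is_graph_rep g N" "fin_gen_in_degrees_le g d N"
    and sq: "subquotient_rep g (associated_graded M n F) N"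
    using assms(2) unfolding d_smallish_def d_small_def by blast
  obtain A B \<eta> where A: "subrep g N A" and B: "subrep g N B"
    and BA: "\<And>Y. graph_of_genus g Y \<Longrightarrow> B Y \<subseteq> A Y"
    and \<eta>: "\<And>Y. graph_of_genus g Y \<Longrightarrow> linear_map class_ring (rep_obj (associated_graded M n F) Y)
          (rep_obj (quotient_rep N A B) Y) (\<eta> Y)"
      "\<And>Y. graph_of_genus g Y \<Longrightarrow> bij_betw (\<eta> Y) (carrier (rep_obj (associated_graded M n F) Y))
          (carrier (rep_obj (quotient_rep N A B) Y))"
    using sq unfolding subquotient_rep_def rep_iso_def by blast
  obtain gens where "tuple_module class_ring (length vs) d (\<lambda>ms. rep_obj N (X ms))
    (\<lambda>ks ms f. rep_map N (X ms) (X ks) (collapse ms ks f)) gens"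
    using tuple_module_of_rep[OF N] by blast
  then interpret N: tuple_module class_ring "length vs" d "\<lambda>ms. rep_obj N (X ms)"
    "\<lambda>ks ms f. rep_map N (X ms) (X ks) (collapse ms ks f)" gens .
  have sub: "VectorSpace.subspace class_ring (C (X ms)) (rep_obj N (X ms))"
    "leaf_inj ks ms f \<Longrightarrow> rep_map N (X ms) (X ks) (collapse ms ks f) ` C (X ks) \<subseteq> C (X ms)"
    if "subrep g N C" for C ks ms f
    using that genus_X collapse_contraction unfolding subrep_def by blast+
  have poly: "eventually_poly r d (\<lambda>ms.
      of_nat (vectorspace.dim class_ring (rep_obj N (X ms)\<lparr>carrier := A (X ms)\<rparr>)) -
      of_nat (vectorspace.dim class_ring (rep_obj N (X ms)\<lparr>carrier := B (X ms)\<rparr>)))"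
    using N.eventually_poly_dim_diff[of "\<lambda>ms. A (X ms)" "\<lambda>ms. B (X ms)"] sub A B assms(4) by simp
  \<comment> \<open>\<open>M\<close> has the dimension of its associated graded module, which is
    isomorphic to \<open>A / B\<close>. Finite dimension travels the same way, starting from the
    finite set of monomials that spans \<open>N\<close>.\<close>
  have dims: "vectorspace.fin_dim class_ring (rep_obj M (X ms)) \<and>
      vectorspace.dim class_ring (rep_obj N (X ms)\<lparr>carrier := A (X ms)\<rparr>) =
      vectorspace.dim class_ring (rep_obj M (X ms)) +
      vectorspace.dim class_ring (rep_obj N (X ms)\<lparr>carrier := B (X ms)\<rparr>)"
    if ms: "length ms = r" for ms
  proof -
    let ?Y = "X ms"
    let ?D = "rep_obj (associated_graded M n F) ?Y" and ?V = "rep_obj M ?Y"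
    let ?Q = "quotient_module (rep_obj N ?Y) (A ?Y) (B ?Y)"
    have N_vs: "vectorspace class_ring (rep_obj N ?Y)" and fdN: "vectorspace.fin_dim class_ring (rep_obj N ?Y)"
      using N.vectorspace_V[of ms] N.fin_dim_V[of ms] ms assms(4) by simp_all
    note quot = dim_quotient_module[OF N_vs fdN sub(1)[OF A] sub(1)[OF B] BA[OF genus_X]]
    interpret \<eta>: linear_map class_ring ?D ?Q "\<eta> ?Y"
      using \<eta>(1)[OF genus_X, of ms] by (simp add: quotient_rep_def)
    have "bij_betw (\<eta> ?Y) (carrier ?D) (carrier ?Q)"
      using \<eta>(2)[OF genus_X, of ms] by (simp add: quotient_rep_def)
    note D = \<eta>.iso_dim[OF this quot(1)]
    have V_vs: "vectorspace class_ring ?V" using assms(1) genus_X unfolding is_graph_rep_def by blast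
    have Fsubrep: "subrep g M (F i)" if "i \<le> n" for i
      using F that by (simp add: filtration_def)
    have Fsub: "VectorSpace.subspace class_ring (F i ?Y) ?V" if "i \<le> n" for i
      using Fsubrep[OF that] genus_X by (simp add: subrep_def)
    have "F 0 ?Y = {\<zero>\<^bsub>?V\<^esub>} \<and> (\<forall>i<n. F i ?Y \<subseteq> F (Suc i) ?Y) \<and> F n ?Y = carrier ?V"
      using F genus_X by (simp add: filtration_def)
    then have F0: "F 0 ?Y = {\<zero>\<^bsub>?V\<^esub>}" and Fn: "F n ?Y = carrier ?V"
      and Fle: "\<And>i. i < n \<Longrightarrow> F i ?Y \<subseteq> F (Suc i) ?Y" by simp_all
    let ?R = "\<lambda>i. quotient_module ?V (F (Suc i) ?Y) (F i ?Y)" and ?\<pi> = "\<lambda>i x. F i ?Y +>\<^bsub>?V\<^esub> x"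
    have \<pi>: "linear_map class_ring (?V\<lparr>carrier := F (Suc i) ?Y\<rparr>) (?R i) (?\<pi> i)"
      "?\<pi> i ` F (Suc i) ?Y = carrier (?R i)"
      "mod_hom.ker (?V\<lparr>carrier := F (Suc i) ?Y\<rparr>) (?R i) (?\<pi> i) = F i ?Y" if "i < n" for i
      using linear_map_quotient_module[OF V_vs Fsub[of "Suc i"] Fsub[of i] Fle[OF that]] that by simp_all
    have D_simps: "carrier ?D = (\<Pi>\<^sub>E i\<in>{..<n}. carrier (?R i))" "\<zero>\<^bsub>?D\<^esub> = (\<lambda>i\<in>{..<n}. \<zero>\<^bsub>?R i\<^esub>)"
      "\<And>x y. x \<oplus>\<^bsub>?D\<^esub> y = (\<lambda>i\<in>{..<n}. x i \<oplus>\<^bsub>?R i\<^esub> y i)"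
      "\<And>c x. c \<odot>\<^bsub>?D\<^esub> x = (\<lambda>i\<in>{..<n}. c \<odot>\<^bsub>?R i\<^esub> x i)"
      by (simp_all add: associated_graded_def direct_sum_rep_def quotient_rep_def)
    have "vectorspace.fin_dim class_ring ?V"
      by (rule dim_filtration(1)[of class_ring ?V ?D n ?R "\<lambda>i. F i ?Y" ?\<pi>,
            OF V_vs \<eta>.V.vectorspace_axioms D(1) D_simps Fsub F0 Fn \<pi>])
    moreover have "vectorspace.dim class_ring ?V = vectorspace.dim class_ring ?D"
      by (rule dim_filtration(2)[of class_ring ?V ?D n ?R "\<lambda>i. F i ?Y" ?\<pi>,
            OF V_vs \<eta>.V.vectorspace_axioms D(1) D_simps Fsub F0 Fn \<pi>])
    ultimately show ?thesis using quot(2) D(2) by simp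
  qed
  \<comment> \<open>From here on \<open>N\<close> is the threshold of the conclusion and no longer
    the finitely generated module.\<close>
  obtain p N where p: "poly_fun r d p" "\<And>ms. length ms = r \<and> (\<forall>i<r. N \<le> ms ! i) \<Longrightarrow>
      of_nat (vectorspace.dim class_ring (rep_obj M (X ms))) = p (\<lambda>i. of_nat (ms ! i))"
  proof -
    have "eventually_poly r d (\<lambda>ms. of_nat (vectorspace.dim class_ring (rep_obj M (X ms))))"
      by (rule eventually_poly_cong[OF poly]) (simp add: dims)
    then show ?thesis using that unfolding eventually_poly_def by blast
  qed
  obtain f :: "rat mpolynomial" where f: "mpoly_vars f \<subseteq> {..<r}" "total_degree_le f d"
    "\<And>x. mpoly_eval f x = p x"
    using poly_fun_imp_mpolynomial[OF p(1)] by blast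
  show ?thesis using f p(2) dims by (intro exI[of _ f] conjI exI[of _ N] allI impI) auto
qed

end
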